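(* Let $\{Z_{ik}\}_{i,k\ge1}$ be independent and identically distributed real random variables with mean $0$, variance $\tfrac12$ and finite fourth moment. Let $p=p(n)$ be positive integers with $p/n\to y\in(0,1)$ as $n\to\infty$. For each $n\ge2$ put $Z_i=(Z_{i1},\ldots,Z_{ip})^T$ for $i=1,\ldots,n$, let $\mu=\mu_p\in\mathbb{R}^p$ be a nonrandom vector, let $\Sigma=\Sigma_p$ be a nonrandom real $p\times p$ Hermitian (i.e. symmetric) positive-definite matrix, with $\sup_p\|\Sigma_p\|<\infty$, and put $X_i=\mu+\Sigma^{1/2}Z_i$ for $i=1,\ldots,n$. Let $$K_n=\frac{2}{n(n-1)}\sum_{1\le i<j\le n}\frac{(X_i-X_j)(X_i-X_j)^T}{\|X_i-X_j\|^2}.$$ Let $H_p$ be the empirical spectral distribution of $\tfrac12\Sigma$, and assume that $H_p$ converges weakly to a probability distribution function $H$ as $p\to\infty$. Then, almost surely, the empirical spectral distribution of $\tfrac12\,\mathrm{tr}(\Sigma)\,K_n$ (the matrix $K_n$ multiplied by the scalar $\tfrac12\mathrm{tr}(\Sigma)$) converges weakly, as $n\to\infty$, to a nonrandom probability distribution $F$ whose Stieltjes transform $m_F(z)$ satisfies $$m_F(z)=\int\frac{1}{\tau\,(1-y-yz\,m_F(z))-z}\,dH(\tau)\qquad\text{for all } z\in\mathbb{C}^+.$$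
   Context: $\|\cdot\|$ is the Euclidean norm for vectors and the spectral (operator) norm for matrices; $\mathrm{tr}$ is the trace; $^T$ is transpose; $\Sigma^{1/2}$ is the positive-definite square root. $\mathbb{C}^+=\{z\in\mathbb{C}:\mathrm{Im}(z)>0\}$. For a real symmetric $p\times p$ matrix $A$ with eigenvalues $\lambda_1,\ldots,\lambda_p$ (counted with multiplicity), its empirical spectral distribution is $F^A(x)=\frac1p\sum_{i=1}^p\mathbf 1(\lambda_i\le x)$. The Stieltjes transform of a probability distribution $F$ on $\mathbb{R}$ is $m_F(z)=\int\frac{1}{\lambda-z}\,dF(\lambda)$, $z\in\mathbb{C}^+$. $K_n$ is the sample multivariate Kendall-$\tau$ matrix. Convention: a summand of $K_n$ with $X_i=X_j$ is interpreted as the zero matrix. *)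

theory Defs
  imports
    "HOL-Probability.Probability"
    "Jordan_Normal_Form.Char_Poly"
begin

(* HOL-Analysis and Jordan_Normal_Form both use $ and the inner-product dot;
   everything below is about the matrices and vectors of Jordan_Normal_Form. *)
unbundle no vec_syntax
unbundle no inner_syntax

definition vec_norm :: "real vec \<Rightarrow> real" where
  "vec_norm v = sqrt (v \<bullet> v)"

definition spectral_norm :: "real mat \<Rightarrow> real" where
  "spectral_norm A =
     (SUP v\<in>{v \<in> carrier_vec (dim_col A). vec_norm v = 1}. vec_norm (A *\<^sub>v v))"

definition mat_trace :: "real mat \<Rightarrow> real" where
  "mat_trace A = (\<Sum>i<dim_row A. A $$ (i, i))"

definition pos_def_mat :: "real mat \<Rightarrow> bool" where
  "pos_def_mat A \<longleftrightarrow> square_mat A \<and> transpose_mat A = A \<and>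
     (\<forall>v \<in> carrier_vec (dim_row A). v \<noteq> 0\<^sub>v (dim_row A) \<longrightarrow> v \<bullet> (A *\<^sub>v v) > 0)"

(* Only meaningful for a positive-definite A, where the square root exists and is unique. *)
definition mat_sqrt :: "real mat \<Rightarrow> real mat" where
  "mat_sqrt A = (THE B. B \<in> carrier_mat (dim_row A) (dim_row A) \<and> pos_def_mat B \<and> B * B = A)"

(* proots is the multiset of roots, so eigenvalues are counted with multiplicity;
   for a real symmetric A all dim_row A eigenvalues are real and hence are counted. *)
definition esd :: "real mat \<Rightarrow> real \<Rightarrow> real" where
  "esd A x = real (size (filter_mset (\<lambda>l. l \<le> x) (proots (char_poly A)))) / real (dim_row A)"

definition stieltjes :: "real measure \<Rightarrow> complex \<Rightarrow> complex" where
  "stieltjes F z = (LINT l|F. 1 / (complex_of_real l - z))"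

definition outer_prod :: "real vec \<Rightarrow> real mat" where
  "outer_prod v = mat (dim_vec v) (dim_vec v) (\<lambda>(a, b). v $ a * v $ b)"

definition kendall_summand :: "real vec \<Rightarrow> real vec \<Rightarrow> real mat" where
  "kendall_summand u v =
     (if u = v then 0\<^sub>m (dim_vec u) (dim_vec u)
      else (1 / (vec_norm (u - v))\<^sup>2) \<cdot>\<^sub>m outer_prod (u - v))"

(* The sum over i < j is taken entrywise, as matrices of varying size are not a
   commutative monoid under addition. *)
definition kendall_tau :: "nat \<Rightarrow> nat \<Rightarrow> (nat \<Rightarrow> real vec) \<Rightarrow> real mat" where
  "kendall_tau p n X = (2 / (real n * (real n - 1))) \<cdot>\<^sub>m
     mat p p (\<lambda>(a, b). \<Sum>(i, j) \<in> {(i, j). 1 \<le> i \<and> i < j \<and> j \<le> n}.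
       kendall_summand (X i) (X j) $$ (a, b))"

(* Vector indices start at 0, so the k-th entry (k < p) of the i-th vector is Z i (k + 1). *)
definition observation ::
  "nat \<Rightarrow> real vec \<Rightarrow> real mat \<Rightarrow> (nat \<Rightarrow> nat \<Rightarrow> 'a \<Rightarrow> real) \<Rightarrow> 'a \<Rightarrow> nat \<Rightarrow> real vec" where
  "observation p mu Sig Z \<omega> i = mu + mat_sqrt Sig *\<^sub>v vec p (\<lambda>k. Z i (Suc k) \<omega>)"

end

theory Submission
  imports Defs "HOL-Probability.Hoeffding"
begin

text \<open>Write \<open>T = \<Sigma> / 2\<close> for the covariance matrix of an observation. A difference \<open>X\<^sub>i - X\<^sub>j\<close> has
  covariance \<open>\<Sigma>\<close>, and its squared norm is \<open>tr \<Sigma>\<close> up to an error of order \<open>\<surd>p\<close> in mean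
  (\<open>quadratic_form_variance\<close>). After multiplication by \<open>tr \<Sigma> / 2\<close> the normalisation in the Kendall
  matrix therefore nearly disappears, and what is left is the sample covariance matrix \<open>B\<close>. The
  comparison is made for Stieltjes transforms: the normalised trace of a resolvent at \<open>z\<close> changes by
  at most the trace norm of the perturbation divided by \<open>p (Im z)\<^sup>2\<close>
  (\<open>resolvent_gram_perturbation\<close>), and trace norms of sums of rank-one matrices are estimated term
  by term. This gives closeness in mean (\<open>kendall_sample_close\<close>) from fourth moments alone, with no
  truncation and no bound on operator norms of random matrices.

  The Stieltjes transform of the Kendall matrix moves by \<open>O(1 / N)\<close> when one of the \<open>N\<close>
  observations is replaced, because every summand has trace norm at most \<open>tr \<Sigma> / (N (N - 1))\<close>
  and an observation occurs in \<open>N - 1\<close> of them. The bounded differences inequality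
  (\<open>bounded_differences_tail\<close>) makes deviations from the mean exponentially unlikely in \<open>N\<close>, so by
  Borel-Cantelli only the means have to be understood (\<open>concentration_AE\<close>).

  For the sample covariance matrix, removing one observation from a resolvent makes the two
  independent, and quadratic forms may be replaced by traces. A bound for the errors
  (\<open>deterministic_equivalent_bound\<close>), when averaged (\<open>deterministic_equivalent_expectation\<close>),
  shows that the mean transform \<open>E\<close> is close to the normalised trace of \<open>(a T - z)\<^sup>-\<^sup>1\<close> with
  \<open>a = 1 - p/N - (p/N) z E\<close>. Limit points of \<open>E\<close> thus solve the equation in the theorem; the
  solution with \<open>Im a \<le> 0\<close> is unique (\<open>sol_unique\<close>), so \<open>E\<close> converges.

  Convergence of the transforms on a countable dense set of points, together with tightness from a
  bound on the trace, gives weak convergence of the spectral distributions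
  (\<open>stieltjes_continuity\<close>), since a distribution is determined by its Stieltjes transform.\<close>

section \<open>The spectral theorem for real symmetric matrices\<close>

text \<open>A reflection exchanging \<open>v\<close> and the first unit vector; its columns form an orthonormal basis
  that starts with \<open>v\<close>.\<close>
lemma householder_completion:
  fixes v :: "real vec"
  assumes v: "v \<in> carrier_vec n" and unit: "v \<bullet> v = 1" and n: "n > 0"
  shows "\<exists>W \<in> carrier_mat n n. transpose_mat W * W = 1\<^sub>m n \<and> W * transpose_mat W = 1\<^sub>m n \<and> col W 0 = v"
proof -
  define u where "u = v - unit_vec n 0"
  have u: "u \<in> carrier_vec n" using v by (simp add: u_def)
  \<comment> \<open>If \<open>v\<close> already is the first unit vector, then \<open>u = 0\<close> and \<open>c = 2 / 0 = 0\<close>, and the reflection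
    degenerates to the identity.\<close>
  define c where "c = 2 / (u \<bullet> u)"
  define W where "W = mat n n (\<lambda>(i, j). (if i = j then 1 else 0) - c * u $ i * u $ j)"
  have W: "W \<in> carrier_mat n n" by (simp add: W_def)
  have sym: "transpose_mat W = W" by (rule eq_matI) (auto simp: W_def)
  have uu: "u \<bullet> u = (\<Sum>i<n. u $ i * u $ i)"
    using u by (simp add: scalar_prod_def atLeast0LessThan)
  have cuu: "c * c * (u \<bullet> u) = 2 * c" by (simp add: c_def)
  have vv: "(\<Sum>i<n. v $ i * v $ i) = 1"
    using v unit by (simp add: scalar_prod_def atLeast0LessThan)
  have u_i: "u $ i = v $ i - (if i = 0 then 1 else 0)" if "i < n" for i
    using that v by (simp add: u_def unit_vec_def)
  have uu2: "u \<bullet> u = 2 - 2 * v $ 0"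
  proof -
    have "u \<bullet> u = (\<Sum>i<n. v $ i * v $ i - (if i = 0 then 2 * v $ 0 - 1 else 0))"
      unfolding uu by (intro sum.cong) (auto simp: u_i algebra_simps)
    also have "\<dots> = 1 - (2 * v $ 0 - 1)"
      using n by (simp add: sum_subtractf vv sum.delta)
    finally show ?thesis by simp
  qed
  have WW: "W * W = 1\<^sub>m n"
  proof (rule eq_matI)
    fix i j assume "i < dim_row (1\<^sub>m n :: real mat)" "j < dim_col (1\<^sub>m n :: real mat)"
    hence ij: "i < n" "j < n" by auto
    have "(W * W) $$ (i, j) = (\<Sum>k<n. W $$ (i, k) * W $$ (k, j))"
      using W ij by (simp add: scalar_prod_def atLeast0LessThan)
    also have "\<dots> = (\<Sum>k<n. (if k = i then (if i = j then 1 else 0) - c * u $ i * u $ j else 0)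
        - (if k = j then c * u $ i * u $ j else 0) + (c * c * u $ i * u $ j) * (u $ k * u $ k))"
      using ij by (intro sum.cong) (auto simp: W_def algebra_simps)
    also have "\<dots> = (if i = j then 1 else 0) - 2 * c * u $ i * u $ j + (c * c * (u \<bullet> u)) * u $ i * u $ j"
      using ij by (simp add: sum.distrib sum_subtractf sum.delta uu flip: sum_distrib_left)
    also have "\<dots> = (if i = j then 1 else 0)" unfolding cuu by simp
    finally show "(W * W) $$ (i, j) = 1\<^sub>m n $$ (i, j)" using ij by simp
  qed (use W in auto)
  have "col W 0 = v"
  proof (rule eq_vecI)
    fix i assume "i < dim_vec v"
    hence i: "i < n" using v by simp
    have "c * u $ 0 = - 1" if "u $ i \<noteq> 0"
    proof -
      have "u \<bullet> u \<noteq> 0"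
      proof
        assume "u \<bullet> u = 0"
        hence "\<forall>k\<in>{..<n}. u $ k * u $ k = 0" unfolding uu by (subst (asm) sum_nonneg_eq_0_iff) auto
        thus False using that i by auto
      qed
      thus ?thesis using n by (simp add: c_def u_i uu2 field_simps)
    qed
    moreover have "c * u $ i * u $ 0 = (c * u $ 0) * u $ i" by simp
    ultimately have "c * u $ i * u $ 0 = - u $ i" by (cases "u $ i = 0") auto
    thus "col W 0 $ i = v $ i" using i n W by (auto simp: W_def u_i)
  qed (use v W in auto)
  thus ?thesis using W WW sym by (intro bexI[of _ W]) auto
qed

text \<open>The terms with imaginary coefficients cancel in pairs by symmetry of \<open>A\<close>. This is used for
  eigenvalues being real and for the lower bound on shifted matrices.\<close>
lemma symmetric_form_real:
  fixes A :: "real mat" and v :: "nat \<Rightarrow> complex"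
  assumes "\<And>i j. i < n \<Longrightarrow> j < n \<Longrightarrow> A $$ (i, j) = A $$ (j, i)"
  shows "(\<Sum>i<n. \<Sum>j<n. cnj (v i) * complex_of_real (A $$ (i, j)) * v j) =
     complex_of_real (\<Sum>i<n. \<Sum>j<n. A $$ (i, j) * (Re (v i) * Re (v j) + Im (v i) * Im (v j)))" (is "?L = of_real ?R")
proof (rule complex_eqI)
  show "Re ?L = Re (complex_of_real ?R)"
    by (simp add: algebra_simps)
  have "Im ?L = (\<Sum>i<n. \<Sum>j<n. A $$ (i, j) * Re (v i) * Im (v j) - A $$ (i, j) * Im (v i) * Re (v j))"
    by (simp add: algebra_simps)
  also have "\<dots> = (\<Sum>i<n. \<Sum>j<n. A $$ (i, j) * Re (v i) * Im (v j)) - (\<Sum>i<n. \<Sum>j<n. A $$ (i, j) * Im (v i) * Re (v j))"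
    by (simp add: sum_subtractf)
  also have "(\<Sum>i<n. \<Sum>j<n. A $$ (i, j) * Im (v i) * Re (v j)) = (\<Sum>j<n. \<Sum>i<n. A $$ (i, j) * Im (v i) * Re (v j))"
    by (rule sum.swap)
  also have "\<dots> = (\<Sum>i<n. \<Sum>j<n. A $$ (i, j) * Re (v i) * Im (v j))"
    by (intro sum.cong) (auto simp: assms)
  finally show "Im ?L = Im (complex_of_real ?R)" by simp
qed

lemma symmetric_mat_entries:
  assumes "A \<in> carrier_mat n n" "transpose_mat A = A" "i < n" "j < n"
  shows "A $$ (i, j) = A $$ (j, i)"
  using assms by (metis carrier_matD index_transpose_mat(1))

text \<open>Over the complex numbers the characteristic polynomial has a root \<open>k\<close>. For an eigenvector
  \<open>w\<close> of the root, \<open>k\<close> times the squared norm of \<open>w\<close> is the real number \<open>w\<^sup>* A w\<close>, so \<open>k\<close> is a real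
  root and already has a real eigenvector.\<close>
lemma symmetric_mat_unit_eigenvector:
  fixes A :: "real mat"
  assumes A: "A \<in> carrier_mat n n" and sym: "transpose_mat A = A" and n: "n > 0"
  shows "\<exists>v l. v \<in> carrier_vec n \<and> v \<bullet> v = 1 \<and> A *\<^sub>v v = l \<cdot>\<^sub>v v"
proof -
  let ?C = "map_mat complex_of_real A"
  have C: "?C \<in> carrier_mat n n" using A by simp
  have "\<not> constant (poly (char_poly ?C))"
    using degree_monic_char_poly[OF C] n constant_degree[of "char_poly ?C"] by simp
  then obtain k where k: "poly (char_poly ?C) k = 0" using fundamental_theorem_of_algebra by blast
  hence "eigenvalue ?C k" using eigenvalue_root_char_poly[OF C] by blast
  then obtain w where w: "w \<in> carrier_vec n" "w \<noteq> 0\<^sub>v n" "?C *\<^sub>v w = k \<cdot>\<^sub>v w"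
    unfolding eigenvalue_def eigenvector_def using C by auto
  have w_i: "(\<Sum>j<n. complex_of_real (A $$ (i, j)) * w $ j) = k * w $ i" if "i < n" for i
    using arg_cong[OF w(3), of "\<lambda>x. x $ i"] that A w(1) by (simp add: scalar_prod_def atLeast0LessThan)
  define N where "N = (\<Sum>i<n. (cmod (w $ i))\<^sup>2)"
  have "N \<noteq> 0"
  proof
    assume "N = 0"
    hence "\<forall>i\<in>{..<n}. (cmod (w $ i))\<^sup>2 = 0" unfolding N_def by (subst (asm) sum_nonneg_eq_0_iff) auto
    hence "w = 0\<^sub>v n" using w(1) by (intro eq_vecI) auto
    with w(2) show False by simp
  qed
  have "(\<Sum>i<n. \<Sum>j<n. cnj (w $ i) * complex_of_real (A $$ (i, j)) * w $ j) = (\<Sum>i<n. cnj (w $ i) * (k * w $ i))"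
    by (intro sum.cong) (auto simp: mult.assoc sum_distrib_left[symmetric] w_i)
  also have "\<dots> = k * of_real N"
    unfolding N_def of_real_sum sum_distrib_left
    by (intro sum.cong) (auto simp: complex_norm_square mult_ac simp del: of_real_power)
  finally have "k * of_real N = of_real (\<Sum>i<n. \<Sum>j<n. A $$ (i, j) * (Re (w $ i) * Re (w $ j) + Im (w $ i) * Im (w $ j)))"
    using symmetric_form_real[of n A "\<lambda>i. w $ i"] symmetric_mat_entries[OF A sym] by simp
  hence "Im (k * of_real N) = 0" by simp
  hence "Im k = 0" using \<open>N \<noteq> 0\<close> by simp
  hence kr: "k = of_real (Re k)" by (simp add: complex_eq_iff)
  have "poly (char_poly ?C) (of_real (Re k)) = of_real (poly (char_poly A) (Re k))"
    by (simp add: of_real_hom.char_poly_hom[OF A])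
  hence "poly (char_poly A) (Re k) = 0" using k kr by simp
  hence "eigenvalue A (Re k)" using eigenvalue_root_char_poly[OF A] by blast
  then obtain u where u: "u \<in> carrier_vec n" "u \<noteq> 0\<^sub>v n" "A *\<^sub>v u = Re k \<cdot>\<^sub>v u"
    unfolding eigenvalue_def eigenvector_def using A by auto
  have uu: "u \<bullet> u > 0"
  proof -
    have "u \<bullet> u = (\<Sum>i<n. u $ i * u $ i)" using u by (simp add: scalar_prod_def atLeast0LessThan)
    moreover have "(\<Sum>i<n. u $ i * u $ i) \<noteq> 0"
    proof
      assume "(\<Sum>i<n. u $ i * u $ i) = 0"
      hence "\<forall>i\<in>{..<n}. u $ i * u $ i = 0" by (subst (asm) sum_nonneg_eq_0_iff) auto
      hence "u = 0\<^sub>v n" using u(1) by (intro eq_vecI) auto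
      with u(2) show False by simp
    qed
    moreover have "(\<Sum>i<n. u $ i * u $ i) \<ge> 0" by (intro sum_nonneg) auto
    ultimately show ?thesis by linarith
  qed
  define v where "v = (1 / sqrt (u \<bullet> u)) \<cdot>\<^sub>v u"
  have "v \<in> carrier_vec n" using u by (simp add: v_def)
  moreover have "v \<bullet> v = 1" using u uu by (simp add: v_def)
  moreover have "A *\<^sub>v v = Re k \<cdot>\<^sub>v v"
    using u A by (simp add: v_def mult_mat_vec[of A n n] smult_smult_assoc mult.commute)
  ultimately show ?thesis by blast
qed

text \<open>Induction on the dimension by deflation: in an orthonormal basis starting with an
  eigenvector, the first column vanishes below the diagonal, by symmetry so does the first row to
  the right of it, and the remaining block is symmetric of smaller size.\<close>
theorem symmetric_mat_diagonalization:
  fixes A :: "real mat"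
  assumes "A \<in> carrier_mat n n" "transpose_mat A = A"
  shows "\<exists>U l. U \<in> carrier_mat n n \<and> transpose_mat U * U = 1\<^sub>m n \<and> U * transpose_mat U = 1\<^sub>m n
    \<and> A = U * mat_diag n l * transpose_mat U"
  using assms
proof (induction n arbitrary: A)
  case 0
  thus ?case by (intro exI[of _ "1\<^sub>m 0"] exI[of _ "\<lambda>_. 0"]) auto
next
  case (Suc n)
  let ?m = "Suc n"
  note A = Suc.prems(1) and sym = Suc.prems(2)
  obtain v e where v: "v \<in> carrier_vec ?m" "v \<bullet> v = 1" "A *\<^sub>v v = e \<cdot>\<^sub>v v"
    using symmetric_mat_unit_eigenvector[OF A sym] by auto
  obtain W where W: "W \<in> carrier_mat ?m ?m" and WtW: "transpose_mat W * W = 1\<^sub>m ?m"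
    and WWt: "W * transpose_mat W = 1\<^sub>m ?m" and cW: "col W 0 = v"
    using householder_completion[OF v(1,2)] by auto
  define B where "B = transpose_mat W * A * W"
  have B: "B \<in> carrier_mat ?m ?m" using W A by (auto simp: B_def)
  have Bsym: "transpose_mat B = B"
    using W A sym by (simp add: B_def transpose_mult[of _ ?m ?m _ ?m] assoc_mult_mat[of _ ?m ?m _ ?m _ ?m])
  have colB: "col B 0 = e \<cdot>\<^sub>v unit_vec ?m 0"
  proof -
    have "col B 0 = (transpose_mat W * A) *\<^sub>v v"
      unfolding B_def cW[symmetric] using W A by (intro col_mult2[of _ ?m ?m _ ?m]) auto
    also have "\<dots> = transpose_mat W *\<^sub>v (e \<cdot>\<^sub>v v)" using W A v by (simp add: assoc_mult_mat_vec[of _ ?m ?m _ ?m])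
    also have "\<dots> = e \<cdot>\<^sub>v (transpose_mat W *\<^sub>v col W 0)" using W v(1) unfolding cW by (simp add: mult_mat_vec[of _ ?m ?m])
    also have "transpose_mat W *\<^sub>v col W 0 = col (transpose_mat W * W) 0"
      using W by (intro eq_vecI) auto
    finally show ?thesis unfolding WtW by simp
  qed
  have B_i0: "B $$ (i, 0) = (if i = 0 then e else 0)" if "i < ?m" for i
    using arg_cong[OF colB, of "\<lambda>x. x $ i"] that B by (auto simp: unit_vec_def)
  have B_0i: "B $$ (0, i) = (if i = 0 then e else 0)" if "i < ?m" for i
    using symmetric_mat_entries[OF B Bsym, of 0 i] B_i0 that by simp
  define A3 where "A3 = mat n n (\<lambda>(i, j). B $$ (Suc i, Suc j))"
  have A3: "A3 \<in> carrier_mat n n" by (simp add: A3_def)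
  have A3sym: "transpose_mat A3 = A3"
    by (rule eq_matI) (auto simp: A3_def symmetric_mat_entries[OF B Bsym])
  have Bblock: "B = four_block_mat (mat 1 1 (\<lambda>_. e)) (0\<^sub>m 1 n) (0\<^sub>m n 1) A3"
    using B by (intro eq_matI) (auto simp: A3_def B_i0 B_0i)
  obtain U l where U: "U \<in> carrier_mat n n" and UtU: "transpose_mat U * U = 1\<^sub>m n"
    and UUt: "U * transpose_mat U = 1\<^sub>m n" and A3U: "A3 = U * mat_diag n l * transpose_mat U"
    using Suc.IH[OF A3 A3sym] by blast
  define V where "V = four_block_mat (1\<^sub>m 1) (0\<^sub>m 1 n) (0\<^sub>m n 1) U"
  have V: "V \<in> carrier_mat ?m ?m" using U by (auto simp: V_def)
  have Vt: "transpose_mat V = four_block_mat (1\<^sub>m 1) (0\<^sub>m 1 n) (0\<^sub>m n 1) (transpose_mat U)"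
    unfolding V_def using U by (subst transpose_four_block_mat[of _ 1 1 _ n _ n]) auto
  have one: "four_block_mat (1\<^sub>m 1) (0\<^sub>m 1 n) (0\<^sub>m n 1) (1\<^sub>m n) = (1\<^sub>m ?m :: real mat)"
    by (intro eq_matI) auto
  have VtV: "transpose_mat V * V = 1\<^sub>m ?m" "V * transpose_mat V = 1\<^sub>m ?m"
    unfolding Vt unfolding V_def using U UtU UUt
    by (subst mult_four_block_mat[of _ 1 1 _ n _ n _ _ 1 _ n]; auto simp: one)+
  define l' where "l' = (\<lambda>i. case i of 0 \<Rightarrow> e | Suc j \<Rightarrow> l j)"
  have D: "mat_diag ?m l' = four_block_mat (mat 1 1 (\<lambda>_. e)) (0\<^sub>m 1 n) (0\<^sub>m n 1) (mat_diag n l)"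
    by (intro eq_matI) (auto simp: mat_diag_def l'_def split: nat.splits)
  have Bd: "B = V * mat_diag ?m l' * transpose_mat V"
  proof -
    define X where "X = U * mat_diag n l"
    have X: "X \<in> carrier_mat n n" unfolding X_def using U by (rule mult_carrier_mat) simp
    have "V * mat_diag ?m l' = four_block_mat (mat 1 1 (\<lambda>_. e)) (0\<^sub>m 1 n) (0\<^sub>m n 1) X"
      unfolding V_def D X_def using U left_mult_zero_mat[of "mat_diag n l" n n 1]
      by (subst mult_four_block_mat[of _ 1 1 _ n _ n _ _ 1 _ n]) auto
    also have "\<dots> * transpose_mat V = B"
      unfolding Vt Bblock A3U X_def[symmetric] using U X
      by (subst mult_four_block_mat[of _ 1 1 _ n _ n _ _ 1 _ n]) auto
    finally show ?thesis by simp
  qed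
  have Dc: "mat_diag ?m l' \<in> carrier_mat ?m ?m" by simp
  have "A = (W * V) * mat_diag ?m l' * transpose_mat (W * V)"
  proof -
    have "(W * V) * mat_diag ?m l' * transpose_mat (W * V) = W * (V * mat_diag ?m l' * transpose_mat V) * transpose_mat W"
      using W V mat_diag_dim[of ?m l']
      by (simp add: transpose_mult[of _ ?m ?m _ ?m] assoc_mult_mat[of _ ?m ?m _ ?m _ ?m] del: mat_diag_dim)
    also have "\<dots> = (W * transpose_mat W) * A * (W * transpose_mat W)"
      unfolding Bd[symmetric] B_def using W A by (simp add: assoc_mult_mat[of _ ?m ?m _ ?m _ ?m])
    also have "\<dots> = A" unfolding WWt using A by simp
    finally show ?thesis by simp
  qed
  moreover have "transpose_mat (W * V) * (W * V) = 1\<^sub>m ?m"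
  proof -
    have "transpose_mat (W * V) * (W * V) = transpose_mat V * (transpose_mat W * W) * V"
      using W V by (simp add: transpose_mult[of _ ?m ?m _ ?m] assoc_mult_mat[of _ ?m ?m _ ?m _ ?m])
    thus ?thesis unfolding WtW using V VtV by simp
  qed
  moreover have "(W * V) * transpose_mat (W * V) = 1\<^sub>m ?m"
  proof -
    have "(W * V) * transpose_mat (W * V) = W * (V * transpose_mat V) * transpose_mat W"
      using W V by (simp add: transpose_mult[of _ ?m ?m _ ?m] assoc_mult_mat[of _ ?m ?m _ ?m _ ?m])
    thus ?thesis unfolding VtV using W WWt by simp
  qed
  moreover have "W * V \<in> carrier_mat ?m ?m" using W V by simp
  ultimately show ?case by blast
qed

section \<open>Square roots and the empirical spectral distribution\<close>

lemma mat_mult_unit_vec: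
  fixes A :: "'a :: comm_ring_1 mat"
  assumes "A \<in> carrier_mat m n" "i < n"
  shows "A *\<^sub>v unit_vec n i = col A i"
  using assms by (intro eq_vecI) auto

lemma diagonalized_form:
  fixes U :: "real mat"
  assumes U: "U \<in> carrier_mat n n" and v: "v \<in> carrier_vec n"
  shows "v \<bullet> ((U * mat_diag n l * transpose_mat U) *\<^sub>v v) = (\<Sum>i<n. l i * ((transpose_mat U *\<^sub>v v) $ i)\<^sup>2)"
proof -
  define w where "w = transpose_mat U *\<^sub>v v"
  have w: "w \<in> carrier_vec n" using U v by (simp add: w_def)
  have "(U * mat_diag n l * transpose_mat U) *\<^sub>v v = U *\<^sub>v (mat_diag n l *\<^sub>v w)"
    using U v mat_diag_dim[of n l]
    by (simp add: w_def assoc_mult_mat_vec[of _ n n _ n] assoc_mult_mat[of _ n n _ n _ n] del: mat_diag_dim)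
  also have "v \<bullet> \<dots> = w \<bullet> (mat_diag n l *\<^sub>v w)"
    unfolding w_def using U v mult_mat_vec_carrier[OF mat_diag_dim[of n l], of "transpose_mat U *\<^sub>v v"]
    by (subst transpose_vec_mult_scalar[of U n n]) auto
  also have "mat_diag n l *\<^sub>v w = vec n (\<lambda>i. l i * w $ i)"
  proof (rule eq_vecI)
    fix i assume "i < dim_vec (vec n (\<lambda>i. l i * w $ i))"
    hence i: "i < n" by simp
    hence "(mat_diag n l *\<^sub>v w) $ i = (\<Sum>j<n. (if i = j then l j else 0) * w $ j)"
      using w by (simp add: mat_diag_def scalar_prod_def atLeast0LessThan)
    also have "\<dots> = l i * w $ i" using i by (subst sum.remove[of _ i]) auto
    finally show "(mat_diag n l *\<^sub>v w) $ i = vec n (\<lambda>i. l i * w $ i) $ i" using i by simp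
  qed (simp add: mat_diag_def)
  also have "w \<bullet> \<dots> = (\<Sum>i<n. l i * (w $ i)\<^sup>2)"
    using w by (simp add: scalar_prod_def atLeast0LessThan power2_eq_square algebra_simps)
  finally show ?thesis unfolding w_def .
qed

lemma diagonalized_eigenvector:
  fixes U :: "real mat"
  assumes U: "U \<in> carrier_mat n n" and UtU: "transpose_mat U * U = 1\<^sub>m n" and i: "i < n"
  shows "(U * mat_diag n l * transpose_mat U) *\<^sub>v col U i = l i \<cdot>\<^sub>v col U i"
    and "transpose_mat U *\<^sub>v col U i = unit_vec n i" and "col U i \<bullet> col U i = 1"
proof -
  have *: "transpose_mat U *\<^sub>v col U i = col (transpose_mat U * U) i"
    using U i by (intro col_mult2[symmetric, of _ n n _ n]) auto
  thus e: "transpose_mat U *\<^sub>v col U i = unit_vec n i" using i by (simp add: UtU)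
  have c: "col U i \<in> carrier_vec n" using U by auto
  have "(U * mat_diag n l * transpose_mat U) *\<^sub>v col U i = (U * mat_diag n l) *\<^sub>v unit_vec n i"
    using U c by (subst assoc_mult_mat_vec[of _ n n _ n]) (auto simp: e)
  also have "\<dots> = col (U * mat_diag n l) i" using U i by (intro mat_mult_unit_vec[of _ n]) auto
  also have "\<dots> = l i \<cdot>\<^sub>v col U i"
    using U i by (intro eq_vecI) (auto simp: mat_diag_mult_right[OF U])
  finally show "(U * mat_diag n l * transpose_mat U) *\<^sub>v col U i = l i \<cdot>\<^sub>v col U i" .
  have "col U i \<bullet> col U i = (transpose_mat U * U) $$ (i, i)" using U i by simp
  thus "col U i \<bullet> col U i = 1" using i by (simp add: UtU)
qed

lemma pos_def_mat_diagonalized: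
  fixes U :: "real mat"
  assumes U: "U \<in> carrier_mat n n" and UtU: "transpose_mat U * U = 1\<^sub>m n" and UUt: "U * transpose_mat U = 1\<^sub>m n"
  shows "pos_def_mat (U * mat_diag n l * transpose_mat U) \<longleftrightarrow> (\<forall>i<n. l i > 0)" (is "pos_def_mat ?A \<longleftrightarrow> _")
proof
  have A: "?A \<in> carrier_mat n n" using U by auto
  {
    assume p: "pos_def_mat ?A"
    show "\<forall>i<n. l i > 0"
    proof (intro allI impI)
      fix i assume i: "i < n"
      have c: "col U i \<in> carrier_vec n" using U by auto
      have "col U i \<noteq> 0\<^sub>v n" using diagonalized_eigenvector(3)[OF U UtU i] by auto
      hence "col U i \<bullet> (?A *\<^sub>v col U i) > 0" using p A c unfolding pos_def_mat_def by (auto simp del: index_mult_mat_vec)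
      thus "l i > 0" using diagonalized_eigenvector[OF U UtU i] c by simp
    qed
  next
    assume l: "\<forall>i<n. l i > 0"
    have "transpose_mat ?A = ?A"
    proof -
      have "transpose_mat (mat_diag n l) = mat_diag n l" by (intro eq_matI) (auto simp: mat_diag_def)
      thus ?thesis using U mat_diag_dim[of n l]
        by (simp add: transpose_mult[of _ n n _ n] assoc_mult_mat[of _ n n _ n _ n] del: mat_diag_dim)
    qed
    moreover have "v \<bullet> (?A *\<^sub>v v) > 0" if v: "v \<in> carrier_vec n" "v \<noteq> 0\<^sub>v n" for v
    proof -
      let ?w = "transpose_mat U *\<^sub>v v"
      have "\<exists>i<n. ?w $ i \<noteq> 0"
      proof (rule ccontr)
        assume "\<not> (\<exists>i<n. ?w $ i \<noteq> 0)"
        hence "?w = 0\<^sub>v n" using U by (intro eq_vecI) auto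
        hence "U *\<^sub>v ?w = 0\<^sub>v n" using U by (intro eq_vecI) auto
        hence "(U * transpose_mat U) *\<^sub>v v = 0\<^sub>v n" using U v by (subst assoc_mult_mat_vec[of _ n n _ n]) auto
        thus False using v by (simp add: UUt)
      qed
      then obtain i where i: "i < n" "?w $ i \<noteq> 0" by auto
      have "(\<Sum>i<n. l i * (?w $ i)\<^sup>2) > 0"
        using i l by (intro sum_pos2[of _ i]) (auto simp: less_imp_le intro!: mult_nonneg_nonneg mult_pos_pos)
      thus ?thesis using diagonalized_form[OF U v(1)] by simp
    qed
    ultimately show "pos_def_mat ?A" unfolding pos_def_mat_def using A by auto
  }
qed

text \<open>With \<open>D = B - C\<close> the hypothesis gives \<open>B D + D C = 0\<close>. Testing this on an eigenvector \<open>w\<close> of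
  \<open>D\<close> with eigenvalue \<open>d\<close> yields \<open>d (w \<bullet> B w + w \<bullet> C w) = 0\<close>, and the bracket is positive, so \<open>D\<close>
  has no eigenvalue other than zero.\<close>
lemma pos_def_sqrt_unique:
  assumes B: "B \<in> carrier_mat n n" "pos_def_mat B" and C: "C \<in> carrier_mat n n" "pos_def_mat C"
    and eq: "B * B = C * C"
  shows "B = C"
proof -
  define D where "D = B - C"
  have D: "D \<in> carrier_mat n n" unfolding D_def using C by (intro minus_carrier_mat)
  have Bt: "transpose_mat B = B" and Ct: "transpose_mat C = C" using B C by (auto simp: pos_def_mat_def)
  have Dt: "transpose_mat D = D" unfolding D_def using B C Bt Ct by (simp add: transpose_minus)
  obtain U d where U: "U \<in> carrier_mat n n" and UtU: "transpose_mat U * U = 1\<^sub>m n"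
    and DU: "D = U * mat_diag n d * transpose_mat U"
    using symmetric_mat_diagonalization[OF D Dt] by blast
  have zero: "B * D + D * C = 0\<^sub>m n n"
  proof -
    have "B * D = B * B - B * C" unfolding D_def using B C by (intro mult_minus_distrib_mat[of _ n n]) auto
    moreover have "D * C = B * C - C * C" unfolding D_def using B C by (intro minus_mult_distrib_mat[of _ n n]) auto
    moreover have "X - Y + (Y - X) = 0\<^sub>m n n" if "X \<in> carrier_mat n n" "Y \<in> carrier_mat n n" for X Y :: "real mat"
      using that by (intro eq_matI) auto
    ultimately show ?thesis using eq B C by simp
  qed
  have d0: "d i = 0" if i: "i < n" for i
  proof -
    define w where "w = col U i"
    have w: "w \<in> carrier_vec n" using U by (auto simp: w_def)
    have w0: "w \<noteq> 0\<^sub>v n" using diagonalized_eigenvector(3)[OF U UtU i] w by (auto simp: w_def)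
    have Dw: "D *\<^sub>v w = d i \<cdot>\<^sub>v w" unfolding w_def DU by (rule diagonalized_eigenvector[OF U UtU i])
    have "0\<^sub>m n n *\<^sub>v w = 0\<^sub>v n" using w by (intro eq_vecI) auto
    hence "0 = w \<bullet> ((B * D + D * C) *\<^sub>v w)" unfolding zero using w by simp
    also have "\<dots> = w \<bullet> ((B * D) *\<^sub>v w) + w \<bullet> ((D * C) *\<^sub>v w)"
      using w B C D by (subst add_mult_distrib_mat_vec[of _ n n]) (auto intro!: scalar_prod_add_distrib[of _ n])
    also have "(B * D) *\<^sub>v w = d i \<cdot>\<^sub>v (B *\<^sub>v w)"
      using w B C D by (subst assoc_mult_mat_vec[of _ n n _ n]) (auto simp: Dw mult_mat_vec[of _ n n])
    also have "(D * C) *\<^sub>v w = D *\<^sub>v (C *\<^sub>v w)"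
      using w B C D by (intro assoc_mult_mat_vec[of _ n n _ n]) auto
    also have "w \<bullet> (D *\<^sub>v (C *\<^sub>v w)) = (D *\<^sub>v w) \<bullet> (C *\<^sub>v w)"
      using transpose_vec_mult_scalar[OF D, of "C *\<^sub>v w" w] w C by (simp add: Dt)
    also have "w \<bullet> (d i \<cdot>\<^sub>v (B *\<^sub>v w)) + (D *\<^sub>v w) \<bullet> (C *\<^sub>v w) = d i * (w \<bullet> (B *\<^sub>v w) + w \<bullet> (C *\<^sub>v w))"
      unfolding Dw using w B C by (simp add: algebra_simps)
    finally have "d i * (w \<bullet> (B *\<^sub>v w) + w \<bullet> (C *\<^sub>v w)) = 0" by simp
    moreover have "w \<bullet> (B *\<^sub>v w) > 0" "w \<bullet> (C *\<^sub>v w) > 0"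
      using B C w w0 by (auto simp: pos_def_mat_def)
    ultimately show ?thesis by auto
  qed
  have "mat_diag n d = 0\<^sub>m n n" using d0 by (intro eq_matI) (auto simp: mat_diag_def)
  hence "D = 0\<^sub>m n n" unfolding DU using U by simp
  show ?thesis
  proof (rule eq_matI)
    fix i j assume "i < dim_row C" "j < dim_col C"
    hence ij: "i < n" "j < n" using C by auto
    have "D $$ (i, j) = 0" using \<open>D = 0\<^sub>m n n\<close> ij by simp
    thus "B $$ (i, j) = C $$ (i, j)" unfolding D_def using B C ij by simp
  qed (use B C in auto)
qed

lemma mat_sqrt_pos_def:
  assumes A: "A \<in> carrier_mat n n" and p: "pos_def_mat A"
  shows "mat_sqrt A \<in> carrier_mat n n" "transpose_mat (mat_sqrt A) = mat_sqrt A" "mat_sqrt A * mat_sqrt A = A"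
proof -
  have sym: "transpose_mat A = A" using p by (simp add: pos_def_mat_def)
  obtain U l where U: "U \<in> carrier_mat n n" and UtU: "transpose_mat U * U = 1\<^sub>m n" 
    and UUt: "U * transpose_mat U = 1\<^sub>m n" and AU: "A = U * mat_diag n l * transpose_mat U"
    using symmetric_mat_diagonalization[OF A sym] by blast
  have l: "l i > 0" if "i < n" for i using p that unfolding AU pos_def_mat_diagonalized[OF U UtU UUt] by auto
  define B where "B = U * mat_diag n (\<lambda>i. sqrt (l i)) * transpose_mat U"
  have B: "B \<in> carrier_mat n n" using U by (auto simp: B_def)
  have pB: "pos_def_mat B" unfolding B_def pos_def_mat_diagonalized[OF U UtU UUt] using l by auto
  have "B * B = U * mat_diag n (\<lambda>i. sqrt (l i)) * (transpose_mat U * U) * mat_diag n (\<lambda>i. sqrt (l i)) * transpose_mat U"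
    unfolding B_def using U mat_diag_dim[of n "\<lambda>i. sqrt (l i)"]
    by (simp add: assoc_mult_mat[of _ n n _ n _ n] del: mat_diag_dim)
  also have "\<dots> = U * (mat_diag n (\<lambda>i. sqrt (l i)) * mat_diag n (\<lambda>i. sqrt (l i))) * transpose_mat U"
    unfolding UtU using U mat_diag_dim[of n "\<lambda>i. sqrt (l i)"]
    by (simp add: assoc_mult_mat[of _ n n _ n _ n] del: mat_diag_diag mat_diag_dim)
  also have "mat_diag n (\<lambda>i. sqrt (l i)) * mat_diag n (\<lambda>i. sqrt (l i)) = mat_diag n l"
    unfolding mat_diag_diag using l by (intro eq_matI) (auto simp: mat_diag_def less_imp_le)
  finally have BB: "B * B = A" by (simp add: AU)
  have "mat_sqrt A = B" unfolding mat_sqrt_def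
    by (rule the_equality) (use A B pB BB pos_def_sqrt_unique in auto)
  thus "mat_sqrt A \<in> carrier_mat n n" "transpose_mat (mat_sqrt A) = mat_sqrt A" "mat_sqrt A * mat_sqrt A = A"
    using B BB pB by (auto simp: pos_def_mat_def)
qed

lemma proots_char_poly_diagonalized:
  fixes U :: "real mat"
  assumes U: "U \<in> carrier_mat n n" and UtU: "transpose_mat U * U = 1\<^sub>m n" and UUt: "U * transpose_mat U = 1\<^sub>m n"
  shows "proots (char_poly (U * mat_diag n l * transpose_mat U)) = image_mset l (mset_set {..<n})" (is "proots (char_poly ?A) = _")
proof -
  have "similar_mat_wit ?A (mat_diag n l) U (transpose_mat U)"
    using U UtU UUt by (intro similar_mat_witI[of _ _ n]) auto
  hence "char_poly ?A = char_poly (mat_diag n l)" using char_poly_similar unfolding similar_mat_def by blast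
  also have "\<dots> = (\<Prod>a\<leftarrow>diag_mat (mat_diag n l). [:- a, 1:])"
    by (rule char_poly_upper_triangular[of _ n]) (auto simp: mat_diag_def upper_triangular_def)
  also have "diag_mat (mat_diag n l) = map l [0..<n]"
    by (auto simp: diag_mat_def mat_diag_def)
  finally have "char_poly ?A = (\<Prod>i<n. [:- l i, 1:])"
    by (simp add: prod.list_conv_set_nth o_def atLeast0LessThan flip: prod.distinct_set_conv_list)
  hence "proots (char_poly ?A) = (\<Sum>i<n. {#l i#})"
    by (simp add: proots_prod)
  thus ?thesis by (simp add: sum_unfold_sum_mset)
qed

lemma esd_diagonalized:
  fixes U :: "real mat"
  assumes U: "U \<in> carrier_mat n n" and UtU: "transpose_mat U * U = 1\<^sub>m n" and UUt: "U * transpose_mat U = 1\<^sub>m n"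
  shows "esd (U * mat_diag n l * transpose_mat U) x = real (card {i. i < n \<and> l i \<le> x}) / real n"
proof -
  have "size (filter_mset (\<lambda>y. y \<le> x) (image_mset l (mset_set {..<n}))) = card {i. i < n \<and> l i \<le> x}"
    by (simp add: filter_mset_image_mset)
  thus ?thesis unfolding esd_def proots_char_poly_diagonalized[OF assms] using U by auto
qed

section \<open>Operator bounds, traces and quadratic forms\<close>

definition cvec_norm :: "complex vec \<Rightarrow> real" where
  "cvec_norm w = L2_set (\<lambda>i. cmod (w $ i)) {..<dim_vec w}"

text \<open>A bound for the operator norm, kept as a relation because only upper estimates occur.\<close>
definition op_bound :: "complex mat \<Rightarrow> real \<Rightarrow> bool" where
  "op_bound M b \<longleftrightarrow> 0 \<le> b \<and> (\<forall>w \<in> carrier_vec (dim_col M). cvec_norm (M *\<^sub>v w) \<le> b * cvec_norm w)"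

definition ctrace :: "complex mat \<Rightarrow> complex" where
  "ctrace M = (\<Sum>i<dim_row M. M $$ (i, i))"

text \<open>Bilinear, not sesquilinear: the vectors are real while the matrices are complex.\<close>
definition qform :: "complex mat \<Rightarrow> (nat \<Rightarrow> real) \<Rightarrow> complex" where
  "qform M x = (\<Sum>i<dim_row M. \<Sum>j<dim_row M. M $$ (i, j) * complex_of_real (x i * x j))"

definition psd_mat :: "nat \<Rightarrow> real mat \<Rightarrow> bool" where
  "psd_mat n A \<longleftrightarrow> A \<in> carrier_mat n n \<and> (\<forall>i<n. \<forall>j<n. A $$ (i, j) = A $$ (j, i)) \<and>
     (\<forall>u. 0 \<le> (\<Sum>i<n. \<Sum>j<n. A $$ (i, j) * (u i * u j)))"

text \<open>Linear combinations of the rank-one matrices \<open>u\<^sub>s u\<^sub>s\<^sup>T\<close>. The index type is arbitrary because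
  the sums run over observations, over pairs of observations and over coordinates.\<close>
definition cgram :: "nat \<Rightarrow> 's set \<Rightarrow> ('s \<Rightarrow> complex) \<Rightarrow> ('s \<Rightarrow> nat \<Rightarrow> real) \<Rightarrow> complex mat" where
  "cgram n S c u = mat n n (\<lambda>(i, j). \<Sum>s\<in>S. c s * complex_of_real (u s i * u s j))"

definition gram :: "nat \<Rightarrow> 's set \<Rightarrow> ('s \<Rightarrow> real) \<Rightarrow> ('s \<Rightarrow> nat \<Rightarrow> real) \<Rightarrow> real mat" where
  "gram n S c u = mat n n (\<lambda>(i, j). \<Sum>s\<in>S. c s * (u s i * u s j))"

text \<open>The coefficient \<open>a\<close> is 1 for random matrices; the deterministic equivalent of their
  resolvents has a complex coefficient, and the range \<open>Im a \<le> 0\<close> is where invertibility persists.\<close>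
definition shifted :: "complex \<Rightarrow> real mat \<Rightarrow> complex \<Rightarrow> complex mat" where
  "shifted a A z = mat (dim_row A) (dim_row A) (\<lambda>(i, j). a * complex_of_real (A $$ (i, j)) - (if i = j then z else 0))"

text \<open>Cramer's rule makes the entries explicit rational functions of the entries of \<open>A\<close>, so that
  measurability is immediate; that this is the inverse of \<open>shifted a A z\<close> is \<open>resolvent_inverse\<close>.\<close>
definition resolvent :: "complex \<Rightarrow> real mat \<Rightarrow> complex \<Rightarrow> complex mat" where
  "resolvent a A z = (1 / det (shifted a A z)) \<cdot>\<^sub>m adj_mat (shifted a A z)"

abbreviation real_cvec :: "nat \<Rightarrow> (nat \<Rightarrow> real) \<Rightarrow> complex vec" where
  "real_cvec n x \<equiv> vec n (\<lambda>i. complex_of_real (x i))"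

lemma gram_carrier [simp]: "gram n S c u \<in> carrier_mat n n" "cgram n S d u \<in> carrier_mat n n"
  by (auto simp: gram_def cgram_def)

lemma gram_dim [simp]: "dim_row (gram n S c u) = n" "dim_col (gram n S c u) = n"
  "dim_row (cgram n S d u) = n" "dim_col (cgram n S d u) = n"
  by (auto simp: gram_def cgram_def)

lemma psd_gram:
  assumes "\<And>s. s \<in> S \<Longrightarrow> c s \<ge> 0"
  shows "psd_mat n (gram n S c u)"
proof -
  have "0 \<le> (\<Sum>i<n. \<Sum>j<n. gram n S c u $$ (i, j) * (x i * x j))" for x
  proof -
    have "(\<Sum>i<n. \<Sum>j<n. gram n S c u $$ (i, j) * (x i * x j)) =
        (\<Sum>i<n. \<Sum>j<n. \<Sum>s\<in>S. c s * ((u s i * x i) * (u s j * x j)))"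
      by (intro sum.cong) (auto simp: gram_def sum_distrib_left sum_distrib_right mult_ac)
    also have "\<dots> = (\<Sum>s\<in>S. \<Sum>i<n. \<Sum>j<n. c s * ((u s i * x i) * (u s j * x j)))"
      by (subst (2) sum.swap, subst sum.swap) simp
    also have "\<dots> = (\<Sum>s\<in>S. c s * (\<Sum>i<n. u s i * x i)\<^sup>2)"
      unfolding power2_eq_square sum_product by (simp add: sum_distrib_left)
    also have "\<dots> \<ge> 0" using assms by (intro sum_nonneg) auto
    finally show ?thesis .
  qed
  thus ?thesis by (auto simp: psd_mat_def gram_def mult.commute intro!: sum.cong)
qed

lemma cvec_norm_nonneg [simp]: "cvec_norm w \<ge> 0" by (simp add: cvec_norm_def L2_set_nonneg)

lemma cvec_norm_sq: "w \<in> carrier_vec n \<Longrightarrow> (cvec_norm w)\<^sup>2 = (\<Sum>i<n. (cmod (w $ i))\<^sup>2)"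
  by (auto simp: cvec_norm_def L2_set_def sum_nonneg)

lemma cvec_norm_eq_0: 
  assumes "w \<in> carrier_vec n" "cvec_norm w = 0" shows "w = 0\<^sub>v n"
proof -
  have "(\<Sum>i<n. (cmod (w $ i))\<^sup>2) = 0" using cvec_norm_sq[OF assms(1)] assms(2) by simp
  hence "\<forall>i\<in>{..<n}. (cmod (w $ i))\<^sup>2 = 0" by (subst (asm) sum_nonneg_eq_0_iff) auto
  thus ?thesis using assms(1) by (intro eq_vecI) auto
qed

lemma cvec_norm_ge_entry: "w \<in> carrier_vec n \<Longrightarrow> i < n \<Longrightarrow> cmod (w $ i) \<le> cvec_norm w"
  unfolding cvec_norm_def by (rule member_le_L2_set) auto

lemma cvec_cauchy_schwarz:
  assumes "x \<in> carrier_vec n" "w \<in> carrier_vec n"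
  shows "cmod (\<Sum>i<n. cnj (x $ i) * w $ i) \<le> cvec_norm x * cvec_norm w"
    and "cmod (x \<bullet> w) \<le> cvec_norm x * cvec_norm w"
proof -
  have "(\<Sum>i<n. cmod (x $ i) * cmod (w $ i)) \<le> cvec_norm x * cvec_norm w"
    using L2_set_mult_ineq[of "\<lambda>i. cmod (x $ i)" "\<lambda>i. cmod (w $ i)" "{..<n}"] assms
    by (simp add: cvec_norm_def)
  thus "cmod (\<Sum>i<n. cnj (x $ i) * w $ i) \<le> cvec_norm x * cvec_norm w" "cmod (x \<bullet> w) \<le> cvec_norm x * cvec_norm w"
    using assms by (auto intro!: order.trans[OF norm_sum] simp: norm_mult scalar_prod_def atLeast0LessThan)
qed

lemma cvec_norm_unit: "i < n \<Longrightarrow> cvec_norm (unit_vec n i) = 1"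
proof -
  assume i: "i < n"
  have "(\<Sum>k<n. (cmod ((unit_vec n i :: complex vec) $ k))\<^sup>2) = (\<Sum>k<n. if k = i then 1 else 0)"
    by (intro sum.cong) (auto simp: unit_vec_def)
  also have "\<dots> = 1" using i by simp
  finally show ?thesis by (simp add: cvec_norm_def L2_set_def)
qed

lemma cvec_norm_real_cvec: "(cvec_norm (real_cvec n x))\<^sup>2 = (\<Sum>i<n. (x i)\<^sup>2)"
  by (subst cvec_norm_sq[of _ n]) auto

lemma op_boundD:
  assumes "op_bound M b" "M \<in> carrier_mat n m" "w \<in> carrier_vec m"
  shows "cvec_norm (M *\<^sub>v w) \<le> b * cvec_norm w"
  using assms by (auto simp: op_bound_def)

lemma op_bound_nonneg: "op_bound M b \<Longrightarrow> 0 \<le> b" by (simp add: op_bound_def)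

lemma op_bound_mult:
  assumes "op_bound M b" "op_bound N c" "M \<in> carrier_mat n n" "N \<in> carrier_mat n n"
  shows "op_bound (M * N) (b * c)"
  unfolding op_bound_def
proof (intro conjI ballI)
  show "0 \<le> b * c" using assms by (auto simp: op_bound_def)
  fix w :: "complex vec" assume "w \<in> carrier_vec (dim_col (M * N))"
  hence w: "w \<in> carrier_vec n" using assms by auto
  have "cvec_norm ((M * N) *\<^sub>v w) = cvec_norm (M *\<^sub>v (N *\<^sub>v w))"
    using assms w by (subst assoc_mult_mat_vec[of _ n n _ n]) auto
  also have "\<dots> \<le> b * cvec_norm (N *\<^sub>v w)" using assms w by (intro op_boundD[of _ _ n n]) auto
  also have "\<dots> \<le> b * (c * cvec_norm w)"
    using assms w op_boundD[of N c n n w] op_bound_nonneg[of M b] by (intro mult_left_mono) auto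
  finally show "cvec_norm ((M * N) *\<^sub>v w) \<le> b * c * cvec_norm w" by (simp add: mult.assoc)
qed

lemma op_bound_col:
  assumes "op_bound M b" "M \<in> carrier_mat n n" "j < n"
  shows "cvec_norm (col M j) \<le> b"
proof -
  have "col M j = M *\<^sub>v unit_vec n j" using assms by (intro mat_mult_unit_vec[symmetric, of _ n]) auto
  thus ?thesis using op_boundD[OF assms(1,2), of "unit_vec n j"] cvec_norm_unit[OF assms(3)] by simp
qed

lemma op_bound_entry:
  assumes "op_bound M b" "M \<in> carrier_mat n n" "i < n" "j < n"
  shows "cmod (M $$ (i, j)) \<le> b"
  using cvec_norm_ge_entry[of "col M j" n i] op_bound_col[OF assms(1,2,4)] assms by auto

lemma op_bound_ctrace:
  assumes "op_bound M b" "M \<in> carrier_mat n n"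
  shows "cmod (ctrace M) \<le> real n * b"
proof -
  have "cmod (ctrace M) \<le> (\<Sum>i<n. cmod (M $$ (i, i)))" using assms unfolding ctrace_def by (auto intro: norm_sum)
  also have "\<dots> \<le> (\<Sum>i<n. b)" by (intro sum_mono op_bound_entry[OF assms]) auto
  finally show ?thesis by simp
qed

text \<open>Each of the \<open>n\<close> columns is the image of a unit vector.\<close>
lemma op_bound_frobenius:
  assumes "op_bound M b" "M \<in> carrier_mat n n"
  shows "(\<Sum>i<n. \<Sum>j<n. (cmod (M $$ (i, j)))\<^sup>2) \<le> real n * b\<^sup>2"
proof -
  have "(\<Sum>i<n. \<Sum>j<n. (cmod (M $$ (i, j)))\<^sup>2) = (\<Sum>j<n. (cvec_norm (col M j))\<^sup>2)"
    using assms by (subst sum.swap, intro sum.cong) (auto simp: cvec_norm_sq[of _ n])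
  also have "\<dots> \<le> (\<Sum>j<n. b\<^sup>2)" by (intro sum_mono power_mono op_bound_col[OF assms]) auto
  finally show ?thesis by simp
qed

lemma qform_scalar_prod:
  assumes "M \<in> carrier_mat n n"
  shows "qform M x = real_cvec n x \<bullet> (M *\<^sub>v real_cvec n x)"
  using assms by (simp add: qform_def scalar_prod_def atLeast0LessThan sum_distrib_left mult_ac)

lemma op_bound_qform:
  assumes "op_bound M b" "M \<in> carrier_mat n n"
  shows "cmod (qform M x) \<le> b * (\<Sum>i<n. (x i)\<^sup>2)"
proof -
  have "cmod (qform M x) \<le> cvec_norm (real_cvec n x) * cvec_norm (M *\<^sub>v real_cvec n x)"
    unfolding qform_scalar_prod[OF assms(2)] using assms by (intro cvec_cauchy_schwarz(2)[of _ n]) auto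
  also have "\<dots> \<le> cvec_norm (real_cvec n x) * (b * cvec_norm (real_cvec n x))"
    using assms by (intro mult_left_mono op_boundD[of _ _ n n]) auto
  also have "\<dots> = b * (\<Sum>i<n. (x i)\<^sup>2)"
    unfolding cvec_norm_real_cvec[symmetric] by (simp add: power2_eq_square)
  finally show ?thesis .
qed

lemma ctrace_comm:
  assumes "A \<in> carrier_mat n n" "B \<in> carrier_mat n n"
  shows "ctrace (A * B) = ctrace (B * A)"
proof -
  have "ctrace (A * B) = (\<Sum>i<n. \<Sum>j<n. A $$ (i, j) * B $$ (j, i))"
    using assms by (auto simp: ctrace_def scalar_prod_def atLeast0LessThan intro!: sum.cong)
  also have "\<dots> = (\<Sum>j<n. \<Sum>i<n. B $$ (j, i) * A $$ (i, j))"
    by (subst sum.swap) (simp add: mult.commute)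
  also have "\<dots> = ctrace (B * A)"
    using assms by (auto simp: ctrace_def scalar_prod_def atLeast0LessThan intro!: sum.cong)
  finally show ?thesis .
qed

lemma ctrace_arith:
  assumes "A \<in> carrier_mat n n" "B \<in> carrier_mat n n"
  shows "ctrace (A + B) = ctrace A + ctrace B" "ctrace (A - B) = ctrace A - ctrace B" "ctrace (c \<cdot>\<^sub>m A) = c * ctrace A"
  using assms by (auto simp: ctrace_def sum.distrib sum_subtractf sum_distrib_left)

lemma ctrace_cgram_mult:
  assumes "M \<in> carrier_mat n n"
  shows "ctrace (cgram n S c u * M) = (\<Sum>s\<in>S. c s * qform M (u s))"
proof -
  have "ctrace (cgram n S c u * M) = (\<Sum>i<n. \<Sum>j<n. \<Sum>s\<in>S. c s * (M $$ (j, i) * complex_of_real (u s j * u s i)))"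
    using assms by (auto simp: ctrace_def scalar_prod_def atLeast0LessThan cgram_def sum_distrib_left sum_distrib_right mult_ac intro!: sum.cong)
  also have "\<dots> = (\<Sum>s\<in>S. \<Sum>i<n. \<Sum>j<n. c s * (M $$ (j, i) * complex_of_real (u s j * u s i)))"
    by (subst (2) sum.swap, subst sum.swap) simp
  also have "\<dots> = (\<Sum>s\<in>S. \<Sum>j<n. \<Sum>i<n. c s * (M $$ (j, i) * complex_of_real (u s j * u s i)))"
    by (intro sum.cong refl sum.swap)
  also have "\<dots> = (\<Sum>s\<in>S. c s * qform M (u s))"
    using assms by (simp add: qform_def sum_distrib_left)
  finally show ?thesis .
qed

text \<open>A rank-one matrix between two factors splits the quadratic form at its own vector into a
  product.\<close>
lemma qform_rank_one_factor:
  assumes M: "M \<in> carrier_mat n n" and N: "N \<in> carrier_mat n n"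
  shows "qform (M * cgram n {i} c u * N) (u i) = c i * qform M (u i) * qform N (u i)"
proof -
  let ?x = "real_cvec n (u i)" and ?X = "cgram n {i} c u"
  have x: "?x \<in> carrier_vec n" by simp
  have X: "?X *\<^sub>v y = (c i * (?x \<bullet> y)) \<cdot>\<^sub>v ?x" if "y \<in> carrier_vec n" for y
    using that by (intro eq_vecI) (auto simp: cgram_def scalar_prod_def atLeast0LessThan sum_distrib_left sum_distrib_right mult_ac)
  have "(M * ?X * N) *\<^sub>v ?x = M *\<^sub>v (?X *\<^sub>v (N *\<^sub>v ?x))"
    using M N gram_carrier(2)[of n "{i}" c u]
    by (simp add: assoc_mult_mat_vec[of _ n n _ n] assoc_mult_mat[of _ n n _ n _ n] del: gram_carrier)
  also have "\<dots> = (c i * qform N (u i)) \<cdot>\<^sub>v (M *\<^sub>v ?x)"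
    using M N by (subst X) (auto simp: mult_mat_vec[of _ n n] qform_scalar_prod[OF N])
  finally have "qform (M * ?X * N) (u i) = ?x \<bullet> ((c i * qform N (u i)) \<cdot>\<^sub>v (M *\<^sub>v ?x))"
    using M N by (subst qform_scalar_prod[of _ n]) auto
  also have "\<dots> = (c i * qform N (u i)) * (?x \<bullet> (M *\<^sub>v ?x))"
    using M by (intro scalar_prod_smult_right) auto
  finally show ?thesis using qform_scalar_prod[OF M] by (simp add: mult_ac)
qed

section \<open>Resolvents of positive semidefinite matrices\<close>

lemma shifted_carrier [simp]: "A \<in> carrier_mat n n \<Longrightarrow> shifted a A z \<in> carrier_mat n n"
  by (auto simp: shifted_def)

lemma shifted_form:
  assumes A: "psd_mat n A" and w: "w \<in> carrier_vec n"
  shows "\<exists>r\<ge>0. (\<Sum>i<n. cnj (w $ i) * (shifted a A z *\<^sub>v w) $ i) = a * of_real r - z * of_real ((cvec_norm w)\<^sup>2)"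
proof -
  have Ac: "A \<in> carrier_mat n n" and sym: "\<And>i j. i < n \<Longrightarrow> j < n \<Longrightarrow> A $$ (i, j) = A $$ (j, i)"
    using A by (auto simp: psd_mat_def)
  define r where "r = (\<Sum>i<n. \<Sum>j<n. A $$ (i, j) * (Re (w $ i) * Re (w $ j) + Im (w $ i) * Im (w $ j)))"
  have "r = (\<Sum>i<n. \<Sum>j<n. A $$ (i, j) * (Re (w $ i) * Re (w $ j))) + (\<Sum>i<n. \<Sum>j<n. A $$ (i, j) * (Im (w $ i) * Im (w $ j)))"
    by (simp add: r_def sum.distrib algebra_simps)
  moreover have "\<dots> \<ge> 0" using A unfolding psd_mat_def by (intro add_nonneg_nonneg) auto
  ultimately have r0: "r \<ge> 0" by linarith
  have e: "(shifted a A z *\<^sub>v w) $ i = a * (\<Sum>j<n. of_real (A $$ (i, j)) * w $ j) - z * w $ i" if "i < n" for i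
  proof -
    have "(shifted a A z *\<^sub>v w) $ i = (\<Sum>j<n. a * (of_real (A $$ (i, j)) * w $ j) - (if j = i then z * w $ i else 0))"
      using that w Ac by (auto simp: shifted_def scalar_prod_def atLeast0LessThan algebra_simps intro!: sum.cong)
    thus ?thesis using that by (simp add: sum_subtractf sum_distrib_left)
  qed
  have "(\<Sum>i<n. cnj (w $ i) * (shifted a A z *\<^sub>v w) $ i) =
     (\<Sum>i<n. a * (\<Sum>j<n. cnj (w $ i) * of_real (A $$ (i, j)) * w $ j) - z * (cnj (w $ i) * w $ i))"
    by (intro sum.cong) (auto simp: e algebra_simps sum_distrib_left simp del: index_mult_mat_vec)
  also have "\<dots> = a * (\<Sum>i<n. \<Sum>j<n. cnj (w $ i) * of_real (A $$ (i, j)) * w $ j) - z * (\<Sum>i<n. cnj (w $ i) * w $ i)"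
    by (simp add: sum_subtractf sum_distrib_left)
  also have "(\<Sum>i<n. \<Sum>j<n. cnj (w $ i) * of_real (A $$ (i, j)) * w $ j) = of_real r"
    unfolding r_def by (rule symmetric_form_real) (rule sym)
  also have "(\<Sum>i<n. cnj (w $ i) * w $ i) = of_real ((cvec_norm w)\<^sup>2)"
    unfolding cvec_norm_sq[OF w] of_real_sum
    by (intro sum.cong) (auto simp: complex_norm_square mult.commute simp del: of_real_power)
  finally show ?thesis using r0 by blast
qed

text \<open>Both \<open>a A\<close> and \<open>- z\<close> contribute to \<open>w\<^sup>* (a A - z) w\<close> with non-positive imaginary part, so the
  contribution of \<open>- z\<close> cannot be cancelled.\<close>
lemma shifted_lower_bound:
  assumes A: "psd_mat n A" and w: "w \<in> carrier_vec n" and a: "Im a \<le> 0" and z: "Im z > 0"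
  shows "Im z * cvec_norm w \<le> cvec_norm (shifted a A z *\<^sub>v w)"
proof (cases "cvec_norm w = 0")
  case False
  have Ac: "A \<in> carrier_mat n n" using A by (auto simp: psd_mat_def)
  let ?f = "\<Sum>i<n. cnj (w $ i) * (shifted a A z *\<^sub>v w) $ i"
  obtain r where r: "r \<ge> 0" "?f = a * of_real r - z * of_real ((cvec_norm w)\<^sup>2)"
    using shifted_form[OF A w] by blast
  have "Im ?f = Im a * r - Im z * (cvec_norm w)\<^sup>2" unfolding r(2) by (simp del: of_real_power)
  moreover have "Im a * r \<le> 0" using a r(1) by (rule mult_nonpos_nonneg)
  ultimately have "Im z * (cvec_norm w)\<^sup>2 \<le> \<bar>Im ?f\<bar>" by linarith
  also have "\<dots> \<le> cmod ?f" by (rule abs_Im_le_cmod)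
  also have "\<dots> \<le> cvec_norm w * cvec_norm (shifted a A z *\<^sub>v w)"
    using w shifted_carrier[OF Ac] by (intro cvec_cauchy_schwarz(1)) (auto intro!: mult_mat_vec_carrier)
  finally have "cvec_norm w * (Im z * cvec_norm w) \<le> cvec_norm w * cvec_norm (shifted a A z *\<^sub>v w)"
    by (simp add: power2_eq_square mult_ac)
  moreover have "cvec_norm w > 0" using False cvec_norm_nonneg[of w] by linarith
  ultimately show ?thesis by simp
qed simp

lemma resolvent_inverse:
  assumes A: "psd_mat n A" and a: "Im a \<le> 0" and z: "Im z > 0"
  shows "resolvent a A z \<in> carrier_mat n n"
    and "shifted a A z * resolvent a A z = 1\<^sub>m n"
    and "resolvent a A z * shifted a A z = 1\<^sub>m n"
    and "op_bound (resolvent a A z) (1 / Im z)"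
proof -
  have Ac: "A \<in> carrier_mat n n" using A by (auto simp: psd_mat_def)
  let ?S = "shifted a A z" and ?G = "resolvent a A z"
  have S: "?S \<in> carrier_mat n n" by (rule shifted_carrier[OF Ac])
  have d: "det ?S \<noteq> 0"
  proof
    assume "det ?S = 0"
    then obtain w where w: "w \<in> carrier_vec n" "w \<noteq> 0\<^sub>v n" "?S *\<^sub>v w = 0\<^sub>v n"
      using det_0_iff_vec_prod_zero[OF S] by auto
    have "cvec_norm (0\<^sub>v n) = 0" by (simp add: cvec_norm_def L2_set_def)
    hence "Im z * cvec_norm w \<le> 0" using shifted_lower_bound[OF A w(1) a z] w(3) by simp
    hence "cvec_norm w = 0" using z cvec_norm_nonneg[of w] by (simp add: mult_le_0_iff)
    thus False using cvec_norm_eq_0[OF w(1)] w(2) by simp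
  qed
  show G: "?G \<in> carrier_mat n n" using adj_mat[OF S] by (simp add: resolvent_def)
  show SG: "?S * ?G = 1\<^sub>m n"
    unfolding resolvent_def using adj_mat[OF S] S d
    by (subst mult_smult_distrib[of _ n n _ n]) (auto intro!: eq_matI)
  show "?G * ?S = 1\<^sub>m n"
    unfolding resolvent_def using adj_mat[OF S] S d
    by (subst mult_smult_assoc_mat[of _ n n _ n]) (auto intro!: eq_matI)
  show "op_bound ?G (1 / Im z)"
    unfolding op_bound_def
  proof (intro conjI ballI)
    fix w :: "complex vec" assume "w \<in> carrier_vec (dim_col ?G)"
    hence w: "w \<in> carrier_vec n" using G by auto
    have "Im z * cvec_norm (?G *\<^sub>v w) \<le> cvec_norm (?S *\<^sub>v (?G *\<^sub>v w))"
      using G w by (intro shifted_lower_bound[OF A _ a z]) auto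
    also have "?S *\<^sub>v (?G *\<^sub>v w) = w"
      using assoc_mult_mat_vec[OF S G w] SG w by simp
    finally show "cvec_norm (?G *\<^sub>v w) \<le> 1 / Im z * cvec_norm w" using z by (simp add: field_simps)
  qed (use z in auto)
qed

text \<open>The resolvent identity.\<close>
lemma inverse_difference:
  fixes S1 :: "complex mat"
  assumes "S1 \<in> carrier_mat n n" "S2 \<in> carrier_mat n n" "G1 \<in> carrier_mat n n" "G2 \<in> carrier_mat n n"
    and 1: "G1 * S1 = 1\<^sub>m n" and 2: "S2 * G2 = 1\<^sub>m n"
  shows "G1 - G2 = G1 * (S2 - S1) * G2"
proof -
  have "G1 * (S2 - S1) * G2 = (G1 * S2 - G1 * S1) * G2"
    using assms by (simp add: mult_minus_distrib_mat[of _ n n])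
  also have "\<dots> = G1 * S2 * G2 - G1 * S1 * G2"
    using assms by (intro minus_mult_distrib_mat[of _ n n]) auto
  also have "G1 * S2 * G2 = G1" using assms by (simp add: assoc_mult_mat[of _ n n _ n _ n])
  also have "G1 * S1 * G2 = G2" using assms by simp
  finally show ?thesis by simp
qed

lemma psd_mat_carrier: "psd_mat n A \<Longrightarrow> A \<in> carrier_mat n n" by (simp add: psd_mat_def)

lemma psd_mat_symmetric: 
  assumes "psd_mat n A" shows "transpose_mat A = A"
  using assms by (intro eq_matI) (auto simp: psd_mat_def)

lemma quadratic_form_sum:
  fixes A :: "real mat"
  assumes "A \<in> carrier_mat n n" "v \<in> carrier_vec n"
  shows "v \<bullet> (A *\<^sub>v v) = (\<Sum>i<n. \<Sum>j<n. A $$ (i, j) * (v $ i * v $ j))"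
  using assms by (simp add: scalar_prod_def atLeast0LessThan sum_distrib_left mult_ac)

lemma mat_trace_diagonalized:
  fixes U :: "real mat"
  assumes U: "U \<in> carrier_mat n n" and UtU: "transpose_mat U * U = 1\<^sub>m n"
  shows "mat_trace (U * mat_diag n l * transpose_mat U) = (\<Sum>i<n. l i)"
proof -
  have "mat_trace (U * mat_diag n l * transpose_mat U) = (\<Sum>k<n. \<Sum>i<n. U $$ (k, i) * l i * U $$ (k, i))"
    using U by (auto simp: mat_trace_def mat_diag_mult_right[OF U] scalar_prod_def atLeast0LessThan intro!: sum.cong)
  also have "\<dots> = (\<Sum>i<n. l i * (\<Sum>k<n. U $$ (k, i) * U $$ (k, i)))"
    by (subst sum.swap) (simp add: sum_distrib_left mult_ac)
  also have "\<dots> = (\<Sum>i<n. l i)"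
  proof (intro sum.cong refl)
    fix i assume "i \<in> {..<n}"
    hence i: "i < n" by simp
    have "(transpose_mat U * U) $$ (i, i) = (\<Sum>k<n. U $$ (k, i) * U $$ (k, i))"
      using U i by (simp add: scalar_prod_def atLeast0LessThan)
    thus "l i * (\<Sum>k<n. U $$ (k, i) * U $$ (k, i)) = l i" using i by (simp add: UtU)
  qed
  finally show ?thesis .
qed

lemma resolvent_unique:
  assumes A: "psd_mat n A" and a: "Im a \<le> 0" and z: "Im z > 0"
    and G: "G \<in> carrier_mat n n" and 1: "shifted a A z * G = 1\<^sub>m n"
  shows "resolvent a A z = G"
proof -
  let ?R = "resolvent a A z" and ?S = "shifted a A z"
  have R: "?R \<in> carrier_mat n n" and S: "?S \<in> carrier_mat n n"
    using resolvent_inverse[OF A a z] shifted_carrier[OF psd_mat_carrier[OF A]] by auto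
  have "?R = ?R * (?S * G)" using R by (simp add: 1)
  also have "\<dots> = (?R * ?S) * G" using R S G by (simp add: assoc_mult_mat[of _ n n _ n _ n])
  also have "\<dots> = G" using G by (simp add: resolvent_inverse[OF A a z])
  finally show ?thesis .
qed

text \<open>One family of eigenvalues serves all purposes at once: it describes the spectral
  distribution, the trace, the traces of resolvents, and it inherits bounds on the quadratic form.\<close>
lemma psd_mat_eigenvalues:
  assumes A: "psd_mat n A"
  obtains l where "\<And>i. i < n \<Longrightarrow> 0 \<le> l i"
    "\<And>x. esd A x = real (card {i. i < n \<and> l i \<le> x}) / real n"
    "mat_trace A = (\<Sum>i<n. l i)"
    "\<And>a z. Im a \<le> 0 \<Longrightarrow> Im z > 0 \<Longrightarrow> ctrace (resolvent a A z) = (\<Sum>i<n. 1 / (a * of_real (l i) - z))"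
    "\<And>C i. (\<And>u. (\<Sum>i<n. \<Sum>j<n. A $$ (i, j) * (u i * u j)) \<le> C * (\<Sum>i<n. (u i)\<^sup>2)) \<Longrightarrow> i < n \<Longrightarrow> l i \<le> C"
proof -
  have Ac: "A \<in> carrier_mat n n" using A by (rule psd_mat_carrier)
  obtain U l where U: "U \<in> carrier_mat n n" and UtU: "transpose_mat U * U = 1\<^sub>m n" 
    and UUt: "U * transpose_mat U = 1\<^sub>m n" and AU: "A = U * mat_diag n l * transpose_mat U"
    using symmetric_mat_diagonalization[OF Ac psd_mat_symmetric[OF A]] by blast
  have ev: "(\<Sum>i<n. \<Sum>j<n. A $$ (i, j) * (col U k $ i * col U k $ j)) = l k" 
    and ev1: "(\<Sum>i<n. (col U k $ i)\<^sup>2) = 1" if k: "k < n" for k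
  proof -
    have c: "col U k \<in> carrier_vec n" using U by auto
    have "(\<Sum>i<n. \<Sum>j<n. A $$ (i, j) * (col U k $ i * col U k $ j)) = col U k \<bullet> (A *\<^sub>v col U k)"
      using quadratic_form_sum[OF Ac c] by simp
    also have "\<dots> = l k" unfolding AU diagonalized_eigenvector(1)[OF U UtU k]
      using c diagonalized_eigenvector(3)[OF U UtU k] by simp
    finally show "(\<Sum>i<n. \<Sum>j<n. A $$ (i, j) * (col U k $ i * col U k $ j)) = l k" .
    show "(\<Sum>i<n. (col U k $ i)\<^sup>2) = 1" using diagonalized_eigenvector(3)[OF U UtU k] U
      by (simp add: scalar_prod_def atLeast0LessThan power2_eq_square)
  qed
  have l0: "0 \<le> l k" if k: "k < n" for k
  proof -
    have "0 \<le> (\<Sum>i<n. \<Sum>j<n. A $$ (i, j) * (col U k $ i * col U k $ j))"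
      using A unfolding psd_mat_def by (elim conjE) (erule spec)
    thus ?thesis using ev[OF k] by simp
  qed
  have lC: "l k \<le> C" if "\<And>u. (\<Sum>i<n. \<Sum>j<n. A $$ (i, j) * (u i * u j)) \<le> C * (\<Sum>i<n. (u i)\<^sup>2)" "k < n" for C k
    using that(1)[of "\<lambda>i. col U k $ i"] ev[OF that(2)] ev1[OF that(2)] by simp
  have tr: "ctrace (resolvent a A z) = (\<Sum>i<n. 1 / (a * of_real (l i) - z))" if a: "Im a \<le> 0" and z: "Im z > 0" for a z
  proof -
    let ?V = "map_mat complex_of_real U"
    let ?W = "map_mat complex_of_real (transpose_mat U)"
    let ?d = "\<lambda>i. a * of_real (l i) - z"
    have V: "?V \<in> carrier_mat n n" and W: "?W \<in> carrier_mat n n" using U by auto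
    have VW: "?V * ?W = 1\<^sub>m n" and WV: "?W * ?V = 1\<^sub>m n"
      using of_real_hom.mat_hom_mult[OF U, of "transpose_mat U" n, where 'a=complex]
        of_real_hom.mat_hom_mult[of "transpose_mat U" n n U n, where 'a=complex] U
      by (auto simp: UUt UtU of_real_hom.mat_hom_one)
    have d0: "?d i \<noteq> 0" if "i < n" for i
    proof
      assume "?d i = 0"
      hence "Im (a * of_real (l i) - z) = 0" by simp
      moreover have "Im a * l i \<le> 0" using a l0[OF that] by (rule mult_nonpos_nonneg)
      ultimately show False using z by simp
    qed
    define D where "D = mat_diag n ?d"
    define E where "E = mat_diag n (\<lambda>i. 1 / ?d i)"
    have D: "D \<in> carrier_mat n n" and E: "E \<in> carrier_mat n n" by (auto simp: D_def E_def)
    have DE: "D * E = 1\<^sub>m n" unfolding D_def E_def mat_diag_diag using d0 by (intro eq_matI) (auto simp: mat_diag_def)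
    have sh: "shifted a A z = ?V * D * ?W"
    proof (rule eq_matI)
      fix i j assume "i < dim_row (?V * D * ?W)" "j < dim_col (?V * D * ?W)"
      hence ij: "i < n" "j < n" using V W by auto
      have "(?V * D * ?W) $$ (i, j) = (\<Sum>k<n. of_real (U $$ (i, k)) * ?d k * of_real (U $$ (j, k)))"
        using ij U unfolding D_def mat_diag_mult_right[OF V] by (simp add: scalar_prod_def atLeast0LessThan)
      also have "\<dots> = a * of_real (\<Sum>k<n. U $$ (i, k) * l k * U $$ (j, k)) - z * of_real (\<Sum>k<n. U $$ (i, k) * U $$ (j, k))"
        by (simp add: sum_subtractf sum_distrib_left algebra_simps)
      also have "(\<Sum>k<n. U $$ (i, k) * l k * U $$ (j, k)) = A $$ (i, j)"
        using ij U unfolding AU mat_diag_mult_right[OF U] by (simp add: scalar_prod_def atLeast0LessThan)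
      also have "(\<Sum>k<n. U $$ (i, k) * U $$ (j, k)) = (U * transpose_mat U) $$ (i, j)"
        using ij U by (simp add: scalar_prod_def atLeast0LessThan)
      also have "\<dots> = (if i = j then 1 else 0)" using ij by (simp add: UUt)
      finally show "shifted a A z $$ (i, j) = (?V * D * ?W) $$ (i, j)"
        using ij Ac by (simp add: shifted_def)
    qed (use V W Ac in \<open>auto simp: shifted_def\<close>)
    have "shifted a A z * (?V * E * ?W) = ?V * (D * ((?W * ?V) * E)) * ?W"
      unfolding sh using V W D E by (simp add: assoc_mult_mat[of _ n n _ n _ n])
    also have "\<dots> = 1\<^sub>m n" unfolding WV using V W D E DE VW by simp
    finally have "resolvent a A z = ?V * E * ?W"
      using V W E by (intro resolvent_unique[OF A a z]) auto
    hence "ctrace (resolvent a A z) = ctrace ((?V * E) * ?W)" by simp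
    also have "\<dots> = ctrace (?W * (?V * E))" using V E W by (intro ctrace_comm[of _ n]) auto
    also have "?W * (?V * E) = E"
      using assoc_mult_mat[OF W V E] E by (simp add: WV)
    finally show ?thesis by (simp add: E_def ctrace_def mat_diag_def)
  qed
  show ?thesis
    by (rule that[of l, OF l0 _ _ tr lC]) (auto simp: AU esd_diagonalized[OF U UtU UUt] mat_trace_diagonalized[OF U UtU])
qed

section \<open>Perturbation of resolvents in trace norm\<close>

text \<open>The difference of the resolvents \<open>G\<^sub>A\<close> and \<open>G\<^sub>B\<close> is \<open>G\<^sub>A (B - A) G\<^sub>B\<close>, and by cyclicity a
  rank-one term of \<open>B - A\<close> contributes the quadratic form of \<open>G\<^sub>B M G\<^sub>A\<close> at its vector. The bound
  contains the trace norm of the perturbation instead of its operator norm times the dimension.\<close>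
lemma resolvent_gram_perturbation:
  assumes A: "psd_mat n A" and B: "psd_mat n B" and z: "Im z > 0"
    and diff: "\<And>i j. i < n \<Longrightarrow> j < n \<Longrightarrow> B $$ (i, j) - A $$ (i, j) = (\<Sum>s\<in>S. c s * (u s i * u s j))"
    and M: "op_bound M m" "M \<in> carrier_mat n n"
  shows "cmod (ctrace (M * resolvent 1 A z) - ctrace (M * resolvent 1 B z)) \<le>
     m * (\<Sum>s\<in>S. \<bar>c s\<bar> * (\<Sum>i<n. (u s i)\<^sup>2)) / (Im z)\<^sup>2"
proof -
  let ?G = "resolvent 1 A z" and ?H = "resolvent 1 B z"
  let ?X = "cgram n S (\<lambda>s. of_real (c s)) u"
  have i: "Im (1::complex) \<le> 0" by simp
  note G = resolvent_inverse[OF A i z] and H = resolvent_inverse[OF B i z]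
  have Ac: "A \<in> carrier_mat n n" and Bc: "B \<in> carrier_mat n n" using A B by (auto simp: psd_mat_def)
  have X: "?X \<in> carrier_mat n n" by simp
  have "?G - ?H = ?G * (shifted 1 B z - shifted 1 A z) * ?H"
    by (rule inverse_difference[of _ n]) (use G H Ac Bc in auto)
  also have "shifted 1 B z - shifted 1 A z = ?X"
  proof (rule eq_matI)
    fix i j assume "i < dim_row ?X" "j < dim_col ?X"
    hence ij: "i < n" "j < n" by auto
    have "of_real (B $$ (i, j)) - of_real (A $$ (i, j)) = (\<Sum>s\<in>S. complex_of_real (c s) * of_real (u s i * u s j))"
      using diff[OF ij] by (metis (no_types, lifting) of_real_diff of_real_mult of_real_sum sum.cong)
    thus "(shifted 1 B z - shifted 1 A z) $$ (i, j) = ?X $$ (i, j)"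
      using ij Ac Bc by (simp add: shifted_def cgram_def)
  qed (use Ac Bc in \<open>auto simp: shifted_def\<close>)
  finally have GH: "?G - ?H = ?G * ?X * ?H" .
  have op: "op_bound (?H * M * ?G) (1 / Im z * m * (1 / Im z))"
    using G H M by (intro op_bound_mult[of _ _ _ _ n]) auto
  have "ctrace (M * ?G) - ctrace (M * ?H) = ctrace (M * (?G - ?H))"
    using M G H by (simp add: mult_minus_distrib_mat[of _ n n] ctrace_arith[of _ n])
  also have "M * (?G - ?H) = (M * ?G) * (?X * ?H)"
    unfolding GH using M G(1) H(1) X by (simp add: assoc_mult_mat[of _ n n _ n _ n] del: gram_carrier)
  also have "ctrace \<dots> = ctrace ((?X * ?H) * (M * ?G))"
    using M G(1) H(1) X by (intro ctrace_comm[of _ n]) auto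
  also have "(?X * ?H) * (M * ?G) = ?X * (?H * M * ?G)"
    using M G(1) H(1) X by (simp add: assoc_mult_mat[of _ n n _ n _ n] del: gram_carrier)
  also have "ctrace \<dots> = (\<Sum>s\<in>S. of_real (c s) * qform (?H * M * ?G) (u s))"
    using M G(1) H(1) by (intro ctrace_cgram_mult) auto
  also have "cmod \<dots> \<le> (\<Sum>s\<in>S. \<bar>c s\<bar> * (1 / Im z * m * (1 / Im z) * (\<Sum>i<n. (u s i)\<^sup>2)))"
  proof (intro order.trans[OF norm_sum] sum_mono)
    fix s
    have "cmod (qform (?H * M * ?G) (u s)) \<le> 1 / Im z * m * (1 / Im z) * (\<Sum>i<n. (u s i)\<^sup>2)"
      using M G(1) H(1) by (intro op_bound_qform[OF op]) auto
    thus "cmod (of_real (c s) * qform (?H * M * ?G) (u s)) \<le> \<bar>c s\<bar> * (1 / Im z * m * (1 / Im z) * (\<Sum>i<n. (u s i)\<^sup>2))"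
      by (simp only: norm_mult norm_of_real mult_left_mono abs_ge_zero)
  qed
  also have "\<dots> = m * (\<Sum>s\<in>S. \<bar>c s\<bar> * (\<Sum>i<n. (u s i)\<^sup>2)) / (Im z)\<^sup>2"
    by (simp add: sum_distrib_left sum_divide_distrib power2_eq_square mult_ac)
  finally show ?thesis .
qed

lemma op_bound_one: "op_bound (1\<^sub>m n) 1"
  by (auto simp: op_bound_def)

section \<open>Removing one sample vector\<close>

text \<open>With \<open>w = (A - z)\<^sup>-\<^sup>1 x\<close> the form equals \<open>w\<^sup>* A w - cnj z \<bar>w\<bar>\<^sup>2\<close>, from which both signs can be
  read off. The second one keeps \<open>1 + c q\<close> away from zero in the leave-one-out formulas.\<close>
lemma qform_resolvent_Im:
  assumes A: "psd_mat n A" and z: "Im z > 0"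
  shows "Im (qform (resolvent 1 A z) x) \<ge> 0" "Im (z * qform (resolvent 1 A z) x) \<ge> 0"
proof -
  let ?G = "resolvent 1 A z" and ?S = "shifted 1 A z"
  have Ac: "A \<in> carrier_mat n n" using A by (rule psd_mat_carrier)
  have i: "Im (1::complex) \<le> 0" by simp
  note G = resolvent_inverse[OF A i z]
  define w where "w = ?G *\<^sub>v real_cvec n x"
  have w: "w \<in> carrier_vec n" using G by (simp add: w_def)
  have Sw: "?S *\<^sub>v w = real_cvec n x"
    unfolding w_def using assoc_mult_mat_vec[OF shifted_carrier[OF Ac, of 1 z] G(1), of "real_cvec n x"] G(2) by simp
  obtain r where r: "r \<ge> 0" "(\<Sum>i<n. cnj (w $ i) * (?S *\<^sub>v w) $ i) = 1 * of_real r - z * of_real ((cvec_norm w)\<^sup>2)"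
    using shifted_form[OF A w] by blast
  have "qform ?G x = (\<Sum>i<n. complex_of_real (x i) * w $ i)"
    unfolding qform_scalar_prod[OF G(1)] w_def[symmetric] using w by (simp add: scalar_prod_def atLeast0LessThan)
  also have "\<dots> = cnj (\<Sum>i<n. cnj (w $ i) * (?S *\<^sub>v w) $ i)"
    unfolding Sw by (simp add: mult.commute)
  also have "\<dots> = of_real r - cnj z * of_real ((cvec_norm w)\<^sup>2)" unfolding r(2) by simp
  finally have q: "qform ?G x = of_real r - cnj z * of_real ((cvec_norm w)\<^sup>2)" .
  show "Im (qform ?G x) \<ge> 0" unfolding q using z by (simp del: of_real_power)
  have "z * qform ?G x = z * of_real r - of_real ((cmod z)\<^sup>2 * (cvec_norm w)\<^sup>2)"
    unfolding q by (simp add: algebra_simps complex_norm_square del: of_real_power)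
  hence "Im (z * qform ?G x) = Im z * r" by (simp del: of_real_power)
  thus "Im (z * qform ?G x) \<ge> 0" using z r by simp
qed

text \<open>Multiplied by \<open>z\<close>, the denominator has imaginary part at least \<open>Im z\<close>.\<close>
lemma inverse_one_plus_bound:
  assumes "Im (z * q) \<ge> 0" "Im z > 0" "c \<ge> 0"
  shows "cmod (1 / (1 + of_real c * q)) \<le> cmod z / Im z" "1 + of_real c * q \<noteq> 0"
proof -
  have "Im z \<le> Im z + c * Im (z * q)" using assms by simp
  also have "\<dots> = Im (z * (1 + of_real c * q))" by (simp add: algebra_simps)
  also have "\<dots> \<le> cmod (z * (1 + of_real c * q))" using abs_Im_le_cmod[of "z * (1 + of_real c * q)"] by linarith
  also have "\<dots> = cmod z * cmod (1 + of_real c * q)" by (simp add: norm_mult)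
  finally have le: "Im z \<le> cmod z * cmod (1 + of_real c * q)" .
  hence "cmod (1 + of_real c * q) > 0" using assms(2)
    by (metis less_le_trans mult_zero_right norm_ge_zero order_less_le)
  thus "1 + of_real c * q \<noteq> 0" by auto
  show "cmod (1 / (1 + of_real c * q)) \<le> cmod z / Im z"
    using le assms(2) \<open>cmod (1 + of_real c * q) > 0\<close> by (simp add: norm_divide field_simps)
qed

text \<open>The Sherman-Morrison formula, read off at the removed vector. It is applied with \<open>M\<close> the
  identity and with \<open>M\<close> the resolvent of the deterministic equivalent.\<close>
lemma leave_one_out:
  fixes n :: nat and I :: "'s set" and c :: real and x :: "'s \<Rightarrow> nat \<Rightarrow> real"
  assumes I: "finite I" "i \<in> I" and c: "c \<ge> 0" and z: "Im z > 0" and M: "M \<in> carrier_mat n n"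
  defines "G \<equiv> resolvent 1 (gram n I (\<lambda>_. c) x) z"
    and "H \<equiv> resolvent 1 (gram n (I - {i}) (\<lambda>_. c) x) z"
  shows "(1 + of_real c * qform H (x i)) * qform (G * M) (x i) = qform (H * M) (x i)"
proof -
  let ?A = "gram n I (\<lambda>_. c) x" and ?B = "gram n (I - {i}) (\<lambda>_. c) x"
  let ?X = "cgram n {i} (\<lambda>_. of_real c) x"
  have i: "Im (1::complex) \<le> 0" by simp
  have A: "psd_mat n ?A" and B: "psd_mat n ?B" using c by (auto intro: psd_gram)
  note G = resolvent_inverse[OF A i z, folded G_def] and H = resolvent_inverse[OF B i z, folded H_def]
  have "H - G = H * (shifted 1 ?A z - shifted 1 ?B z) * G"
    by (rule inverse_difference[of _ n]) (use G H in auto)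
  also have "shifted 1 ?A z - shifted 1 ?B z = ?X"
    using I by (intro eq_matI) (auto simp: shifted_def cgram_def gram_def sum.remove[of I i])
  finally have HG: "H - G = H * ?X * G" .
  have X: "?X \<in> carrier_mat n n" by simp
  have "H * M - G * M = H * ?X * (G * M)"
    unfolding minus_mult_distrib_mat[OF H(1) G(1) M, symmetric] HG
    using H(1) G(1) M X by (simp add: assoc_mult_mat[of _ n n _ n _ n] del: gram_carrier)
  moreover have "qform (H * M - G * M) (x i) = qform (H * M) (x i) - qform (G * M) (x i)"
    using H(1) G(1) M by (simp add: qform_def sum_subtractf algebra_simps)
  moreover have "qform (H * ?X * (G * M)) (x i) = of_real c * qform H (x i) * qform (G * M) (x i)"
    using H(1) G(1) M by (intro qform_rank_one_factor) auto
  ultimately show ?thesis by (simp add: algebra_simps)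
qed

text \<open>The trace of \<open>(B - z) G = 1\<close>, with the trace of \<open>B G\<close> expanded over the vectors and each
  term rewritten by \<open>leave_one_out\<close>.\<close>
lemma gram_resolvent_trace:
  fixes n :: nat and I :: "'s set" and c :: real and x :: "'s \<Rightarrow> nat \<Rightarrow> real"
  assumes I: "finite I" and c: "c \<ge> 0" and z: "Im z > 0"
  defines "G \<equiv> resolvent 1 (gram n I (\<lambda>_. c) x) z"
    and "H \<equiv> \<lambda>i. resolvent 1 (gram n (I - {i}) (\<lambda>_. c) x) z"
  shows "of_nat n + z * ctrace G = (\<Sum>i\<in>I. 1 - 1 / (1 + of_real c * qform (H i) (x i)))"
proof -
  let ?A = "gram n I (\<lambda>_. c) x" and ?X = "cgram n I (\<lambda>_. of_real c) x"
  have i: "Im (1::complex) \<le> 0" by simp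
  have A: "psd_mat n ?A" using c by (auto intro: psd_gram)
  note G = resolvent_inverse[OF A i z, folded G_def]
  have X: "?X \<in> carrier_mat n n" by simp
  have "shifted 1 ?A z = ?X - z \<cdot>\<^sub>m 1\<^sub>m n" by (intro eq_matI) (auto simp: shifted_def cgram_def gram_def)
  hence "1\<^sub>m n = (?X - z \<cdot>\<^sub>m 1\<^sub>m n) * G" using G by simp
  also have "\<dots> = ?X * G - z \<cdot>\<^sub>m G" using G(1) X
    by (subst minus_mult_distrib_mat[of _ n n]) (auto simp: mult_smult_assoc_mat[of _ n n])
  finally have "ctrace (1\<^sub>m n) = ctrace (?X * G - z \<cdot>\<^sub>m G)" by simp
  also have "\<dots> = (\<Sum>i\<in>I. of_real c * qform G (x i)) - z * ctrace G"
    using ctrace_arith(2)[of "?X * G" n "z \<cdot>\<^sub>m G"] ctrace_arith(3)[OF G(1) G(1), of z]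
      ctrace_cgram_mult[OF G(1), of I "\<lambda>_. of_real c" x] G(1) mult_carrier_mat[OF X G(1)]
    by (simp add: sum_distrib_left)
  finally have "of_nat n + z * ctrace G = (\<Sum>i\<in>I. of_real c * qform G (x i))"
    by (simp add: ctrace_def algebra_simps)
  also have "\<dots> = (\<Sum>i\<in>I. 1 - 1 / (1 + of_real c * qform (H i) (x i)))"
  proof (intro sum.cong refl)
    fix i assume i: "i \<in> I"
    have B: "psd_mat n (gram n (I - {i}) (\<lambda>_. c) x)" using c by (auto intro: psd_gram)
    have Hc: "H i \<in> carrier_mat n n" unfolding H_def using resolvent_inverse(1)[OF B _ z, of 1] by simp
    have ne: "1 + of_real c * qform (H i) (x i) \<noteq> 0"
      unfolding H_def by (intro inverse_one_plus_bound(2)[OF _ z c] qform_resolvent_Im[OF B z])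
    have "(1 + of_real c * qform (H i) (x i)) * qform G (x i) = qform (H i) (x i)"
      using leave_one_out[OF I i c z one_carrier_mat, of n x] G(1) Hc by (simp add: G_def H_def)
    thus "of_real c * qform G (x i) = 1 - 1 / (1 + of_real c * qform (H i) (x i))"
      using ne by (simp add: field_simps)
  qed
  finally show ?thesis .
qed

section \<open>The deterministic equivalent of a sample covariance resolvent\<close>

text \<open>For the sample covariance matrix \<open>B\<close> with resolvent \<open>G\<close>, cyclicity and the resolvent
  identity turn \<open>tr D - tr G\<close> into \<open>tr (B G D) - a tr (T G D)\<close>. Expanding \<open>B\<close> over its vectors and
  removing from \<open>G\<close> the vector at hand gives terms \<open>\<alpha>\<^sub>i x\<^sub>i\<^sup>T H\<^sub>i D x\<^sub>i\<close> with
  \<open>\<alpha>\<^sub>i = 1 / (1 + x\<^sub>i\<^sup>T H\<^sub>i x\<^sub>i / N)\<close>. If quadratic forms are close to traces (errors \<open>\<delta>\<close> and \<open>\<eta>\<close>), the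
  \<open>\<alpha>\<^sub>i\<close> are close to a common value, hence to their average, which is \<open>1 - p/N - (z/N) tr G\<close> by
  \<open>gram_resolvent_trace\<close>; and the forms in \<open>H\<^sub>i D\<close> are close to \<open>tr (T G D)\<close>. For a good choice of
  \<open>a\<close> the two traces nearly cancel. The statement is deterministic: all randomness is in the size
  of the errors.\<close>
lemma deterministic_equivalent_bound:
  fixes p N :: nat and x :: "nat \<Rightarrow> nat \<Rightarrow> real" and T :: "real mat" and a z :: complex
    and K :: "'k set" and d :: "'k \<Rightarrow> real" and r :: "'k \<Rightarrow> nat \<Rightarrow> real"
  assumes N: "N > 0" and z: "Im z > 0" and a: "Im a \<le> 0"
    and T: "T = gram p K d r" and d: "\<And>k. k \<in> K \<Longrightarrow> d k \<ge> 0"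
    and \<kappa>: "op_bound (map_mat complex_of_real T) \<kappa>"
  defines "G \<equiv> resolvent 1 (gram p {..<N} (\<lambda>_. 1 / real N) x) z"
    and "H \<equiv> \<lambda>i. resolvent 1 (gram p ({..<N} - {i}) (\<lambda>_. 1 / real N) x) z"
    and "D \<equiv> resolvent a T z" and "TC \<equiv> map_mat complex_of_real T"
  defines "\<rho> \<equiv> (\<Sum>i<N. \<Sum>k<p. (x i k)\<^sup>2) / real N"
    and "\<delta> \<equiv> (\<Sum>i<N. cmod (qform (H i) (x i) - ctrace (TC * H i))) / real N"
    and "\<eta> \<equiv> (\<Sum>i<N. cmod (qform (H i * D) (x i) - ctrace (TC * (H i * D)))) / real N"
  shows "cmod (ctrace D - ctrace G) \<le> cmod z / Im z * \<eta> + real p * \<kappa> / (Im z)\<^sup>2 *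
      (2 * (cmod z / Im z)\<^sup>2 / real N * (\<delta> + \<kappa> * \<rho> / ((Im z)\<^sup>2 * real N)) 
        + cmod (1 - of_nat p / of_nat N - z / of_nat N * ctrace G - a))
      + cmod a * \<kappa> * \<rho> / ((Im z) ^ 3 * real N)"
proof -
  define c where "c = 1 / real N"
  define v where "v = Im z"
  define \<zeta> where "\<zeta> = cmod z / Im z"
  have v: "v > 0" and c0: "c \<ge> 0" and \<zeta>0: "\<zeta> \<ge> 0" using z by (auto simp: v_def c_def \<zeta>_def)
  let ?I = "{..<N}"
  have i1: "Im (1::complex) \<le> 0" by simp
  have psdT: "psd_mat p T" unfolding T by (rule psd_gram) (rule d)
  have psdB: "psd_mat p (gram p ?I (\<lambda>_. 1 / real N) x)" by (rule psd_gram) auto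
  have psdBi: "psd_mat p (gram p (?I - {i}) (\<lambda>_. 1 / real N) x)" for i by (rule psd_gram) auto
  note Gp = resolvent_inverse[OF psdB i1 z, folded G_def]
  have Hc: "H i \<in> carrier_mat p p" and Hop: "op_bound (H i) (1 / Im z)" for i
    unfolding H_def by (rule resolvent_inverse[OF psdBi i1 z])+
  note Dp = resolvent_inverse[OF psdT a z, folded D_def]
  have Tc: "T \<in> carrier_mat p p" by (simp add: T)
  have TCc: "TC \<in> carrier_mat p p" using Tc by (simp add: TC_def)
  have TCop: "op_bound TC \<kappa>" using \<kappa> by (simp add: TC_def)
  have \<kappa>0: "\<kappa> \<ge> 0" using TCop by (rule op_bound_nonneg)
  have TCg: "TC = cgram p K (\<lambda>k. of_real (d k)) r"
    by (intro eq_matI) (auto simp: TC_def T gram_def cgram_def)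
  define q where "q i = qform (H i) (x i)" for i
  define al where "al i = 1 / (1 + of_real c * q i)" for i
  define t where "t = ctrace (TC * G)"
  \<comment> \<open>The common value that the \<open>\<alpha>\<^sub>i\<close> are compared with. It satisfies the same bound because \<open>T\<close> is
    a positive combination of rank-one matrices.\<close>
  define al0 where "al0 = 1 / (1 + of_real c * t)"
  have qIm: "Im (z * q i) \<ge> 0" for i unfolding q_def H_def by (rule qform_resolvent_Im[OF psdBi z])
  have t_sum: "t = (\<Sum>k\<in>K. of_real (d k) * qform G (r k))"
    unfolding t_def TCg using Gp by (intro ctrace_cgram_mult) auto
  have tIm: "Im (z * t) \<ge> 0"
  proof -
    have "z * t = (\<Sum>k\<in>K. of_real (d k) * (z * qform G (r k)))" unfolding t_sum by (simp add: sum_distrib_left mult_ac)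
    hence "Im (z * t) = (\<Sum>k\<in>K. d k * Im (z * qform G (r k)))" by simp
    also have "\<dots> \<ge> 0" unfolding G_def by (intro sum_nonneg mult_nonneg_nonneg d qform_resolvent_Im[OF psdB z]) auto
    finally show ?thesis .
  qed
  have al_le: "cmod (al i) \<le> \<zeta>" and al_ne: "1 + of_real c * q i \<noteq> 0" for i
    unfolding al_def \<zeta>_def using inverse_one_plus_bound[OF qIm z c0] by auto
  have al0_le: "cmod al0 \<le> \<zeta>" and al0_ne: "1 + of_real c * t \<noteq> 0"
    unfolding al0_def \<zeta>_def using inverse_one_plus_bound[OF tIm z c0] by auto
  define X where "X i = (\<Sum>k<p. (x i k)\<^sup>2)" for i
  have X0: "X i \<ge> 0" for i by (auto simp: X_def intro: sum_nonneg)
  have rank1: "cmod (ctrace (P * H i) - ctrace (P * G)) \<le> m * (c * X i) / v\<^sup>2"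
    if P: "op_bound P m" "P \<in> carrier_mat p p" and i: "i < N" for P m i
  proof -
    have "cmod (ctrace (P * H i) - ctrace (P * G)) \<le> m * (\<Sum>s\<in>{i}. \<bar>c\<bar> * (\<Sum>k<p. (x s k)\<^sup>2)) / (Im z)\<^sup>2"
      unfolding H_def G_def
      by (rule resolvent_gram_perturbation[OF psdBi psdB z _ P])
         (use i in \<open>simp add: gram_def c_def sum.remove[of ?I i]\<close>)
    thus ?thesis using c0 by (simp add: X_def v_def)
  qed
  define e1 where "e1 i = cmod (q i - ctrace (TC * H i))" for i
  have al_diff: "cmod (al i - al0) \<le> \<zeta>\<^sup>2 * c * (e1 i + \<kappa> * (c * X i) / v\<^sup>2)" if i: "i < N" for i
  proof -
    have "al i - al0 = of_real c * (t - q i) * (al i * al0)"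
      using al_ne[of i] al0_ne by (simp add: al_def al0_def field_simps)
    hence "cmod (al i - al0) = c * cmod (q i - t) * (cmod (al i) * cmod al0)"
      using c0 by (simp add: norm_mult norm_minus_commute)
    also have "\<dots> \<le> c * (e1 i + \<kappa> * (c * X i) / v\<^sup>2) * (\<zeta> * \<zeta>)"
    proof (intro mult_mono al_le al0_le c0 order.refl)
      have "cmod (q i - t) \<le> e1 i + cmod (ctrace (TC * H i) - t)"
        unfolding e1_def by (rule norm_triangle_ineq4[of "q i - ctrace (TC * H i)" "t - ctrace (TC * H i)", simplified norm_minus_commute[of t], THEN order.trans[rotated]]) simp
      thus "cmod (q i - t) \<le> e1 i + \<kappa> * (c * X i) / v\<^sup>2"
        using rank1[OF TCop TCc i] by (simp add: t_def)
    qed (use c0 \<zeta>0 X0[of i] \<kappa>0 v in \<open>auto simp: e1_def intro!: mult_nonneg_nonneg add_nonneg_nonneg divide_nonneg_nonneg\<close>)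
    finally show ?thesis by (simp add: power2_eq_square mult_ac)
  qed
  \<comment> \<open>The average of the \<open>\<alpha>\<^sub>i\<close> is known exactly, which removes the comparison value again.\<close>
  define Ab where "Ab = of_real c * (\<Sum>i<N. al i)"
  have Ab: "Ab = 1 - of_nat p / of_nat N - z / of_nat N * ctrace G"
  proof -
    have "of_nat p + z * ctrace G = (\<Sum>i<N. 1 - al i)"
      unfolding G_def al_def q_def H_def c_def by (intro gram_resolvent_trace z) auto
    hence "of_nat p + z * ctrace G = of_nat N - (\<Sum>i<N. al i)" by (simp add: sum_subtractf)
    hence "(\<Sum>i<N. al i) = of_nat N - of_nat p - z * ctrace G" by (simp add: algebra_simps)
    hence "Ab = (of_nat N - of_nat p - z * ctrace G) / of_nat N" by (simp add: Ab_def c_def)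
    thus ?thesis using N by (simp add: diff_divide_distrib)
  qed
  define e2 where "e2 i = cmod (qform (H i * D) (x i) - ctrace (TC * (H i * D)))" for i
  define W where "W = (\<Sum>i<N. \<zeta>\<^sup>2 * c * (e1 i + \<kappa> * (c * X i) / v\<^sup>2))"
  have cN: "c * real N = 1" using N by (simp add: c_def)
  have sumW: "(\<Sum>i<N. cmod (al i - al0)) \<le> W" unfolding W_def by (intro sum_mono al_diff) auto
  have "cmod (Ab - al0) \<le> c * W"
  proof -
    have "Ab - al0 = of_real c * (\<Sum>i<N. al i - al0)"
    proof -
      have "of_real c * (\<Sum>i<N. al i - al0) = Ab - of_real (c * real N) * al0"
        by (simp add: Ab_def sum_subtractf right_diff_distrib mult.assoc)
      thus ?thesis by (simp add: cN)
    qed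
    hence "cmod (Ab - al0) \<le> c * (\<Sum>i<N. cmod (al i - al0))"
      using c0 by (simp add: norm_mult mult_left_mono norm_sum)
    thus ?thesis using sumW c0 by (meson mult_left_mono order.trans)
  qed
  have al_a: "c * (\<Sum>i<N. cmod (al i - a)) \<le> 2 * (c * W) + cmod (Ab - a)"
  proof -
    have "(\<Sum>i<N. cmod (al i - a)) \<le> (\<Sum>i<N. cmod (al i - al0) + (cmod (Ab - al0) + cmod (Ab - a)))"
    proof (intro sum_mono)
      fix i
      have "al i - a = (al i - al0) - (Ab - al0) + (Ab - a)" by simp
      thus "cmod (al i - a) \<le> cmod (al i - al0) + (cmod (Ab - al0) + cmod (Ab - a))"
        by (metis (no_types, lifting) add.assoc add_right_mono norm_triangle_ineq norm_triangle_ineq4 order.trans)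
    qed
    also have "\<dots> \<le> W + real N * (c * W + cmod (Ab - a))"
      using sumW \<open>cmod (Ab - al0) \<le> c * W\<close> by (simp add: sum.distrib add_mono mult_left_mono)
    finally have "c * (\<Sum>i<N. cmod (al i - a)) \<le> c * (W + real N * (c * W + cmod (Ab - a)))"
      using c0 by (rule mult_left_mono)
    also have "\<dots> = c * W + (c * real N) * (c * W + cmod (Ab - a))" by (simp add: algebra_simps)
    also have "\<dots> = 2 * (c * W) + cmod (Ab - a)" by (simp add: cN)
    finally show ?thesis .
  qed
  have main: "ctrace D - ctrace G = of_real c * (\<Sum>i<N. al i * qform (H i * D) (x i)) - a * ctrace (TC * (G * D))"
  proof -
    let ?X = "cgram p ?I (\<lambda>_. of_real c) x"
    have Xc: "?X \<in> carrier_mat p p" by simp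
    have "D - G = D * (shifted 1 (gram p ?I (\<lambda>_. 1 / real N) x) z - shifted a T z) * G"
      by (rule inverse_difference[of _ p]) (use Dp Gp Tc in auto)
    also have "shifted 1 (gram p ?I (\<lambda>_. 1 / real N) x) z - shifted a T z = ?X - a \<cdot>\<^sub>m TC"
      using Tc by (intro eq_matI) (auto simp: shifted_def cgram_def gram_def TC_def c_def)
    finally have DG: "D - G = D * (?X - a \<cdot>\<^sub>m TC) * G" .
    have "ctrace D - ctrace G = ctrace (D * ((?X - a \<cdot>\<^sub>m TC) * G))"
    proof -
      have "?X - a \<cdot>\<^sub>m TC \<in> carrier_mat p p" using TCc by (intro minus_carrier_mat) auto
      from assoc_mult_mat[OF Dp(1) this Gp(1)] show ?thesis
        using DG ctrace_arith(2)[OF Dp(1) Gp(1)] by simp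
    qed
    also have "\<dots> = ctrace ((?X - a \<cdot>\<^sub>m TC) * G * D)"
      using Dp(1) Gp(1) TCc Xc by (intro ctrace_comm[of _ p]) auto
    also have "(?X - a \<cdot>\<^sub>m TC) * G * D = ?X * (G * D) - a \<cdot>\<^sub>m (TC * (G * D))"
      using Dp(1) Gp(1) TCc Xc by (simp add: assoc_mult_mat[of _ p p _ p _ p] minus_mult_distrib_mat[of _ p p] 
          mult_smult_assoc_mat[of _ p p] del: gram_carrier)
    also have "ctrace \<dots> = ctrace (?X * (G * D)) - a * ctrace (TC * (G * D))"
    proof -
      have GD: "G * D \<in> carrier_mat p p" using Gp(1) Dp(1) by simp
      have 1: "?X * (G * D) \<in> carrier_mat p p" "TC * (G * D) \<in> carrier_mat p p"
        by (rule mult_carrier_mat[OF Xc GD] mult_carrier_mat[OF TCc GD])+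
      hence "a \<cdot>\<^sub>m (TC * (G * D)) \<in> carrier_mat p p" by simp
      from ctrace_arith(2)[OF 1(1) this] ctrace_arith(3)[OF 1(2) 1(2), of a] show ?thesis by simp
    qed
    also have "ctrace (?X * (G * D)) = (\<Sum>i<N. of_real c * qform (G * D) (x i))"
      using Dp(1) Gp(1) by (intro ctrace_cgram_mult) auto
    also have "\<dots> = (\<Sum>i<N. of_real c * (al i * qform (H i * D) (x i)))"
    proof (intro sum.cong refl)
      fix i assume i: "i \<in> ?I"
      have "(1 + of_real c * q i) * qform (G * D) (x i) = qform (H i * D) (x i)"
        unfolding q_def G_def H_def c_def by (rule leave_one_out[OF _ i _ z Dp(1)]) auto
      thus "of_real c * qform (G * D) (x i) = of_real c * (al i * qform (H i * D) (x i))"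
        using al_ne[of i] by (simp add: al_def field_simps)
    qed
    finally show ?thesis by (simp add: sum_distrib_left)
  qed
  have tr_le: "cmod (ctrace (TC * (H i * D))) \<le> real p * \<kappa> / v\<^sup>2" for i
  proof -
    have "op_bound (TC * (H i * D)) (\<kappa> * (1 / v * (1 / v)))"
      using Hc[of i] Hop[of i] mult_carrier_mat[OF Hc[of i] Dp(1)] Dp TCop TCc by (intro op_bound_mult[of _ _ _ _ p]) (auto simp: v_def)
    hence "cmod (ctrace (TC * (H i * D))) \<le> real p * (\<kappa> * (1 / v * (1 / v)))"
      using mult_carrier_mat[OF TCc mult_carrier_mat[OF Hc[of i] Dp(1)]] by (intro op_bound_ctrace) auto
    thus ?thesis by (simp add: power2_eq_square)
  qed
  have tr_diff: "cmod (ctrace (TC * (H i * D)) - ctrace (TC * (G * D))) \<le> \<kappa> * (c * X i) / v ^ 3" if i: "i < N" for i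
  proof -
    have e: "ctrace (TC * (Y * D)) = ctrace ((D * TC) * Y)" if Y: "Y \<in> carrier_mat p p" for Y
    proof -
      have "ctrace (TC * (Y * D)) = ctrace ((TC * Y) * D)" using Y Dp(1) TCc by (simp add: assoc_mult_mat[of _ p p _ p _ p])
      also have "\<dots> = ctrace (D * (TC * Y))" using Y Dp(1) TCc by (intro ctrace_comm[of _ p]) auto
      finally show ?thesis using Y Dp(1) TCc by (simp add: assoc_mult_mat[of _ p p _ p _ p])
    qed
    have op: "op_bound (D * TC) (1 / v * \<kappa>)" using Dp TCop TCc by (intro op_bound_mult[of _ _ _ _ p]) (auto simp: v_def)
    have "cmod (ctrace ((D * TC) * H i) - ctrace ((D * TC) * G)) \<le> (1 / v * \<kappa>) * (c * X i) / v\<^sup>2"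
      using Dp(1) TCc by (intro rank1[OF op _ i]) auto
    also have "\<dots> = \<kappa> * (c * X i) / v ^ 3" by (simp add: power2_eq_square power3_eq_cube)
    finally show ?thesis by (simp add: e[OF Hc] e[OF Gp(1)])
  qed
  have "ctrace D - ctrace G = of_real c * (\<Sum>i<N. al i * qform (H i * D) (x i) - a * ctrace (TC * (G * D)))"
  proof -
    have "of_real c * (\<Sum>i<N. al i * qform (H i * D) (x i) - a * ctrace (TC * (G * D))) = 
       of_real c * (\<Sum>i<N. al i * qform (H i * D) (x i)) - of_real (c * real N) * (a * ctrace (TC * (G * D)))"
      by (simp add: sum_subtractf right_diff_distrib mult.assoc)
    thus ?thesis unfolding main cN by simp
  qed
  hence "cmod (ctrace D - ctrace G) \<le> c * (\<Sum>i<N. cmod (al i * qform (H i * D) (x i) - a * ctrace (TC * (G * D))))"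
    using c0 by (simp add: norm_mult mult_left_mono norm_sum)
  also have "\<dots> \<le> c * (\<Sum>i<N. \<zeta> * e2 i + cmod (al i - a) * (real p * \<kappa> / v\<^sup>2) + cmod a * (\<kappa> * (c * X i) / v ^ 3))"
  proof (intro mult_left_mono sum_mono c0)
    fix i assume "i \<in> ?I"
    hence i: "i < N" by simp
    have "al i * qform (H i * D) (x i) - a * ctrace (TC * (G * D)) =
       al i * (qform (H i * D) (x i) - ctrace (TC * (H i * D))) + (al i - a) * ctrace (TC * (H i * D))
       + a * (ctrace (TC * (H i * D)) - ctrace (TC * (G * D)))"
      by (simp add: algebra_simps)
    also have "cmod \<dots> \<le> cmod (al i * (qform (H i * D) (x i) - ctrace (TC * (H i * D)))) + cmod ((al i - a) * ctrace (TC * (H i * D)))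
       + cmod (a * (ctrace (TC * (H i * D)) - ctrace (TC * (G * D))))"
      by (intro order.trans[OF norm_triangle_ineq] add_right_mono norm_triangle_ineq)
    also have "\<dots> \<le> \<zeta> * e2 i + cmod (al i - a) * (real p * \<kappa> / v\<^sup>2) + cmod a * (\<kappa> * (c * X i) / v ^ 3)"
      unfolding norm_mult e2_def
      by (intro add_mono mult_mono al_le tr_le tr_diff i order.refl norm_ge_zero \<zeta>0)
    finally show "cmod (al i * qform (H i * D) (x i) - a * ctrace (TC * (G * D))) \<le> \<dots>" .
  qed
  also have "\<dots> = \<zeta> * (c * (\<Sum>i<N. e2 i)) + (real p * \<kappa> / v\<^sup>2) * (c * (\<Sum>i<N. cmod (al i - a)))
       + cmod a * \<kappa> * (c * (\<Sum>i<N. X i)) / (v ^ 3) * c"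
    by (simp add: sum.distrib sum_distrib_left sum_distrib_right sum_divide_distrib algebra_simps)
  also have "\<dots> \<le> \<zeta> * (c * (\<Sum>i<N. e2 i)) + (real p * \<kappa> / v\<^sup>2) * (2 * (c * W) + cmod (Ab - a))
       + cmod a * \<kappa> * (c * (\<Sum>i<N. X i)) / (v ^ 3) * c"
    using \<kappa>0 v by (intro add_mono mult_left_mono al_a order.refl) auto
  also have "c * (\<Sum>i<N. e2 i) = \<eta>" by (simp add: e2_def \<eta>_def c_def)
  also have "c * (\<Sum>i<N. X i) = \<rho>" by (simp add: X_def \<rho>_def c_def)
  also have "c * W = \<zeta>\<^sup>2 * c * (c * (\<Sum>i<N. e1 i) + \<kappa> * c * (c * (\<Sum>i<N. X i)) / v\<^sup>2)"
    unfolding W_def by (simp add: sum.distrib sum_distrib_left sum_divide_distrib algebra_simps)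
  also have "c * (\<Sum>i<N. e1 i) = \<delta>" by (simp add: e1_def \<delta>_def c_def q_def)
  also have "c * (\<Sum>i<N. X i) = \<rho>" by (simp add: X_def \<rho>_def c_def)
  finally show ?thesis unfolding Ab by (simp add: \<zeta>_def v_def c_def field_simps)
qed

section \<open>Variance of quadratic forms\<close>

text \<open>Pythagoras for an orthogonal family with complex coefficients.\<close>
lemma orthogonal_sum_second_moment:
  fixes \<xi> :: "'s \<Rightarrow> 'a \<Rightarrow> real" and c :: "'s \<Rightarrow> complex"
  assumes S: "finite S" and int: "\<And>s t. s \<in> S \<Longrightarrow> t \<in> S \<Longrightarrow> integrable M (\<lambda>\<omega>. \<xi> s \<omega> * \<xi> t \<omega>)"
    and orth: "\<And>s t. s \<in> S \<Longrightarrow> t \<in> S \<Longrightarrow> s \<noteq> t \<Longrightarrow> (\<integral>\<omega>. \<xi> s \<omega> * \<xi> t \<omega> \<partial>M) = 0"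
    and bound: "\<And>s. s \<in> S \<Longrightarrow> (\<integral>\<omega>. \<xi> s \<omega> * \<xi> s \<omega> \<partial>M) \<le> C"
  shows "integrable M (\<lambda>\<omega>. (cmod (\<Sum>s\<in>S. c s * of_real (\<xi> s \<omega>)))\<^sup>2)"
    and "(\<integral>\<omega>. (cmod (\<Sum>s\<in>S. c s * of_real (\<xi> s \<omega>)))\<^sup>2 \<partial>M) \<le> C * (\<Sum>s\<in>S. (cmod (c s))\<^sup>2)"
proof -
  have eq: "(cmod (\<Sum>s\<in>S. c s * of_real (\<xi> s \<omega>)))\<^sup>2 = (\<Sum>s\<in>S. \<Sum>t\<in>S. Re (c s * cnj (c t)) * (\<xi> s \<omega> * \<xi> t \<omega>))" for \<omega>
  proof -
    have "complex_of_real ((cmod (\<Sum>s\<in>S. c s * of_real (\<xi> s \<omega>)))\<^sup>2) =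
        (\<Sum>s\<in>S. \<Sum>t\<in>S. (c s * cnj (c t)) * of_real (\<xi> s \<omega> * \<xi> t \<omega>))"
      unfolding complex_norm_square cnj_sum sum_product by (simp add: mult_ac)
    from arg_cong[OF this, of Re] show ?thesis by simp
  qed
  show "integrable M (\<lambda>\<omega>. (cmod (\<Sum>s\<in>S. c s * of_real (\<xi> s \<omega>)))\<^sup>2)"
    unfolding eq using int by (intro Bochner_Integration.integrable_sum integrable_mult_right) auto
  have "(\<integral>\<omega>. (cmod (\<Sum>s\<in>S. c s * of_real (\<xi> s \<omega>)))\<^sup>2 \<partial>M) = (\<Sum>s\<in>S. \<Sum>t\<in>S. Re (c s * cnj (c t)) * (\<integral>\<omega>. \<xi> s \<omega> * \<xi> t \<omega> \<partial>M))"
    unfolding eq using int by (subst Bochner_Integration.integral_sum; (intro Bochner_Integration.integrable_sum integrable_mult_right)?; auto)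
  also have "\<dots> = (\<Sum>s\<in>S. (cmod (c s))\<^sup>2 * (\<integral>\<omega>. \<xi> s \<omega> * \<xi> s \<omega> \<partial>M))"
  proof (intro sum.cong refl)
    fix s assume s: "s \<in> S"
    have "(\<Sum>t\<in>S - {s}. Re (c s * cnj (c t)) * (\<integral>\<omega>. \<xi> s \<omega> * \<xi> t \<omega> \<partial>M)) = 0"
    proof (intro sum.neutral ballI)
      fix t assume "t \<in> S - {s}"
      hence "t \<in> S" "s \<noteq> t" by auto
      thus "Re (c s * cnj (c t)) * (\<integral>\<omega>. \<xi> s \<omega> * \<xi> t \<omega> \<partial>M) = 0" using orth[OF s] by simp
    qed
    hence "(\<Sum>t\<in>S. Re (c s * cnj (c t)) * (\<integral>\<omega>. \<xi> s \<omega> * \<xi> t \<omega> \<partial>M)) = Re (c s * cnj (c s)) * (\<integral>\<omega>. \<xi> s \<omega> * \<xi> s \<omega> \<partial>M)"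
      by (subst sum.remove[OF S s]) simp
    also have "Re (c s * cnj (c s)) = (cmod (c s))\<^sup>2"
      using arg_cong[OF complex_norm_square[of "c s"], of Re] by simp
    finally show "(\<Sum>t\<in>S. Re (c s * cnj (c t)) * (\<integral>\<omega>. \<xi> s \<omega> * \<xi> t \<omega> \<partial>M)) = (cmod (c s))\<^sup>2 * (\<integral>\<omega>. \<xi> s \<omega> * \<xi> s \<omega> \<partial>M)" .
  qed
  also have "\<dots> \<le> (\<Sum>s\<in>S. (cmod (c s))\<^sup>2 * C)" by (intro sum_mono mult_left_mono bound) auto
  finally show "(\<integral>\<omega>. (cmod (\<Sum>s\<in>S. c s * of_real (\<xi> s \<omega>)))\<^sup>2 \<partial>M) \<le> C * (\<Sum>s\<in>S. (cmod (c s))\<^sup>2)"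
    by (simp add: sum_distrib_left mult.commute)
qed

lemma double_sum_pairs:
  fixes f :: "nat \<Rightarrow> nat \<Rightarrow> 'c::comm_monoid_add"
  shows "(\<Sum>i<n. \<Sum>j<n. f i j) = (\<Sum>s\<in>{(i, j). i < j \<and> j < n}. f (fst s) (snd s) + f (snd s) (fst s)) + (\<Sum>i<n. f i i)"
proof -
  define P where "P = {(i, j). i < j \<and> j < n}"
  define Q where "Q = {(i, j). j < i \<and> i < (n::nat)}"
  have P: "finite P" by (rule finite_subset[of _ "{..<n} \<times> {..<n}"]) (auto simp: P_def)
  have Q: "finite Q" by (rule finite_subset[of _ "{..<n} \<times> {..<n}"]) (auto simp: Q_def)
  have "(\<Sum>i<n. \<Sum>j<n. f i j) = (\<Sum>s\<in>{..<n} \<times> {..<n}. f (fst s) (snd s))"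
    by (simp add: sum.cartesian_product case_prod_unfold)
  also have "{..<n} \<times> {..<n} = (P \<union> Q) \<union> (\<lambda>j. (j, j)) ` {..<n}" by (auto simp: P_def Q_def)
  also have "(\<Sum>s\<in>\<dots>. f (fst s) (snd s)) = (\<Sum>s\<in>P. f (fst s) (snd s)) + (\<Sum>s\<in>Q. f (fst s) (snd s)) + (\<Sum>s\<in>(\<lambda>j. (j, j)) ` {..<n}. f (fst s) (snd s))"
    using P Q by (subst sum.union_disjoint; (subst sum.union_disjoint)?) (auto simp: P_def Q_def)
  also have "(\<Sum>s\<in>Q. f (fst s) (snd s)) = (\<Sum>s\<in>P. f (snd s) (fst s))"
    by (rule sum.reindex_bij_witness[of _ "\<lambda>(i, j). (j, i)" "\<lambda>(i, j). (j, i)"]) (auto simp: P_def Q_def)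
  also have "(\<Sum>s\<in>(\<lambda>j. (j, j)) ` {..<n}. f (fst s) (snd s)) = (\<Sum>j<n. f j j)"
    by (subst sum.reindex) (auto simp: inj_on_def)
  finally show ?thesis by (simp add: sum.distrib P_def)
qed

lemma power_le_one_plus_fourth:
  fixes x :: real assumes "e \<le> 4" shows "\<bar>x ^ e\<bar> \<le> 1 + x ^ 4"
proof (cases "\<bar>x\<bar> \<le> 1")
  case True
  hence "\<bar>x\<bar> ^ e \<le> 1" by (intro power_le_one) auto
  moreover have "x ^ 4 \<ge> 0" by simp
  ultimately show ?thesis unfolding power_abs by linarith
next
  case False
  hence "\<bar>x\<bar> ^ e \<le> \<bar>x\<bar> ^ 4" using assms by (intro power_increasing) auto
  also have "\<bar>x\<bar> ^ 4 = x ^ 4" by (simp add: power_even_abs)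
  finally show ?thesis by (simp add: power_abs)
qed

locale indep_coordinates = prob_space M for M :: "'a measure" +
  fixes p :: nat and u :: "nat \<Rightarrow> 'a \<Rightarrow> real" and s2 k4 :: real
  assumes indep: "indep_vars (\<lambda>_. borel) u {..<p}"
    and int4: "\<And>k. k < p \<Longrightarrow> integrable M (\<lambda>\<omega>. u k \<omega> ^ 4)"
    and mean0: "\<And>k. k < p \<Longrightarrow> expectation (u k) = 0"
    and var: "\<And>k. k < p \<Longrightarrow> expectation (\<lambda>\<omega>. (u k \<omega>)\<^sup>2) = s2"
    and m4: "\<And>k. k < p \<Longrightarrow> expectation (\<lambda>\<omega>. u k \<omega> ^ 4) \<le> k4"
begin

lemma rv: "k < p \<Longrightarrow> u k \<in> borel_measurable M"
  using indep by (auto simp: indep_vars_def)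

lemma int_power:
  assumes "k < p" "e \<le> 4" shows "integrable M (\<lambda>\<omega>. u k \<omega> ^ e)"
proof (rule Bochner_Integration.integrable_bound[of _ "\<lambda>\<omega>. 1 + u k \<omega> ^ 4"])
  show "integrable M (\<lambda>\<omega>. 1 + u k \<omega> ^ 4)" using int4[OF assms(1)] by auto
  show "(\<lambda>\<omega>. u k \<omega> ^ e) \<in> borel_measurable M" using rv[OF assms(1)] by simp
  show "AE \<omega> in M. norm (u k \<omega> ^ e) \<le> norm (1 + u k \<omega> ^ 4)"
  proof (rule AE_I2)
    fix \<omega> have "(u k \<omega>) ^ 4 \<ge> 0" by simp
    thus "norm (u k \<omega> ^ e) \<le> norm (1 + u k \<omega> ^ 4)"
      using power_le_one_plus_fourth[OF assms(2), of "u k \<omega>"] by simp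
  qed
qed

text \<open>The number of times that \<open>i\<close> occurs among four indices, so that a product of four
  coordinates is a product of powers of distinct, independent coordinates.\<close>
definition mult4 :: "nat \<Rightarrow> nat \<Rightarrow> nat \<Rightarrow> nat \<Rightarrow> nat \<Rightarrow> nat" where
  "mult4 j k l m i = (if i = j then 1 else 0) + (if i = k then 1 else 0) + (if i = l then 1 else 0) + (if i = m then 1 else 0)"

lemma four_product:
  assumes "j < p" "k < p" "l < p" "m < p"
  shows "integrable M (\<lambda>\<omega>. u j \<omega> * u k \<omega> * u l \<omega> * u m \<omega>)"
    and "expectation (\<lambda>\<omega>. u j \<omega> * u k \<omega> * u l \<omega> * u m \<omega>) = (\<Prod>i<p. expectation (\<lambda>\<omega>. u i \<omega> ^ mult4 j k l m i))"
proof -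
  have one: "(\<Prod>i<p. u i \<omega> ^ (if i = j then 1 else 0)) = u j \<omega>" if "j < p" for j \<omega>
    using that by (subst prod.remove[of _ j]) (auto intro!: prod.neutral)
  have eq: "u j \<omega> * u k \<omega> * u l \<omega> * u m \<omega> = (\<Prod>i<p. u i \<omega> ^ mult4 j k l m i)" for \<omega>
    by (simp only: mult4_def power_add prod.distrib one assms)
  have m: "mult4 j k l m i \<le> 4" for i by (simp add: mult4_def)
  have ind: "indep_vars (\<lambda>_. borel) (\<lambda>i \<omega>. u i \<omega> ^ mult4 j k l m i) {..<p}"
    by (rule indep_vars_compose2[OF indep]) auto
  show "integrable M (\<lambda>\<omega>. u j \<omega> * u k \<omega> * u l \<omega> * u m \<omega>)"
    unfolding eq by (rule indep_vars_integrable[OF _ ind]) (auto intro!: int_power m)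
  show "expectation (\<lambda>\<omega>. u j \<omega> * u k \<omega> * u l \<omega> * u m \<omega>) = (\<Prod>i<p. expectation (\<lambda>\<omega>. u i \<omega> ^ mult4 j k l m i))"
    unfolding eq by (rule indep_vars_lebesgue_integral[OF _ ind]) (auto intro!: int_power m)
qed

text \<open>If two unordered pairs differ, some index occurs exactly once among the four, and its
  coordinate has mean zero.\<close>
lemma four_product_zero:
  assumes "j < p" "k < p" "l < p" "m < p" "j < k" "l < m" "(j, k) \<noteq> (l, m)"
  shows "expectation (\<lambda>\<omega>. u j \<omega> * u k \<omega> * u l \<omega> * u m \<omega>) = 0"
proof -
  have "mult4 j k l m j = 1 \<or> mult4 j k l m k = 1" using assms(5-7) by (auto simp: mult4_def)
  then obtain i where i: "i < p" "mult4 j k l m i = 1" using assms(1,2) by blast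
  hence "expectation (\<lambda>\<omega>. u i \<omega> ^ mult4 j k l m i) = 0" using mean0[OF i(1)] by simp
  thus ?thesis unfolding four_product(2)[OF assms(1-4)] using i(1) by (intro prod_zero) auto
qed

lemma four_product_pair:
  assumes "j < p" "l < p" "j \<noteq> l"
  shows "expectation (\<lambda>\<omega>. u j \<omega> * u j \<omega> * u l \<omega> * u l \<omega>) = s2\<^sup>2"
proof -
  have "(\<Prod>i<p. expectation (\<lambda>\<omega>. u i \<omega> ^ mult4 j j l l i)) = (\<Prod>i<p. (if i = j then s2 else 1) * (if i = l then s2 else 1))"
    using assms var by (intro prod.cong) (auto simp: mult4_def prob_space numeral_2_eq_2[symmetric])
  also have "\<dots> = s2\<^sup>2" using assms by (simp add: prod.distrib power2_eq_square)
  finally show ?thesis using four_product(2)[OF assms(1,1,2,2)] by simp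
qed

text \<open>The centred form is a combination of the products \<open>u\<^sub>j u\<^sub>k\<close> with \<open>j < k\<close>, which are pairwise
  uncorrelated, and of the centred squares, which are uncorrelated as well. Its second moment is
  therefore controlled by the Frobenius norm and the fourth moment of the coordinates.\<close>
lemma quadratic_form_variance:
  fixes a :: "nat \<Rightarrow> nat \<Rightarrow> complex"
  shows "integrable M (\<lambda>\<omega>. (cmod ((\<Sum>j<p. \<Sum>k<p. a j k * of_real (u j \<omega> * u k \<omega>)) - of_real s2 * (\<Sum>j<p. a j j)))\<^sup>2)" (is ?int)
    and "expectation (\<lambda>\<omega>. (cmod ((\<Sum>j<p. \<Sum>k<p. a j k * of_real (u j \<omega> * u k \<omega>)) - of_real s2 * (\<Sum>j<p. a j j)))\<^sup>2)
      \<le> (2 * k4 + 4 * s2\<^sup>2) * (\<Sum>j<p. \<Sum>k<p. (cmod (a j k))\<^sup>2)" (is ?le)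
proof -
  define P where "P = {(j, k). j < k \<and> k < p}"
  have P: "finite P" by (rule finite_subset[of _ "{..<p} \<times> {..<p}"]) (auto simp: P_def)
  define \<xi> where "\<xi> s \<omega> = u (fst s) \<omega> * u (snd s) \<omega>" for s :: "nat \<times> nat" and \<omega>
  define b where "b s = a (fst s) (snd s) + a (snd s) (fst s)" for s :: "nat \<times> nat"
  define \<eta> where "\<eta> j \<omega> = (u j \<omega>)\<^sup>2 - s2" for j \<omega>
  define X where "X \<omega> = (\<Sum>s\<in>P. b s * of_real (\<xi> s \<omega>))" for \<omega>
  define Y where "Y \<omega> = (\<Sum>j<p. a j j * of_real (\<eta> j \<omega>))" for \<omega>
  note split = double_sum_pairs[where n = p, folded P_def]
  have XY: "(\<Sum>j<p. \<Sum>k<p. a j k * of_real (u j \<omega> * u k \<omega>)) - of_real s2 * (\<Sum>j<p. a j j) = X \<omega> + Y \<omega>" for \<omega>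
  proof -
    have "(\<Sum>j<p. \<Sum>k<p. a j k * of_real (u j \<omega> * u k \<omega>)) = X \<omega> + (\<Sum>j<p. a j j * of_real (u j \<omega> * u j \<omega>))"
      unfolding split[of "\<lambda>j k. a j k * of_real (u j \<omega> * u k \<omega>)"] X_def b_def \<xi>_def by (simp add: algebra_simps)
    moreover have "(\<Sum>j<p. a j j * of_real (u j \<omega> * u j \<omega>)) - of_real s2 * (\<Sum>j<p. a j j) = Y \<omega>"
      unfolding Y_def \<eta>_def by (simp add: sum_distrib_left algebra_simps sum_subtractf power2_eq_square)
    ultimately show ?thesis by (simp add: algebra_simps)
  qed
  have X: "integrable M (\<lambda>\<omega>. (cmod (X \<omega>))\<^sup>2)" "expectation (\<lambda>\<omega>. (cmod (X \<omega>))\<^sup>2) \<le> s2\<^sup>2 * (\<Sum>s\<in>P. (cmod (b s))\<^sup>2)"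
  proof -
    have "integrable M (\<lambda>\<omega>. \<xi> s \<omega> * \<xi> t \<omega>)" if "s \<in> P" "t \<in> P" for s t
      using four_product(1)[of "fst s" "snd s" "fst t" "snd t"] that by (auto simp: \<xi>_def P_def mult.assoc)
    moreover have "expectation (\<lambda>\<omega>. \<xi> s \<omega> * \<xi> t \<omega>) = 0" if "s \<in> P" "t \<in> P" "s \<noteq> t" for s t
      using four_product_zero[of "fst s" "snd s" "fst t" "snd t"] that by (auto simp: \<xi>_def P_def mult.assoc)
    moreover have "expectation (\<lambda>\<omega>. \<xi> s \<omega> * \<xi> s \<omega>) \<le> s2\<^sup>2" if "s \<in> P" for s
      using four_product_pair[of "fst s" "snd s"] that by (auto simp: \<xi>_def P_def mult_ac)
    ultimately show "integrable M (\<lambda>\<omega>. (cmod (X \<omega>))\<^sup>2)" "expectation (\<lambda>\<omega>. (cmod (X \<omega>))\<^sup>2) \<le> s2\<^sup>2 * (\<Sum>s\<in>P. (cmod (b s))\<^sup>2)"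
      unfolding X_def by (intro orthogonal_sum_second_moment[OF P]; blast)+
  qed
  have Y: "integrable M (\<lambda>\<omega>. (cmod (Y \<omega>))\<^sup>2)" "expectation (\<lambda>\<omega>. (cmod (Y \<omega>))\<^sup>2) \<le> k4 * (\<Sum>j<p. (cmod (a j j))\<^sup>2)"
  proof -
    have exp: "\<eta> s \<omega> * \<eta> t \<omega> = u s \<omega> * u s \<omega> * u t \<omega> * u t \<omega> - s2 * (u s \<omega>)\<^sup>2 - s2 * (u t \<omega>)\<^sup>2 + s2\<^sup>2" for s t \<omega>
      by (simp add: \<eta>_def power2_eq_square algebra_simps)
    have i: "integrable M (\<lambda>\<omega>. \<eta> s \<omega> * \<eta> t \<omega>)" if "s \<in> {..<p}" "t \<in> {..<p}" for s t
      unfolding exp using four_product(1)[of s s t t] int_power[of s 2] int_power[of t 2] that by auto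
    have e: "expectation (\<lambda>\<omega>. \<eta> s \<omega> * \<eta> t \<omega>) = expectation (\<lambda>\<omega>. u s \<omega> * u s \<omega> * u t \<omega> * u t \<omega>) - s2\<^sup>2" if "s \<in> {..<p}" "t \<in> {..<p}" for s t
      unfolding exp using four_product(1)[of s s t t] int_power[of s 2] int_power[of t 2] that var 
      by (simp add: prob_space power2_eq_square)
    have o: "expectation (\<lambda>\<omega>. \<eta> s \<omega> * \<eta> t \<omega>) = 0" if "s \<in> {..<p}" "t \<in> {..<p}" "s \<noteq> t" for s t
      using that four_product_pair[of s t] by (subst e) auto
    have b: "expectation (\<lambda>\<omega>. \<eta> s \<omega> * \<eta> s \<omega>) \<le> k4" if "s \<in> {..<p}" for s
    proof -
      have "expectation (\<lambda>\<omega>. u s \<omega> * u s \<omega> * u s \<omega> * u s \<omega>) = expectation (\<lambda>\<omega>. u s \<omega> ^ 4)"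
        by (simp add: power4_eq_xxxx)
      moreover have "s2\<^sup>2 \<ge> 0" by simp
      ultimately show ?thesis using m4[of s] that e[OF that that] unfolding lessThan_iff by linarith
    qed
    show "integrable M (\<lambda>\<omega>. (cmod (Y \<omega>))\<^sup>2)" "expectation (\<lambda>\<omega>. (cmod (Y \<omega>))\<^sup>2) \<le> k4 * (\<Sum>j<p. (cmod (a j j))\<^sup>2)"
      unfolding Y_def by (intro orthogonal_sum_second_moment[OF finite_lessThan i o b]; assumption)+
  qed
  have sq: "(cmod (x + y))\<^sup>2 \<le> 2 * (cmod x)\<^sup>2 + 2 * (cmod y)\<^sup>2" for x y
  proof -
    have "(cmod (x + y))\<^sup>2 \<le> (cmod x + cmod y)\<^sup>2" by (intro power_mono norm_triangle_ineq) auto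
    also have "\<dots> \<le> 2 * (cmod x)\<^sup>2 + 2 * (cmod y)\<^sup>2"
      using zero_le_power2[of "cmod x - cmod y"] by (simp add: power2_eq_square algebra_simps)
    finally show ?thesis .
  qed
  have uM[measurable]: "u k \<in> borel_measurable M" if "k \<in> {..<p}" for k using rv that by simp
  have meas: "(\<lambda>\<omega>. cmod ((\<Sum>j<p. \<Sum>k<p. a j k * of_real (u j \<omega> * u k \<omega>)) - of_real s2 * (\<Sum>j<p. a j j))) \<in> borel_measurable M"
    by measurable
  show int: ?int
    unfolding XY
  proof (rule Bochner_Integration.integrable_bound)
    show "integrable M (\<lambda>\<omega>. 2 * (cmod (X \<omega>))\<^sup>2 + 2 * (cmod (Y \<omega>))\<^sup>2)" using X Y by auto
    show "(\<lambda>\<omega>. (cmod (X \<omega> + Y \<omega>))\<^sup>2) \<in> borel_measurable M" using meas unfolding XY by simp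
  qed (use sq in auto)
  have "expectation (\<lambda>\<omega>. (cmod (X \<omega> + Y \<omega>))\<^sup>2) \<le> expectation (\<lambda>\<omega>. 2 * (cmod (X \<omega>))\<^sup>2 + 2 * (cmod (Y \<omega>))\<^sup>2)"
    using X Y int unfolding XY by (intro integral_mono sq) auto
  also have "\<dots> \<le> 2 * (s2\<^sup>2 * (\<Sum>s\<in>P. (cmod (b s))\<^sup>2)) + 2 * (k4 * (\<Sum>j<p. (cmod (a j j))\<^sup>2))"
    using X Y by simp
  also have "(\<Sum>s\<in>P. (cmod (b s))\<^sup>2) \<le> (\<Sum>s\<in>P. 2 * (cmod (a (fst s) (snd s)))\<^sup>2 + 2 * (cmod (a (snd s) (fst s)))\<^sup>2)"
    unfolding b_def by (intro sum_mono sq)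
  also have "\<dots> = 2 * ((\<Sum>j<p. \<Sum>k<p. (cmod (a j k))\<^sup>2) - (\<Sum>j<p. (cmod (a j j))\<^sup>2))"
    unfolding split[of "\<lambda>j k. (cmod (a j k))\<^sup>2"] by (simp add: sum_distrib_left sum.distrib)
  also have "2 * (s2\<^sup>2 * (2 * ((\<Sum>j<p. \<Sum>k<p. (cmod (a j k))\<^sup>2) - (\<Sum>j<p. (cmod (a j j))\<^sup>2)))) + 2 * (k4 * (\<Sum>j<p. (cmod (a j j))\<^sup>2))
     \<le> (2 * k4 + 4 * s2\<^sup>2) * (\<Sum>j<p. \<Sum>k<p. (cmod (a j k))\<^sup>2)"
  proof -
    define A where "A = (\<Sum>j<p. \<Sum>k<p. (cmod (a j k))\<^sup>2)"
    define B where "B = (\<Sum>j<p. (cmod (a j j))\<^sup>2)"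
    have B0: "B \<ge> 0" by (auto simp: B_def intro: sum_nonneg)
    have BA: "B \<le> A" unfolding A_def B_def by (intro sum_mono member_le_sum[of _ _ "\<lambda>k. (cmod (a _ k))\<^sup>2"]) auto
    have "k4 * B \<le> k4 * A"
    proof (cases "p = 0")
      case False
      have "0 \<le> expectation (\<lambda>\<omega>. u 0 \<omega> ^ 4)" by (intro integral_nonneg_AE) auto
      also have "\<dots> \<le> k4" using m4[of 0] False by simp
      finally have "k4 \<ge> 0" .
      thus ?thesis by (rule mult_left_mono[OF BA])
    qed (simp add: A_def B_def)
    moreover have "s2\<^sup>2 * B \<ge> 0" using B0 by simp
    ultimately show ?thesis unfolding A_def[symmetric] B_def[symmetric] by (simp add: algebra_simps)
  qed
  finally show ?le unfolding XY by (auto simp: mult_left_mono)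
qed

end

section \<open>Concentration for functions with bounded differences\<close>

text \<open>Replacing a coordinate by an independent copy preserves the distribution.\<close>
lemma nn_integral_PiM_resample:
  fixes P :: "'b measure" and I :: "'i set" and h :: "('i \<Rightarrow> 'b) \<Rightarrow> ennreal"
  assumes P: "prob_space P" and I: "finite I" "i \<in> I" and h: "h \<in> borel_measurable (PiM I (\<lambda>_. P))"
  shows "(\<integral>\<^sup>+ z. h z \<partial>PiM I (\<lambda>_. P)) = (\<integral>\<^sup>+ z. (\<integral>\<^sup>+ y. h (z(i := y)) \<partial>P) \<partial>PiM I (\<lambda>_. P))"
proof -
  interpret P: prob_space P by (rule P)
  interpret F: product_sigma_finite "\<lambda>_. P" by standard
  obtain J where J: "I = insert i J" "i \<notin> J" "finite J" using I by (metis finite_insert mk_disjoint_insert)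
  have h'[measurable]: "h \<in> borel_measurable (PiM (insert i J) (\<lambda>_. P))" using h J by simp
  have m2: "(\<lambda>(z, y). z(i := y)) \<in> measurable (PiM (insert i J) (\<lambda>_. P) \<Otimes>\<^sub>M P) (PiM (insert i J) (\<lambda>_. P))"
    using measurable_add_dim[of i "insert i J" "\<lambda>_. P"] by simp
  have m3: "(\<lambda>z. \<integral>\<^sup>+ y. h (z(i := y)) \<partial>P) \<in> borel_measurable (PiM (insert i J) (\<lambda>_. P))"
    using measurable_compose[OF m2 h'] by (intro P.borel_measurable_nn_integral) (simp add: case_prod_unfold)
  have "(\<integral>\<^sup>+ z. (\<integral>\<^sup>+ y. h (z(i := y)) \<partial>P) \<partial>PiM (insert i J) (\<lambda>_. P)) =
     (\<integral>\<^sup>+ z. (\<integral>\<^sup>+ y'. (\<integral>\<^sup>+ y. h ((z(i := y'))(i := y)) \<partial>P) \<partial>P) \<partial>PiM J (\<lambda>_. P))"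
    using F.product_nn_integral_insert[OF J(3,2) m3] .
  also have "\<dots> = (\<integral>\<^sup>+ z. (\<integral>\<^sup>+ y. h (z(i := y)) \<partial>P) \<partial>PiM J (\<lambda>_. P))"
    by (simp add: P.emeasure_space_1)
  also have "\<dots> = (\<integral>\<^sup>+ z. h z \<partial>PiM (insert i J) (\<lambda>_. P))"
    using F.product_nn_integral_insert[OF J(3,2) h'] by simp
  finally show ?thesis unfolding J(1) by simp
qed

text \<open>Induction over the coordinates. Integrating one coordinate out leaves a function \<open>g\<close> of the
  others with the same mean and the same difference bounds, and conditionally on these the
  deviation \<open>f - g\<close> is centred and lies in an interval of length \<open>2 c\<close>, so that Hoeffding's lemma
  contributes the factor \<open>exp (l\<^sup>2 (2 c)\<^sup>2 / 8)\<close>.\<close>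
lemma bounded_differences_mgf:
  fixes P :: "'b measure" and I :: "'i set" and f :: "('i \<Rightarrow> 'b) \<Rightarrow> real"
  assumes P: "prob_space P" and I: "finite I" and l: "l > 0" and c: "c \<ge> 0"
    and f: "f \<in> borel_measurable (PiM I (\<lambda>_. P))"
    and bdd: "\<And>z. z \<in> space (PiM I (\<lambda>_. P)) \<Longrightarrow> \<bar>f z\<bar> \<le> B"
    and diff: "\<And>i z y. i \<in> I \<Longrightarrow> z \<in> space (PiM I (\<lambda>_. P)) \<Longrightarrow> y \<in> space P \<Longrightarrow> \<bar>f (z(i := y)) - f z\<bar> \<le> c"
  shows "(\<integral>\<^sup>+ z. ennreal (exp (l * (f z - (\<integral>z. f z \<partial>PiM I (\<lambda>_. P))))) \<partial>PiM I (\<lambda>_. P)) \<le> ennreal (exp (l\<^sup>2 * c\<^sup>2 * real (card I) / 2))"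
  using I f bdd diff
proof (induction I arbitrary: f)
  case empty
  interpret P: prob_space P by (rule P)
  interpret F: product_sigma_finite "\<lambda>_. P" by standard
  show ?case
    by (simp add: PiM_empty nn_integral_count_space_finite lebesgue_integral_count_space_finite)
next
  case (insert i J)
  interpret P: prob_space P by (rule P)
  interpret F: product_sigma_finite "\<lambda>_. P" by standard
  interpret PJ: prob_space "PiM J (\<lambda>_. P)" by (intro prob_space_PiM P)
  interpret PI: prob_space "PiM (insert i J) (\<lambda>_. P)" by (intro prob_space_PiM P)
  note [measurable] = insert.prems(1)
  note bdd = insert.prems(2) and diff = insert.prems(3)
  let ?J = "PiM J (\<lambda>_. P)" and ?I = "PiM (insert i J) (\<lambda>_. P)"
  have upd: "z(i := y) \<in> space ?I" if "z \<in> space ?J" "y \<in> space P" for z y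
    using that by (auto simp: space_PiM PiE_iff extensional_def)
  have m2[measurable]: "(\<lambda>(z, y). f (z(i := y))) \<in> borel_measurable (?J \<Otimes>\<^sub>M P)"
    using measurable_compose[OF measurable_add_dim[of i J "\<lambda>_. P"] insert.prems(1)] by (simp add: case_prod_unfold)
  have fy: "(\<lambda>y. f (z(i := y))) \<in> borel_measurable P" if "z \<in> space ?J" for z
    using measurable_compose[OF measurable_Pair1'[OF that] m2] by simp
  define g where "g z = (\<integral>y. f (z(i := y)) \<partial>P)" for z
  have g[measurable]: "g \<in> borel_measurable ?J"
    unfolding g_def using m2 by (intro P.borel_measurable_lebesgue_integral) simp
  have int_f: "integrable ?I f"
    by (rule PI.integrable_const_bound[of _ B]) (auto intro!: AE_I2 bdd)
  have int_fy: "integrable P (\<lambda>y. f (z(i := y)))" if "z \<in> space ?J" for z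
    by (rule P.integrable_const_bound[of _ B]) (use that in \<open>auto intro!: AE_I2 bdd upd\<close>)
  have Eg: "(\<integral>z. g z \<partial>?J) = (\<integral>z. f z \<partial>?I)"
    unfolding g_def using F.product_integral_insert[OF insert.hyps(1,2) int_f] by simp
  have g_bdd: "\<bar>g z\<bar> \<le> B" if z: "z \<in> space ?J" for z
  proof -
    have "\<bar>g z\<bar> \<le> (\<integral>y. \<bar>f (z(i := y))\<bar> \<partial>P)" unfolding g_def by (rule integral_abs_bound)
    also have "\<dots> \<le> (\<integral>y. B \<partial>P)" using int_fy[OF z] by (intro integral_mono) (auto intro!: bdd upd z)
    finally show ?thesis by (simp add: P.prob_space)
  qed
  have g_diff: "\<bar>g (z(j := w)) - g z\<bar> \<le> c" if j: "j \<in> J" and z: "z \<in> space ?J" and w: "w \<in> space P" for j z w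
  proof -
    have zw: "z(j := w) \<in> space ?J" using z j w by (auto simp: space_PiM PiE_iff extensional_def)
    have ij: "i \<noteq> j" using j insert.hyps by auto
    have "\<bar>g (z(j := w)) - g z\<bar> = \<bar>\<integral>y. f ((z(j := w))(i := y)) - f (z(i := y)) \<partial>P\<bar>"
      unfolding g_def using int_fy[OF z] int_fy[OF zw] by simp
    also have "\<dots> \<le> (\<integral>y. \<bar>f ((z(j := w))(i := y)) - f (z(i := y))\<bar> \<partial>P)" by (rule integral_abs_bound)
    also have "\<dots> \<le> (\<integral>y. c \<partial>P)"
    proof (intro integral_mono)
      fix y assume y: "y \<in> space P"
      show "\<bar>f ((z(j := w))(i := y)) - f (z(i := y))\<bar> \<le> c"
        unfolding fun_upd_twist[OF ij[symmetric]] using j by (intro diff upd z y w) auto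
    qed (use int_fy[OF z] int_fy[OF zw] in auto)
    finally show ?thesis by (simp add: P.prob_space)
  qed
  have hoeff: "(\<integral>\<^sup>+ y. ennreal (exp (l * (f (z(i := y)) - g z))) \<partial>P) \<le> ennreal (exp (l\<^sup>2 * c\<^sup>2 / 2))" if z: "z \<in> space ?J" for z
  proof -
    obtain y0 where y0: "y0 \<in> space P" using P.not_empty by auto
    interpret X: interval_bounded_random_variable P "\<lambda>y. f (z(i := y)) - g z" "f (z(i := y0)) - g z - c" "f (z(i := y0)) - g z + c"
    proof
      show "(\<lambda>y. f (z(i := y)) - g z) \<in> borel_measurable P" using fy[OF z] by simp
      show "AE y in P. f (z(i := y)) - g z \<in> {f (z(i := y0)) - g z - c..f (z(i := y0)) - g z + c}"
      proof (rule AE_I2)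
        fix y assume y: "y \<in> space P"
        have "\<bar>f ((z(i := y0))(i := y)) - f (z(i := y0))\<bar> \<le> c" by (intro diff upd z y0 y) auto
        thus "f (z(i := y)) - g z \<in> {f (z(i := y0)) - g z - c..f (z(i := y0)) - g z + c}" by auto
      qed
    qed
    have "P.expectation (\<lambda>y. f (z(i := y)) - g z) = 0"
      using int_fy[OF z] by (simp add: P.prob_space g_def)
    from X.Hoeffdings_lemma_nn_integral_0[OF l this]
    have "(\<integral>\<^sup>+ y. ennreal (exp (l * (f (z(i := y)) - g z))) \<partial>P) \<le> ennreal (exp (l\<^sup>2 * (f (z(i := y0)) - g z + c - (f (z(i := y0)) - g z - c))\<^sup>2 / 8))" .
    also have "l\<^sup>2 * (f (z(i := y0)) - g z + c - (f (z(i := y0)) - g z - c))\<^sup>2 / 8 = l\<^sup>2 * c\<^sup>2 / 2"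
      by (simp add: power2_eq_square)
    finally show ?thesis .
  qed
  let ?E = "\<integral>z. f z \<partial>?I"
  have "(\<integral>\<^sup>+ z. ennreal (exp (l * (f z - ?E))) \<partial>?I) = (\<integral>\<^sup>+ z. (\<integral>\<^sup>+ y. ennreal (exp (l * (f (z(i := y)) - ?E))) \<partial>P) \<partial>?J)"
    by (intro F.product_nn_integral_insert insert.hyps) measurable
  also have "\<dots> \<le> (\<integral>\<^sup>+ z. ennreal (exp (l * (g z - ?E))) * ennreal (exp (l\<^sup>2 * c\<^sup>2 / 2)) \<partial>?J)"
  proof (intro nn_integral_mono)
    fix z assume z: "z \<in> space ?J"
    have "(\<integral>\<^sup>+ y. ennreal (exp (l * (f (z(i := y)) - ?E))) \<partial>P) = (\<integral>\<^sup>+ y. ennreal (exp (l * (g z - ?E))) * ennreal (exp (l * (f (z(i := y)) - g z))) \<partial>P)"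
      by (intro nn_integral_cong) (simp add: ennreal_mult[symmetric] exp_add[symmetric] algebra_simps)
    also have "\<dots> = ennreal (exp (l * (g z - ?E))) * (\<integral>\<^sup>+ y. ennreal (exp (l * (f (z(i := y)) - g z))) \<partial>P)"
    proof (rule nn_integral_cmult)
      have "(\<lambda>y. ennreal (exp (l * (f (z(i := y)) - r)))) \<in> borel_measurable P" for r using fy[OF z] by measurable
      thus "(\<lambda>y. ennreal (exp (l * (f (z(i := y)) - g z)))) \<in> borel_measurable P" .
    qed
    also have "\<dots> \<le> ennreal (exp (l * (g z - ?E))) * ennreal (exp (l\<^sup>2 * c\<^sup>2 / 2))"
      by (intro mult_left_mono hoeff z) auto
    finally show "(\<integral>\<^sup>+ y. ennreal (exp (l * (f (z(i := y)) - ?E))) \<partial>P) \<le> \<dots>" .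
  qed
  also have "\<dots> = (\<integral>\<^sup>+ z. ennreal (exp (l * (g z - (\<integral>z. g z \<partial>?J)))) \<partial>?J) * ennreal (exp (l\<^sup>2 * c\<^sup>2 / 2))"
    unfolding Eg by (intro nn_integral_multc) measurable
  also have "\<dots> \<le> ennreal (exp (l\<^sup>2 * c\<^sup>2 * real (card J) / 2)) * ennreal (exp (l\<^sup>2 * c\<^sup>2 / 2))"
    by (intro mult_right_mono insert.IH g g_bdd g_diff) auto
  also have "\<dots> = ennreal (exp (l\<^sup>2 * c\<^sup>2 * real (card (insert i J)) / 2))"
    using insert.hyps by (simp add: ennreal_mult[symmetric] exp_add[symmetric] field_simps)
  finally show ?case .
qed

text \<open>Chernoff's bound for both signs, with the exponent that minimises the resulting estimate.\<close>
lemma bounded_differences_tail: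
  fixes P :: "'b measure" and I :: "'i set" and f :: "('i \<Rightarrow> 'b) \<Rightarrow> real"
  assumes P: "prob_space P" and I: "finite I" "I \<noteq> {}" and c: "c > 0" and \<epsilon>: "\<epsilon> > 0"
    and f: "f \<in> borel_measurable (PiM I (\<lambda>_. P))"
    and bdd: "\<And>z. z \<in> space (PiM I (\<lambda>_. P)) \<Longrightarrow> \<bar>f z\<bar> \<le> B"
    and diff: "\<And>i z y. i \<in> I \<Longrightarrow> z \<in> space (PiM I (\<lambda>_. P)) \<Longrightarrow> y \<in> space P \<Longrightarrow> \<bar>f (z(i := y)) - f z\<bar> \<le> c"
  shows "measure (PiM I (\<lambda>_. P)) {z \<in> space (PiM I (\<lambda>_. P)). \<bar>f z - (\<integral>z. f z \<partial>PiM I (\<lambda>_. P))\<bar> \<ge> \<epsilon>} \<le> 2 * exp (- \<epsilon>\<^sup>2 / (2 * c\<^sup>2 * real (card I)))"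
proof -
  let ?I = "PiM I (\<lambda>_. P)"
  interpret PI: prob_space ?I by (intro prob_space_PiM P)
  have n: "real (card I) > 0" using I by (simp add: card_gt_0_iff)
  have one_sided: "measure ?I {z \<in> space ?I. h z - (\<integral>z. h z \<partial>?I) \<ge> \<epsilon>} \<le> exp (- \<epsilon>\<^sup>2 / (2 * c\<^sup>2 * real (card I)))"
    if h[measurable]: "h \<in> borel_measurable ?I" and hb: "\<And>z. z \<in> space ?I \<Longrightarrow> \<bar>h z\<bar> \<le> B"
      and hd: "\<And>i z y. i \<in> I \<Longrightarrow> z \<in> space ?I \<Longrightarrow> y \<in> space P \<Longrightarrow> \<bar>h (z(i := y)) - h z\<bar> \<le> c" for h
  proof -
    define l where "l = \<epsilon> / (c\<^sup>2 * real (card I))"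
    have l: "l > 0" using c \<epsilon> n by (simp add: l_def)
    have "ennreal (measure ?I {z \<in> space ?I. h z - (\<integral>z. h z \<partial>?I) \<ge> \<epsilon>}) = emeasure ?I {z \<in> space ?I. h z - (\<integral>z. h z \<partial>?I) \<ge> \<epsilon>}"
      by (simp add: PI.emeasure_eq_measure)
    also have "\<dots> \<le> ennreal (exp (- l * \<epsilon>)) * (\<integral>\<^sup>+ z \<in> space ?I. exp (l * (h z - (\<integral>z. h z \<partial>?I))) \<partial>?I)"
      using l by (intro Chernoff_ineq_nn_integral_ge) auto
    also have "(\<integral>\<^sup>+ z \<in> space ?I. exp (l * (h z - (\<integral>z. h z \<partial>?I))) \<partial>?I) = (\<integral>\<^sup>+ z. exp (l * (h z - (\<integral>z. h z \<partial>?I))) \<partial>?I)"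
      by (intro nn_integral_cong) auto
    also have "\<dots> \<le> ennreal (exp (l\<^sup>2 * c\<^sup>2 * real (card I) / 2))"
      using c by (intro bounded_differences_mgf[OF P I(1) l _ h hb hd]) auto
    finally have "ennreal (measure ?I {z \<in> space ?I. h z - (\<integral>z. h z \<partial>?I) \<ge> \<epsilon>}) \<le> ennreal (exp (- l * \<epsilon>)) * ennreal (exp (l\<^sup>2 * c\<^sup>2 * real (card I) / 2))"
      by (simp add: mult_left_mono)
    also have "\<dots> = ennreal (exp (- l * \<epsilon> + l\<^sup>2 * c\<^sup>2 * real (card I) / 2))"
      by (simp add: ennreal_mult[symmetric] exp_add[symmetric])
    also have "- l * \<epsilon> + l\<^sup>2 * c\<^sup>2 * real (card I) / 2 = - \<epsilon>\<^sup>2 / (2 * c\<^sup>2 * real (card I))"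
      using c n by (simp add: l_def power2_eq_square field_simps)
    finally show ?thesis by simp
  qed
  note [measurable] = f
  let ?E = "\<integral>z. f z \<partial>?I"
  have "{z \<in> space ?I. \<bar>f z - ?E\<bar> \<ge> \<epsilon>} \<subseteq> {z \<in> space ?I. f z - ?E \<ge> \<epsilon>} \<union> {z \<in> space ?I. - f z - (\<integral>z. - f z \<partial>?I) \<ge> \<epsilon>}"
    by auto
  hence "measure ?I {z \<in> space ?I. \<bar>f z - ?E\<bar> \<ge> \<epsilon>} \<le> measure ?I ({z \<in> space ?I. f z - ?E \<ge> \<epsilon>} \<union> {z \<in> space ?I. - f z - (\<integral>z. - f z \<partial>?I) \<ge> \<epsilon>})"
    by (intro PI.finite_measure_mono) auto
  also have "\<dots> \<le> measure ?I {z \<in> space ?I. f z - ?E \<ge> \<epsilon>} + measure ?I {z \<in> space ?I. - f z - (\<integral>z. - f z \<partial>?I) \<ge> \<epsilon>}"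
    by (intro measure_Un_le) auto
  also have "\<dots> \<le> exp (- \<epsilon>\<^sup>2 / (2 * c\<^sup>2 * real (card I))) + exp (- \<epsilon>\<^sup>2 / (2 * c\<^sup>2 * real (card I)))"
  proof (intro add_mono one_sided)
    show "\<And>i z y. i \<in> I \<Longrightarrow> z \<in> space ?I \<Longrightarrow> y \<in> space P \<Longrightarrow> \<bar>- f (z(i := y)) - - f z\<bar> \<le> c"
      using diff by (simp add: abs_minus_commute)
  qed (use bdd diff in auto)
  finally show ?thesis by simp
qed

section \<open>Measurability of matrix expressions\<close>

text \<open>A polynomial in the entries.\<close>
lemma borel_measurable_det:
  fixes A :: "'a \<Rightarrow> complex mat"
  assumes c: "\<And>\<omega>. A \<omega> \<in> carrier_mat n n"
    and m: "\<And>i j. i < n \<Longrightarrow> j < n \<Longrightarrow> (\<lambda>\<omega>. A \<omega> $$ (i, j)) \<in> borel_measurable M"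
  shows "(\<lambda>\<omega>. det (A \<omega>)) \<in> borel_measurable M"
proof -
  have "det (A \<omega>) = (\<Sum>q\<in>{q. q permutes {0..<n}}. signof q * (\<Prod>i = 0..<n. A \<omega> $$ (i, q i)))" for \<omega>
    using c[of \<omega>] by (simp add: det_def)
  moreover have "(\<lambda>\<omega>. A \<omega> $$ (i, q i)) \<in> borel_measurable M" if "q permutes {0..<n}" "i \<in> {0..<n}" for q i
    using permutes_in_image[OF that(1), of i] that by (intro m) auto
  ultimately show ?thesis by simp
qed

lemma borel_measurable_resolvent:
  fixes A :: "'a \<Rightarrow> real mat"
  assumes c: "\<And>\<omega>. A \<omega> \<in> carrier_mat n n"
    and m: "\<And>i j. i < n \<Longrightarrow> j < n \<Longrightarrow> (\<lambda>\<omega>. A \<omega> $$ (i, j)) \<in> borel_measurable M"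
    and ij: "i < n" "j < n"
  shows "(\<lambda>\<omega>. resolvent a (A \<omega>) z $$ (i, j)) \<in> borel_measurable M"
proof -
  let ?S = "\<lambda>\<omega>. shifted a (A \<omega>) z"
  have Sc: "?S \<omega> \<in> carrier_mat n n" for \<omega> using c by simp
  have Sm: "(\<lambda>\<omega>. ?S \<omega> $$ (k, l)) \<in> borel_measurable M" if "k < n" "l < n" for k l
  proof -
    have "?S \<omega> $$ (k, l) = a * complex_of_real (A \<omega> $$ (k, l)) - (if k = l then z else 0)" for \<omega>
      using that c[of \<omega>] by (simp add: shifted_def)
    thus ?thesis using m[OF that] by simp
  qed
  have d: "(\<lambda>\<omega>. det (?S \<omega>)) \<in> borel_measurable M" by (rule borel_measurable_det[OF Sc Sm])
  have cof: "(\<lambda>\<omega>. cofactor (?S \<omega>) j i) \<in> borel_measurable M"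
  proof -
    have "(\<lambda>\<omega>. det (mat_delete (?S \<omega>) j i)) \<in> borel_measurable M"
    proof (rule borel_measurable_det[of _ "n - 1"])
      fix k l assume kl: "k < n - 1" "l < n - 1"
      have "mat_delete (?S \<omega>) j i $$ (k, l) = ?S \<omega> $$ (if k < j then k else Suc k, if l < i then l else Suc l)" for \<omega>
        using kl Sc[of \<omega>] by (simp add: mat_delete_def)
      moreover have "(\<lambda>\<omega>. ?S \<omega> $$ (if k < j then k else Suc k, if l < i then l else Suc l)) \<in> borel_measurable M"
        using kl by (intro Sm) auto
      ultimately show "(\<lambda>\<omega>. mat_delete (?S \<omega>) j i $$ (k, l)) \<in> borel_measurable M" by simp
    qed (rule mat_delete_carrier[OF Sc])
    thus ?thesis by (simp add: cofactor_def)
  qed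
  have "resolvent a (A \<omega>) z $$ (i, j) = 1 / det (?S \<omega>) * cofactor (?S \<omega>) j i" for \<omega>
    using ij Sc[of \<omega>] by (simp add: resolvent_def adj_mat_def)
  thus ?thesis using d cof by simp
qed

lemma borel_measurable_mat_mult:
  fixes A B :: "'a \<Rightarrow> complex mat"
  assumes "\<And>\<omega>. A \<omega> \<in> carrier_mat n n" "\<And>\<omega>. B \<omega> \<in> carrier_mat n n"
    and "\<And>i j. i < n \<Longrightarrow> j < n \<Longrightarrow> (\<lambda>\<omega>. A \<omega> $$ (i, j)) \<in> borel_measurable M"
    and "\<And>i j. i < n \<Longrightarrow> j < n \<Longrightarrow> (\<lambda>\<omega>. B \<omega> $$ (i, j)) \<in> borel_measurable M"
    and ij: "i < n" "j < n"
  shows "(\<lambda>\<omega>. (A \<omega> * B \<omega>) $$ (i, j)) \<in> borel_measurable M"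
proof -
  have "(A \<omega> * B \<omega>) $$ (i, j) = (\<Sum>k<n. A \<omega> $$ (i, k) * B \<omega> $$ (k, j))" for \<omega>
    using assms(1)[of \<omega>] assms(2)[of \<omega>] ij by (simp add: scalar_prod_def atLeast0LessThan)
  thus ?thesis using assms by simp
qed

lemma borel_measurable_ctrace:
  assumes "\<And>\<omega>. A \<omega> \<in> carrier_mat n n" and "\<And>i j. i < n \<Longrightarrow> j < n \<Longrightarrow> (\<lambda>\<omega>. A \<omega> $$ (i, j)) \<in> borel_measurable M"
  shows "(\<lambda>\<omega>. ctrace (A \<omega>)) \<in> borel_measurable M"
proof -
  have "ctrace (A \<omega>) = (\<Sum>i<n. A \<omega> $$ (i, i))" for \<omega> using assms(1)[of \<omega>] by (simp add: ctrace_def)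
  thus ?thesis using assms by simp
qed

lemma borel_measurable_qform:
  assumes "\<And>\<omega>. A \<omega> \<in> carrier_mat n n" and "\<And>i j. i < n \<Longrightarrow> j < n \<Longrightarrow> (\<lambda>\<omega>. A \<omega> $$ (i, j)) \<in> borel_measurable M"
    and "\<And>k. k < n \<Longrightarrow> (\<lambda>\<omega>. x \<omega> k) \<in> borel_measurable M"
  shows "(\<lambda>\<omega>. qform (A \<omega>) (x \<omega>)) \<in> borel_measurable M"
proof -
  have "qform (A \<omega>) (x \<omega>) = (\<Sum>i<n. \<Sum>j<n. A \<omega> $$ (i, j) * (of_real (x \<omega> i) * of_real (x \<omega> j)))" for \<omega>
    using assms(1)[of \<omega>] by (simp add: qform_def)
  thus ?thesis using assms by simp
qed

section \<open>First and second moments of forms in independent coordinates\<close>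

context indep_coordinates
begin

lemma two_product:
  assumes "j < p" "k < p"
  shows "integrable M (\<lambda>\<omega>. u j \<omega> * u k \<omega>)" and "j \<noteq> k \<Longrightarrow> expectation (\<lambda>\<omega>. u j \<omega> * u k \<omega>) = 0"
proof -
  let ?e = "\<lambda>i. (if i = j then 1 else 0) + (if i = k then 1 else (0::nat))"
  have one: "(\<Prod>i<p. u i \<omega> ^ (if i = j then 1 else 0)) = u j \<omega>" if "j < p" for j \<omega>
    using that by (subst prod.remove[of _ j]) (auto intro!: prod.neutral)
  have eq: "u j \<omega> * u k \<omega> = (\<Prod>i<p. u i \<omega> ^ ?e i)" for \<omega>
    by (simp only: power_add prod.distrib one assms)
  have ind: "indep_vars (\<lambda>_. borel) (\<lambda>i \<omega>. u i \<omega> ^ ?e i) {..<p}"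
    by (rule indep_vars_compose2[OF indep]) auto
  have ip: "integrable M (\<lambda>\<omega>. u i \<omega> ^ ?e i)" if "i \<in> {..<p}" for i
    by (rule int_power) (use that in auto)
  show "integrable M (\<lambda>\<omega>. u j \<omega> * u k \<omega>)"
    unfolding eq by (rule indep_vars_integrable[OF finite_lessThan ind ip])
  have e: "expectation (\<lambda>\<omega>. u j \<omega> * u k \<omega>) = (\<Prod>i<p. expectation (\<lambda>\<omega>. u i \<omega> ^ ?e i))"
    unfolding eq by (rule indep_vars_lebesgue_integral[OF finite_lessThan ind ip])
  assume jk: "j \<noteq> k"
  hence ej: "?e j = 1" by simp
  have z: "expectation (\<lambda>\<omega>. u j \<omega> ^ ?e j) = 0" unfolding ej power_one_right by (rule mean0[OF assms(1)])
  show "expectation (\<lambda>\<omega>. u j \<omega> * u k \<omega>) = 0"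
    unfolding e
  proof (rule prod_zero[OF finite_lessThan], rule bexI)
    show "expectation (\<lambda>\<omega>. u j \<omega> ^ ?e j) = 0" by (rule z)
  qed (use assms in simp)
qed

lemma linear_form_second_moment:
  fixes b :: "nat \<Rightarrow> real"
  shows "(\<integral>\<^sup>+ \<omega>. ennreal ((\<Sum>k<p. b k * u k \<omega>)\<^sup>2) \<partial>M) \<le> ennreal (s2 * (\<Sum>k<p. (b k)\<^sup>2))"
proof -
  have b: "expectation (\<lambda>\<omega>. u k \<omega> * u k \<omega>) \<le> s2" if "k \<in> {..<p}" for k
    using var[of k] that by (simp add: power2_eq_square)
  have tp: "integrable M (\<lambda>\<omega>. u s \<omega> * u t \<omega>)" "s \<noteq> t \<Longrightarrow> expectation (\<lambda>\<omega>. u s \<omega> * u t \<omega>) = 0"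
    if "s \<in> {..<p}" "t \<in> {..<p}" for s t
    using two_product[of s t] that by auto
  let ?Q = "\<lambda>\<omega>. (cmod (\<Sum>s<p. complex_of_real (b s) * of_real (u s \<omega>)))\<^sup>2"
  have os: "integrable M ?Q" "expectation ?Q \<le> s2 * (\<Sum>s<p. (cmod (complex_of_real (b s)))\<^sup>2)"
    by (rule orthogonal_sum_second_moment[OF finite_lessThan]; use tp b in blast)+
  have eq: "(cmod (\<Sum>s<p. complex_of_real (b s) * of_real (u s \<omega>)))\<^sup>2 = (\<Sum>k<p. b k * u k \<omega>)\<^sup>2" for \<omega>
  proof -
    have "(\<Sum>s<p. complex_of_real (b s) * of_real (u s \<omega>)) = of_real (\<Sum>k<p. b k * u k \<omega>)" by simp
    thus ?thesis by (simp only: norm_of_real power2_abs)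
  qed
  have "(\<integral>\<^sup>+ \<omega>. ennreal ((\<Sum>k<p. b k * u k \<omega>)\<^sup>2) \<partial>M) = ennreal (expectation (\<lambda>\<omega>. (\<Sum>k<p. b k * u k \<omega>)\<^sup>2))"
    using os(1) unfolding eq by (intro nn_integral_eq_integral) auto
  also have "\<dots> \<le> ennreal (s2 * (\<Sum>k<p. (b k)\<^sup>2))"
    using os(2) unfolding eq by (intro ennreal_leI) simp
  finally show ?thesis .
qed

lemma squares_sum_expectation:
  "(\<integral>\<^sup>+ \<omega>. ennreal (\<Sum>k<p. (u k \<omega>)\<^sup>2) \<partial>M) = ennreal (real p * s2)"
proof -
  have "integrable M (\<lambda>\<omega>. \<Sum>k<p. (u k \<omega>)\<^sup>2)" using int_power[of _ 2] by auto
  hence "(\<integral>\<^sup>+ \<omega>. ennreal (\<Sum>k<p. (u k \<omega>)\<^sup>2) \<partial>M) = ennreal (expectation (\<lambda>\<omega>. \<Sum>k<p. (u k \<omega>)\<^sup>2))"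
    by (intro nn_integral_eq_integral) (auto intro!: AE_I2 sum_nonneg)
  also have "expectation (\<lambda>\<omega>. \<Sum>k<p. (u k \<omega>)\<^sup>2) = real p * s2"
    using int_power[of _ 2] var by (subst Bochner_Integration.integral_sum) auto
  finally show ?thesis .
qed

end

lemma abs_le_square_div: "s > 0 \<Longrightarrow> t \<ge> 0 \<Longrightarrow> t \<le> t\<^sup>2 / s + (s::real)"
proof -
  assume s: "s > 0" and t: "t \<ge> 0"
  show ?thesis
  proof (cases "t \<le> s")
    case False
    hence "t * s \<le> t * t" using t by (intro mult_left_mono) auto
    hence "t \<le> t\<^sup>2 / s" using s by (simp add: power2_eq_square field_simps)
    thus ?thesis using s by simp
  qed (use s in \<open>simp add: add_increasing\<close>)
qed

text \<open>A second moment of order \<open>s\<^sup>2\<close> bounds the first absolute moment by order \<open>s\<close>. The pointwise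
  inequality \<open>t \<le> t\<^sup>2 / s + s\<close> replaces the Cauchy-Schwarz inequality and works directly for
  non-negative integrals.\<close>
lemma nn_integral_abs_le:
  assumes P: "prob_space M" and f[measurable]: "f \<in> borel_measurable M" and f0: "\<And>x. f x \<ge> (0::real)"
    and sq: "(\<integral>\<^sup>+ x. ennreal ((f x)\<^sup>2) \<partial>M) \<le> ennreal (K * s\<^sup>2)" and s: "s > 0" and K: "K \<ge> 0"
  shows "(\<integral>\<^sup>+ x. ennreal (f x) \<partial>M) \<le> ennreal (s * (K + 1))"
proof -
  interpret prob_space M by (rule P)
  have "(\<integral>\<^sup>+ x. ennreal (f x) \<partial>M) \<le> (\<integral>\<^sup>+ x. ennreal (1 / s) * ennreal ((f x)\<^sup>2) + ennreal s \<partial>M)"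
  proof (intro nn_integral_mono)
    fix x
    have "ennreal (f x) \<le> ennreal ((f x)\<^sup>2 / s + s)" using s f0 by (intro ennreal_leI abs_le_square_div) auto
    also have "\<dots> = ennreal (1 / s) * ennreal ((f x)\<^sup>2) + ennreal s" using s by (simp add: ennreal_mult[symmetric])
    finally show "ennreal (f x) \<le> ennreal (1 / s) * ennreal ((f x)\<^sup>2) + ennreal s" .
  qed
  also have "\<dots> = ennreal (1 / s) * (\<integral>\<^sup>+ x. ennreal ((f x)\<^sup>2) \<partial>M) + ennreal s"
    by (subst nn_integral_add) (auto simp: nn_integral_cmult emeasure_space_1)
  also have "\<dots> \<le> ennreal (1 / s) * ennreal (K * s\<^sup>2) + ennreal s"
    by (intro add_mono mult_left_mono sq) auto
  also have "\<dots> = ennreal (s * (K + 1))"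
    using s K by (simp add: ennreal_mult[symmetric] ennreal_plus[symmetric] power2_eq_square field_simps del: ennreal_plus)
  finally show ?thesis .
qed

lemma cvec_norm_smult: "cvec_norm (c \<cdot>\<^sub>v w) = cmod c * cvec_norm w"
proof -
  have "cvec_norm (c \<cdot>\<^sub>v w) = L2_set (\<lambda>i. cmod c * cmod (w $ i)) {..<dim_vec w}"
    unfolding cvec_norm_def by (intro L2_set_cong) (auto simp: norm_mult)
  thus ?thesis by (simp add: cvec_norm_def L2_set_right_distrib)
qed

section \<open>Linear images of vectors with independent entries\<close>

text \<open>The matrix \<open>R\<close> stands for the square root of \<open>\<Sigma>\<close> and \<open>C\<close> for a bound on the norm of \<open>\<Sigma>\<close>,
  uniform along a sequence of models. As entries have variance 1/2, the vector \<open>row y\<close> has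
  covariance matrix \<open>T = \<Sigma> / 2\<close>. Vectors are centred: translation by the mean cancels in
  differences.\<close>
locale sample_setting =
  fixes \<nu> :: "real measure" and p N :: nat and R :: "real mat" and C :: real
  assumes prob_nu: "prob_space \<nu>" and sets_nu: "sets \<nu> = sets borel"
    and nu4: "integrable \<nu> (\<lambda>x. x ^ 4)" and nu1: "(\<integral>x. x \<partial>\<nu>) = 0" and nu2: "(\<integral>x. x\<^sup>2 \<partial>\<nu>) = 1 / 2"
    and p: "p > 0" and N: "N \<ge> 2"
    and R: "R \<in> carrier_mat p p" and R_sym: "transpose_mat R = R"
    and C: "C > 0" and R_bound: "\<And>u. (\<Sum>k<p. (\<Sum>l<p. R $$ (k, l) * u l)\<^sup>2) \<le> C * (\<Sum>l<p. (u l)\<^sup>2)"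
begin

definition "k4 = (\<integral>x. x ^ 4 \<partial>\<nu>)"
definition "Pr = PiM {..<p} (\<lambda>_. \<nu>)"
definition "Om = PiM {..<N} (\<lambda>_. Pr)"
definition row :: "(nat \<Rightarrow> real) \<Rightarrow> nat \<Rightarrow> real" where "row y k = (\<Sum>l<p. R $$ (k, l) * y l)"
definition T :: "real mat" where "T = gram p {..<p} (\<lambda>_. 1 / 2) (\<lambda>k l. R $$ (k, l))"
definition TC :: "complex mat" where "TC = map_mat complex_of_real T"
definition RC :: "complex mat" where "RC = map_mat complex_of_real R"

lemma prob_Pr: "prob_space Pr" unfolding Pr_def by (intro prob_space_PiM prob_nu)
lemma prob_Om: "prob_space Om" unfolding Om_def by (intro prob_space_PiM prob_Pr)

lemma k4_nonneg: "k4 \<ge> 0" unfolding k4_def by (intro integral_nonneg_AE) auto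

lemma coord_measurable [measurable]: "k < p \<Longrightarrow> (\<lambda>y. y k) \<in> borel_measurable Pr"
proof -
  assume "k < p"
  hence "(\<lambda>y. y k) \<in> measurable Pr \<nu>" unfolding Pr_def by (intro measurable_component_singleton) auto
  thus ?thesis using sets_nu by (metis measurable_cong_sets)
qed

lemma coord_integral:
  assumes k: "k < p" and f: "f \<in> borel_measurable borel"
  shows "(\<integral>y. f (y k) \<partial>Pr) = (\<integral>x. f x \<partial>\<nu>)" and "integrable Pr (\<lambda>y. f (y k)) \<longleftrightarrow> integrable \<nu> (f :: real \<Rightarrow> real)"
proof -
  have d: "distr Pr \<nu> (\<lambda>y. y k) = \<nu>"
    unfolding Pr_def using k prob_nu by (intro distr_PiM_component) auto
  have m: "(\<lambda>y. y k) \<in> measurable Pr \<nu>" using k unfolding Pr_def by (intro measurable_component_singleton) auto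
  have f': "f \<in> borel_measurable \<nu>" using f sets_nu by (metis measurable_cong_sets)
  show "(\<integral>y. f (y k) \<partial>Pr) = (\<integral>x. f x \<partial>\<nu>)" using integral_distr[OF m f'] d by simp
  show "integrable Pr (\<lambda>y. f (y k)) \<longleftrightarrow> integrable \<nu> f" using integrable_distr_eq[OF m f'] d by simp
qed

sublocale Pr: indep_coordinates Pr p "\<lambda>k y. y k" "1/2" k4
proof (intro indep_coordinates.intro prob_Pr indep_coordinates_axioms.intro)
  interpret Pr: prob_space Pr by (rule prob_Pr)
  have ne: "{..<p} \<noteq> {}" using p by auto
  have d: "distr Pr borel (\<lambda>y. y k) = \<nu>" if "k \<in> {..<p}" for k
  proof -
    have "distr Pr borel (\<lambda>y. y k) = distr Pr \<nu> (\<lambda>y. y k)" using sets_nu by (intro distr_cong) auto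
    also have "\<dots> = \<nu>" unfolding Pr_def using that prob_nu by (intro distr_PiM_component) auto
    finally show ?thesis .
  qed
  have "distr Pr (PiM {..<p} (\<lambda>_. borel)) (\<lambda>x. \<lambda>i\<in>{..<p}. x i) = distr Pr Pr (\<lambda>x. x)"
  proof (intro distr_cong)
    show "sets (PiM {..<p} (\<lambda>_. borel)) = sets Pr" unfolding Pr_def using sets_nu by (intro sets_PiM_cong) auto
    show "\<And>x. x \<in> space Pr \<Longrightarrow> (\<lambda>i\<in>{..<p}. x i) = x" by (auto simp: Pr_def space_PiM)
  qed simp
  also have "\<dots> = Pr" by (rule distr_id)
  also have "\<dots> = PiM {..<p} (\<lambda>i. distr Pr borel (\<lambda>y. y i))"
    unfolding Pr_def[of] by (intro PiM_cong) (auto simp: d[unfolded Pr_def])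
  finally show "Pr.indep_vars (\<lambda>_. borel) (\<lambda>k y. y k) {..<p}"
    by (subst Pr.indep_vars_iff_distr_eq_PiM'[OF ne]) auto
  fix k assume k: "k < p"
  show "integrable Pr (\<lambda>y. y k ^ 4)" using coord_integral(2)[OF k, of "\<lambda>x. x ^ 4"] nu4 by simp
  show "(\<integral>y. y k \<partial>Pr) = 0" using coord_integral(1)[OF k, of "\<lambda>x. x"] nu1 by simp
  show "(\<integral>y. (y k)\<^sup>2 \<partial>Pr) = 1 / 2" using coord_integral(1)[OF k, of "\<lambda>x. x\<^sup>2"] nu2 by simp
  show "(\<integral>y. y k ^ 4 \<partial>Pr) \<le> k4" using coord_integral(1)[OF k, of "\<lambda>x. x ^ 4"] by (simp add: k4_def)
qed

lemma R_entry_sym: "k < p \<Longrightarrow> l < p \<Longrightarrow> R $$ (k, l) = R $$ (l, k)"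
  using symmetric_mat_entries[OF R R_sym] by simp

lemma RC_carrier [simp]: "RC \<in> carrier_mat p p" and TC_carrier [simp]: "TC \<in> carrier_mat p p" and T_carrier [simp]: "T \<in> carrier_mat p p"
  using R by (auto simp: RC_def TC_def T_def)

lemma psd_T: "psd_mat p T" unfolding T_def by (rule psd_gram) auto

lemma TC_eq: "TC = (1 / 2) \<cdot>\<^sub>m (RC * RC)"
proof (rule eq_matI)
  fix i j assume "i < dim_row ((1 / 2) \<cdot>\<^sub>m (RC * RC))" "j < dim_col ((1 / 2) \<cdot>\<^sub>m (RC * RC))"
  hence ij: "i < p" "j < p" using R by (auto simp: RC_def)
  have "(\<Sum>k<p. complex_of_real (R $$ (k, i)) * of_real (R $$ (k, j))) = (\<Sum>k<p. complex_of_real (R $$ (i, k)) * of_real (R $$ (k, j)))"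
    using ij by (intro sum.cong) (auto simp: R_entry_sym[of _ i])
  moreover have "TC $$ (i, j) = 1 / 2 * (\<Sum>k<p. complex_of_real (R $$ (k, i)) * of_real (R $$ (k, j)))"
    using ij by (simp add: TC_def T_def gram_def sum_distrib_left)
  moreover have "((1 / 2) \<cdot>\<^sub>m (RC * RC)) $$ (i, j) = 1 / 2 * (\<Sum>k<p. complex_of_real (R $$ (i, k)) * of_real (R $$ (k, j)))"
    using ij R by (simp add: RC_def scalar_prod_def atLeast0LessThan)
  ultimately show "TC $$ (i, j) = ((1 / 2) \<cdot>\<^sub>m (RC * RC)) $$ (i, j)" by metis
qed (use R in \<open>auto simp: TC_def T_def RC_def\<close>)

lemma op_bound_RC: "op_bound RC (sqrt C)"
  unfolding op_bound_def
proof (intro conjI ballI)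
  fix w :: "complex vec" assume "w \<in> carrier_vec (dim_col RC)"
  hence w: "w \<in> carrier_vec p" using R by (simp add: RC_def)
  have e: "(cmod ((RC *\<^sub>v w) $ k))\<^sup>2 = (\<Sum>l<p. R $$ (k, l) * Re (w $ l))\<^sup>2 + (\<Sum>l<p. R $$ (k, l) * Im (w $ l))\<^sup>2" if "k < p" for k
    using that w R by (simp add: RC_def scalar_prod_def atLeast0LessThan cmod_power2)
  have "(cvec_norm (RC *\<^sub>v w))\<^sup>2 = (\<Sum>k<p. (\<Sum>l<p. R $$ (k, l) * Re (w $ l))\<^sup>2) + (\<Sum>k<p. (\<Sum>l<p. R $$ (k, l) * Im (w $ l))\<^sup>2)"
    using w mult_mat_vec_carrier[OF RC_carrier w] by (simp add: cvec_norm_sq[of _ p] e sum.distrib del: index_mult_mat_vec)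
  also have "\<dots> \<le> C * (\<Sum>l<p. (Re (w $ l))\<^sup>2) + C * (\<Sum>l<p. (Im (w $ l))\<^sup>2)" by (intro add_mono R_bound)
  also have "\<dots> = C * (cvec_norm w)\<^sup>2"
    unfolding cvec_norm_sq[OF w] cmod_power2 sum.distrib by (rule distrib_left[symmetric])
  also have "\<dots> = (sqrt C * cvec_norm w)\<^sup>2" using C by (simp add: power_mult_distrib)
  finally have le: "(cvec_norm (RC *\<^sub>v w))\<^sup>2 \<le> (sqrt C * cvec_norm w)\<^sup>2" .
  show "cvec_norm (RC *\<^sub>v w) \<le> sqrt C * cvec_norm w"
    by (rule power2_le_imp_le[OF le]) (use C in simp)
qed (use C in auto)

lemma op_bound_TC: "op_bound TC (C / 2)"
proof -
  have op: "op_bound (RC * RC) C" using op_bound_mult[OF op_bound_RC op_bound_RC, of p] C by simp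
  show ?thesis unfolding op_bound_def
  proof (intro conjI ballI)
    fix w :: "complex vec" assume "w \<in> carrier_vec (dim_col TC)"
    hence w: "w \<in> carrier_vec p" by (simp add: TC_def T_def)
    have RR: "RC * RC \<in> carrier_mat p p" by (rule mult_carrier_mat[OF RC_carrier RC_carrier])
    have "TC *\<^sub>v w = (1 / 2) \<cdot>\<^sub>v ((RC * RC) *\<^sub>v w)"
      unfolding TC_eq using w RR by (intro eq_vecI) (auto simp: smult_scalar_prod_distrib[of _ p])
    hence "cvec_norm (TC *\<^sub>v w) = 1 / 2 * cvec_norm ((RC * RC) *\<^sub>v w)"
      using cvec_norm_smult[of "1 / 2" "(RC * RC) *\<^sub>v w"] by (simp add: norm_divide)
    also have "\<dots> \<le> C / 2 * cvec_norm w" using op_boundD[OF op RR w] by simp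
    finally show "cvec_norm (TC *\<^sub>v w) \<le> C / 2 * cvec_norm w" .
  qed (use C in auto)
qed

lemma qform_row:
  assumes M: "M \<in> carrier_mat p p"
  shows "qform M (row y) = qform (RC * M * RC) y"
proof -
  have rc: "real_cvec p (row y) = RC *\<^sub>v real_cvec p y"
    using R by (intro eq_vecI) (auto simp: row_def RC_def scalar_prod_def atLeast0LessThan)
  have RCt: "transpose_mat RC = RC" using R R_entry_sym by (intro eq_matI) (auto simp: RC_def)
  have "qform M (row y) = (RC *\<^sub>v real_cvec p y) \<bullet> (M *\<^sub>v (RC *\<^sub>v real_cvec p y))"
    unfolding qform_scalar_prod[OF M] rc ..
  also have "\<dots> = real_cvec p y \<bullet> (RC *\<^sub>v (M *\<^sub>v (RC *\<^sub>v real_cvec p y)))"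
  proof -
    define w where "w = M *\<^sub>v (RC *\<^sub>v real_cvec p y)"
    have w: "w \<in> carrier_vec p" unfolding w_def using M mult_mat_vec_carrier[OF RC_carrier, of "real_cvec p y"] by simp
    have "(RC *\<^sub>v real_cvec p y) \<bullet> w = real_cvec p y \<bullet> (RC *\<^sub>v w)"
      using transpose_vec_mult_scalar[OF RC_carrier w, of "real_cvec p y"] by (simp add: RCt)
    thus ?thesis by (simp add: w_def)
  qed
  also have "RC *\<^sub>v (M *\<^sub>v (RC *\<^sub>v real_cvec p y)) = (RC * M * RC) *\<^sub>v real_cvec p y"
  proof -
    have "RC * M \<in> carrier_mat p p" using M by (intro mult_carrier_mat) auto
    moreover have "RC *\<^sub>v real_cvec p y \<in> carrier_vec p" by (rule mult_mat_vec_carrier[OF RC_carrier]) simp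
    ultimately show ?thesis using M assoc_mult_mat_vec[of "RC * M" p p RC p "real_cvec p y"]
        assoc_mult_mat_vec[of RC p p M p "RC *\<^sub>v real_cvec p y"] by simp
  qed
  also have "real_cvec p y \<bullet> \<dots> = qform (RC * M * RC) y"
    using M by (intro qform_scalar_prod[symmetric] mult_carrier_mat[of _ p p]) auto
  finally show ?thesis .
qed

lemma ctrace_sandwich:
  assumes M: "M \<in> carrier_mat p p"
  shows "ctrace (RC * M * RC) = 2 * ctrace (TC * M)"
proof -
  have RM: "RC * M \<in> carrier_mat p p" using M by (intro mult_carrier_mat) auto
  have RR: "RC * RC \<in> carrier_mat p p" by (rule mult_carrier_mat[OF RC_carrier RC_carrier])
  have RRM: "RC * RC * M \<in> carrier_mat p p" by (rule mult_carrier_mat[OF RR M])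
  have "ctrace (RC * M * RC) = ctrace (RC * (RC * M))" using RM by (intro ctrace_comm[of _ p]) auto
  also have "RC * (RC * M) = RC * RC * M" using M by (intro assoc_mult_mat[symmetric, of _ p p _ p _ p]) auto
  also have "TC * M = (1 / 2) \<cdot>\<^sub>m (RC * RC * M)" unfolding TC_eq using RR M by (rule mult_smult_assoc_mat)
  hence h: "ctrace (TC * M) = 1 / 2 * ctrace (RC * RC * M)" using ctrace_arith(3)[OF RRM RRM, of "1/2"] by simp
  have "ctrace (RC * RC * M) = 2 * ctrace (TC * M)" unfolding h by simp
  finally show ?thesis .
qed

lemma row_measurable [measurable]: "k < p \<Longrightarrow> (\<lambda>y. row y k) \<in> borel_measurable Pr"
  unfolding row_def by (intro borel_measurable_sum borel_measurable_times borel_measurable_const coord_measurable) auto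

definition "Kq b = (2 * k4 + 1) * (C * b)\<^sup>2"

lemma Kq_nonneg: "Kq b \<ge> 0" unfolding Kq_def using k4_nonneg by auto

text \<open>In terms of the independent entries the form has matrix \<open>R M R\<close>, whose Frobenius norm is of
  order \<open>\<surd>p\<close>; its expectation is half the trace of \<open>R M R\<close>.\<close>
lemma row_quadratic_form:
  assumes M: "M \<in> carrier_mat p p" and b: "op_bound M b"
  shows "(\<integral>\<^sup>+ y. ennreal (cmod (qform M (row y) - ctrace (TC * M))) \<partial>Pr) \<le> ennreal (sqrt (real p) * (Kq b + 1))"
proof (rule nn_integral_abs_le[OF prob_Pr _ _ _ _ Kq_nonneg])
  define A where "A = RC * M * RC"
  have A: "A \<in> carrier_mat p p" unfolding A_def using M by (intro mult_carrier_mat[of _ p p]) auto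
  have opA: "op_bound A (C * b)"
  proof -
    have "op_bound A (sqrt C * b * sqrt C)"
      unfolding A_def using M b by (intro op_bound_mult[of _ _ _ _ p] op_bound_RC) (auto intro!: mult_carrier_mat[of _ p p])
    moreover have "sqrt C * b * sqrt C = C * b" using C by (simp add: mult.commute mult.left_commute)
    ultimately show ?thesis by simp
  qed
  have eq: "qform M (row y) - ctrace (TC * M) = (\<Sum>j<p. \<Sum>k<p. A $$ (j, k) * of_real (y j * y k)) - of_real (1 / 2) * (\<Sum>j<p. A $$ (j, j))" for y
    using ctrace_sandwich[OF M] qform_row[OF M, of y] A by (simp add: A_def[symmetric] qform_def ctrace_def)
  note qv = Pr.quadratic_form_variance[of "\<lambda>j k. A $$ (j, k)", folded eq]
  have "(\<integral>\<^sup>+ y. ennreal ((cmod (qform M (row y) - ctrace (TC * M)))\<^sup>2) \<partial>Pr) = ennreal (\<integral>y. (cmod (qform M (row y) - ctrace (TC * M)))\<^sup>2 \<partial>Pr)"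
    using qv(1) by (intro nn_integral_eq_integral) auto
  also have "\<dots> \<le> ennreal ((2 * k4 + 4 * (1 / 2)\<^sup>2) * (\<Sum>j<p. \<Sum>k<p. (cmod (A $$ (j, k)))\<^sup>2))"
    by (intro ennreal_leI qv(2))
  also have "\<dots> \<le> ennreal ((2 * k4 + 4 * (1 / 2)\<^sup>2) * (real p * (C * b)\<^sup>2))"
    using k4_nonneg by (intro ennreal_leI mult_left_mono op_bound_frobenius[OF opA A]) auto
  also have "(2 * k4 + 4 * (1 / 2)\<^sup>2) * (real p * (C * b)\<^sup>2) = Kq b * (sqrt (real p))\<^sup>2"
    by (simp add: Kq_def power2_eq_square)
  finally show "(\<integral>\<^sup>+ y. ennreal ((cmod (qform M (row y) - ctrace (TC * M)))\<^sup>2) \<partial>Pr) \<le> ennreal (Kq b * (sqrt (real p))\<^sup>2)" .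
  show "(\<lambda>y. cmod (qform M (row y) - ctrace (TC * M))) \<in> borel_measurable Pr"
    using borel_measurable_qform[of "\<lambda>_. M" p Pr row] M by simp
qed (use p in auto)

lemma row_norm_le: "(\<Sum>k<p. (row y k)\<^sup>2) \<le> C * (\<Sum>l<p. (y l)\<^sup>2)"
  unfolding row_def by (rule R_bound)

lemma row_norm_integral: "(\<integral>\<^sup>+ y. ennreal (\<Sum>k<p. (row y k)\<^sup>2) \<partial>Pr) \<le> ennreal (C * real p / 2)"
proof -
  have "(\<integral>\<^sup>+ y. ennreal (\<Sum>k<p. (row y k)\<^sup>2) \<partial>Pr) \<le> (\<integral>\<^sup>+ y. ennreal C * ennreal (\<Sum>k<p. (y k)\<^sup>2) \<partial>Pr)"
    using C by (intro nn_integral_mono) (auto simp: ennreal_mult[symmetric] sum_nonneg intro!: ennreal_leI row_norm_le)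
  also have "\<dots> = ennreal C * (\<integral>\<^sup>+ y. ennreal (\<Sum>k<p. (y k)\<^sup>2) \<partial>Pr)"
    by (intro nn_integral_cmult borel_measurable_sum measurable_compose[OF _ measurable_ennreal]
        borel_measurable_power coord_measurable) auto
  also have "\<dots> = ennreal (C * real p / 2)" unfolding Pr.squares_sum_expectation using C by (simp add: ennreal_mult[symmetric])
  finally show ?thesis .
qed

lemma row_linear_form:
  "(\<integral>\<^sup>+ y. ennreal ((\<Sum>k<p. row y k * w k)\<^sup>2) \<partial>Pr) \<le> ennreal (C / 2 * (\<Sum>k<p. (w k)\<^sup>2))"
proof -
  have "(\<Sum>k<p. row y k * w k) = (\<Sum>l<p. row w l * y l)" for y
  proof -
    have "(\<Sum>k<p. row y k * w k) = (\<Sum>k<p. \<Sum>l<p. R $$ (k, l) * y l * w k)" by (simp add: row_def sum_distrib_right)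
    also have "\<dots> = (\<Sum>l<p. \<Sum>k<p. R $$ (k, l) * y l * w k)" by (rule sum.swap)
    also have "\<dots> = (\<Sum>l<p. row w l * y l)"
      unfolding row_def sum_distrib_right by (intro sum.cong) (auto simp: R_entry_sym)
    finally show ?thesis .
  qed
  hence "(\<integral>\<^sup>+ y. ennreal ((\<Sum>k<p. row y k * w k)\<^sup>2) \<partial>Pr) \<le> ennreal (1 / 2 * (\<Sum>k<p. (row w k)\<^sup>2))"
    using Pr.linear_form_second_moment[of "row w"] by simp
  also have "\<dots> \<le> ennreal (C / 2 * (\<Sum>k<p. (w k)\<^sup>2))"
    using row_norm_le[of w] by (intro ennreal_leI) simp
  finally show ?thesis .
qed

section \<open>The sample as a point of a product space\<close>

definition X :: "(nat \<Rightarrow> nat \<Rightarrow> real) \<Rightarrow> nat \<Rightarrow> nat \<Rightarrow> real" where "X z i = row (z i)"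

lemma X_measurable [measurable]: "i < N \<Longrightarrow> k < p \<Longrightarrow> (\<lambda>z. X z i k) \<in> borel_measurable Om"
proof -
  assume "i < N" "k < p"
  moreover from this have "(\<lambda>z. z i) \<in> measurable Om Pr" unfolding Om_def by (intro measurable_component_singleton) auto
  ultimately show ?thesis unfolding X_def using measurable_compose[OF _ row_measurable] by simp
qed

lemma resample:
  assumes "h \<in> borel_measurable Om" "i < N"
  shows "(\<integral>\<^sup>+ z. h z \<partial>Om) = (\<integral>\<^sup>+ z. (\<integral>\<^sup>+ y. h (z(i := y)) \<partial>Pr) \<partial>Om)"
  using assms unfolding Om_def by (intro nn_integral_PiM_resample[OF prob_Pr]) auto

lemma resample_le:
  assumes "h \<in> borel_measurable Om" "i < N" "\<And>z. (\<integral>\<^sup>+ y. h (z(i := y)) \<partial>Pr) \<le> c"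
  shows "(\<integral>\<^sup>+ z. h z \<partial>Om) \<le> c"
proof -
  interpret prob_space Om by (rule prob_Om)
  have "(\<integral>\<^sup>+ z. h z \<partial>Om) \<le> (\<integral>\<^sup>+ z. c \<partial>Om)"
    unfolding resample[OF assms(1,2)] by (intro nn_integral_mono assms(3))
  thus ?thesis by (simp add: emeasure_space_1)
qed

lemma row_norm_expectation:
  assumes i: "i < N" shows "(\<integral>\<^sup>+ z. ennreal (\<Sum>k<p. (X z i k)\<^sup>2) \<partial>Om) \<le> ennreal (C * real p / 2)"
proof (rule resample_le[OF _ i])
  show "(\<lambda>z. ennreal (\<Sum>k<p. (X z i k)\<^sup>2)) \<in> borel_measurable Om"
    by (intro measurable_compose[OF _ measurable_ennreal] borel_measurable_sum borel_measurable_power X_measurable i) auto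
qed (use row_norm_integral in \<open>simp add: X_def\<close>)

text \<open>The hypothesis \<open>inv\<close> says that \<open>H\<close> does not depend on the row at which the form is
  evaluated, as is the case for leave-one-out resolvents.\<close>
lemma quadratic_error_expectation:
  assumes i: "i < N" and H: "\<And>z. H z \<in> carrier_mat p p" "\<And>z. op_bound (H z) b"
    and inv: "\<And>z y. H (z(i := y)) = H z"
    and meas: "\<And>j k. j < p \<Longrightarrow> k < p \<Longrightarrow> (\<lambda>z. H z $$ (j, k)) \<in> borel_measurable Om"
  shows "(\<integral>\<^sup>+ z. ennreal (cmod (qform (H z) (X z i) - ctrace (TC * H z))) \<partial>Om) \<le> ennreal (sqrt (real p) * (Kq b + 1))"
proof (rule resample_le[OF _ i])
  have "(\<lambda>z. qform (H z) (X z i)) \<in> borel_measurable Om"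
    by (intro borel_measurable_qform[of _ p] H meas X_measurable i) auto
  moreover have "(\<lambda>z. ctrace (TC * H z)) \<in> borel_measurable Om"
    by (intro borel_measurable_ctrace[of _ p] borel_measurable_mat_mult[of _ p] mult_carrier_mat[of _ p p] H meas) auto
  ultimately show "(\<lambda>z. ennreal (cmod (qform (H z) (X z i) - ctrace (TC * H z)))) \<in> borel_measurable Om" by simp
  fix z show "(\<integral>\<^sup>+ y. ennreal (cmod (qform (H (z(i := y))) (X (z(i := y)) i) - ctrace (TC * H (z(i := y))))) \<partial>Pr) \<le> ennreal (sqrt (real p) * (Kq b + 1))"
    unfolding inv using row_quadratic_form[OF H] by (simp add: X_def)
qed

text \<open>Given one row, the inner product is a linear form in the other; it is of order \<open>\<surd>p\<close>, whereas
  squared norms are of order \<open>p\<close>.\<close>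
lemma inner_product_expectation:
  assumes ij: "i < N" "j < N" "i \<noteq> j"
  shows "(\<integral>\<^sup>+ z. ennreal \<bar>\<Sum>k<p. X z i k * X z j k\<bar> \<partial>Om) \<le> ennreal (sqrt (real p) * (C\<^sup>2 / 4 + 1))"
proof (rule nn_integral_abs_le[OF prob_Om])
  have m: "(\<lambda>z. \<Sum>k<p. X z i k * X z j k) \<in> borel_measurable Om"
    using ij by (intro borel_measurable_sum borel_measurable_times X_measurable) auto
  thus "(\<lambda>z. \<bar>\<Sum>k<p. X z i k * X z j k\<bar>) \<in> borel_measurable Om" by simp
  have "(\<integral>\<^sup>+ z. ennreal (\<bar>\<Sum>k<p. X z i k * X z j k\<bar>\<^sup>2) \<partial>Om) = (\<integral>\<^sup>+ z. (\<integral>\<^sup>+ y. ennreal ((\<Sum>k<p. row y k * X z j k)\<^sup>2) \<partial>Pr) \<partial>Om)"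
    using m ij by (subst resample[of _ i]) (auto simp: X_def)
  also have "\<dots> \<le> (\<integral>\<^sup>+ z. ennreal (C / 2) * ennreal (\<Sum>k<p. (X z j k)\<^sup>2) \<partial>Om)"
    using C by (intro nn_integral_mono order.trans[OF row_linear_form]) (simp add: ennreal_mult[symmetric] sum_nonneg)
  also have "\<dots> = ennreal (C / 2) * (\<integral>\<^sup>+ z. ennreal (\<Sum>k<p. (X z j k)\<^sup>2) \<partial>Om)"
    using ij by (intro nn_integral_cmult measurable_compose[OF _ measurable_ennreal] borel_measurable_sum borel_measurable_power X_measurable) auto
  also have "\<dots> \<le> ennreal (C / 2) * ennreal (C * real p / 2)" by (intro mult_left_mono row_norm_expectation ij) auto
  also have "\<dots> = ennreal (C\<^sup>2 / 4 * (sqrt (real p))\<^sup>2)" using C by (simp add: ennreal_mult[symmetric] power2_eq_square)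
  finally show "(\<integral>\<^sup>+ z. ennreal (\<bar>\<Sum>k<p. X z i k * X z j k\<bar>\<^sup>2) \<partial>Om) \<le> ennreal (C\<^sup>2 / 4 * (sqrt (real p))\<^sup>2)" .
qed (use p C in auto)

end

section \<open>Kendall and covariance matrices of a sample\<close>

lemma nn_integral_real_bound:
  assumes "f \<in> borel_measurable M" "\<And>x. f x \<ge> (0::real)" "(\<integral>\<^sup>+ x. ennreal (f x) \<partial>M) \<le> ennreal c" "c \<ge> 0"
  shows "integrable M f" "(\<integral>x. f x \<partial>M) \<le> c"
proof -
  show "integrable M f" using assms le_less_trans[OF assms(3) ennreal_less_top] by (intro integrableI_nonneg) auto
  show "(\<integral>x. f x \<partial>M) \<le> c" using assms(3,4) by (intro integral_real_bounded) auto
qed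

locale sample_resolvent = sample_setting + 
  fixes w :: complex assumes w: "Im w > 0"
begin

text \<open>\<open>KM\<close> is the Kendall matrix times \<open>tr \<Sigma> / 2\<close>, where \<open>tS = tr \<Sigma>\<close>; a pair of equal
  observations contributes zero, its vector being zero. In \<open>SM\<close> all squared norms are replaced by
  their common mean \<open>tS\<close>, and \<open>BM\<close> is the sample covariance matrix of the centred vectors.
  \<open>mt A\<close> is the Stieltjes transform at \<open>w\<close> of the spectral distribution of \<open>A\<close>.\<close>

definition "v = Im w"
definition nsq :: "(nat \<Rightarrow> real) \<Rightarrow> real" where "nsq f = (\<Sum>k<p. (f k)\<^sup>2)"
definition ip :: "(nat \<Rightarrow> real) \<Rightarrow> (nat \<Rightarrow> real) \<Rightarrow> real" where "ip f g = (\<Sum>k<p. f k * g k)"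
definition "tS = (\<Sum>k<p. \<Sum>l<p. (R $$ (k, l))\<^sup>2)"
definition pairs :: "(nat \<times> nat) set" where "pairs = {(i, j). i < j \<and> j < N}"
definition "NN = real N * (real N - 1)"
definition d :: "(nat \<Rightarrow> nat \<Rightarrow> real) \<Rightarrow> nat \<times> nat \<Rightarrow> nat \<Rightarrow> real" where "d z s k = X z (fst s) k - X z (snd s) k"
definition "KM z = gram p pairs (\<lambda>s. tS / (NN * nsq (d z s))) (d z)"
definition "SM z = gram p pairs (\<lambda>s. 1 / NN) (d z)"
definition "BM z = gram p {..<N} (\<lambda>_. 1 / real N) (X z)"
definition "mt A = ctrace (resolvent 1 A w) / of_nat p"

lemma v: "v > 0" using w by (simp add: v_def)
lemma NN: "NN > 0" using N by (auto simp: NN_def)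
lemma finite_pairs: "finite pairs" by (rule finite_subset[of _ "{..<N} \<times> {..<N}"]) (auto simp: pairs_def)
lemma nsq_nonneg: "nsq f \<ge> 0" unfolding nsq_def by (intro sum_nonneg) auto
lemma tS_nonneg: "tS \<ge> 0" unfolding tS_def by (intro sum_nonneg) auto

lemma tS_le: "tS \<le> C * real p"
proof -
  have "(\<Sum>k<p. (R $$ (k, l))\<^sup>2) \<le> C" if l: "l < p" for l
  proof -
    have "(\<Sum>k<p. (\<Sum>m<p. R $$ (k, m) * (if m = l then 1 else 0))\<^sup>2) \<le> C * (\<Sum>m<p. (if m = l then 1 else (0::real))\<^sup>2)"
      by (rule R_bound)
    moreover have "(\<Sum>m<p. R $$ (k, m) * (if m = l then 1 else 0)) = R $$ (k, l)" for k
      using l by (subst sum.remove[of _ l]) (auto intro!: sum.neutral)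
    moreover have "(\<Sum>m<p. (if m = l then 1 else (0::real))\<^sup>2) = 1"
      using l by (subst sum.remove[of _ l]) (auto intro!: sum.neutral)
    ultimately show ?thesis by simp
  qed
  hence "(\<Sum>l<p. \<Sum>k<p. (R $$ (k, l))\<^sup>2) \<le> (\<Sum>l<p. C)" by (intro sum_mono) auto
  thus ?thesis unfolding tS_def by (subst sum.swap) (simp add: mult.commute)
qed

lemma ctrace_TC: "ctrace TC = of_real (tS / 2)"
proof -
  have "ctrace TC = of_real (\<Sum>i<p. \<Sum>k<p. 1 / 2 * (R $$ (k, i) * R $$ (k, i)))"
    by (simp add: ctrace_def TC_def T_def gram_def)
  also have "(\<Sum>i<p. \<Sum>k<p. 1 / 2 * (R $$ (k, i) * R $$ (k, i))) = (\<Sum>k<p. \<Sum>i<p. 1 / 2 * (R $$ (k, i) * R $$ (k, i)))"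
    by (rule sum.swap)
  also have "\<dots> = tS / 2" unfolding tS_def by (simp add: power2_eq_square sum_divide_distrib)
  finally show ?thesis .
qed

lemma psd_KM: "psd_mat p (KM z)" and psd_SM: "psd_mat p (SM z)" and psd_BM: "psd_mat p (BM z)"
  unfolding KM_def SM_def BM_def using tS_nonneg NN nsq_nonneg
  by (auto intro!: psd_gram divide_nonneg_nonneg mult_nonneg_nonneg simp: less_imp_le)

lemma mt_bound: "psd_mat p A \<Longrightarrow> cmod (mt A) \<le> 1 / v"
proof -
  assume A: "psd_mat p A"
  have "cmod (ctrace (resolvent 1 A w)) \<le> real p * (1 / v)"
    using resolvent_inverse(1,4)[OF A _ w, of 1] by (intro op_bound_ctrace) (auto simp: v_def)
  thus ?thesis using p by (simp add: mt_def norm_divide field_simps)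
qed

lemma mt_perturbation:
  assumes "psd_mat p A" "psd_mat p B"
    and diff: "\<And>i j. i < p \<Longrightarrow> j < p \<Longrightarrow> B $$ (i, j) - A $$ (i, j) = (\<Sum>s\<in>S. c s * (u s i * u s j))"
  shows "cmod (mt A - mt B) \<le> (\<Sum>s\<in>S. \<bar>c s\<bar> * nsq (u s)) / (real p * v\<^sup>2)"
proof -
  have "cmod (ctrace (1\<^sub>m p * resolvent 1 A w) - ctrace (1\<^sub>m p * resolvent 1 B w)) \<le> 1 * (\<Sum>s\<in>S. \<bar>c s\<bar> * (\<Sum>i<p. (u s i)\<^sup>2)) / (Im w)\<^sup>2"
    by (rule resolvent_gram_perturbation[OF assms(1,2) w diff op_bound_one]) auto
  hence "cmod (ctrace (resolvent 1 A w) - ctrace (resolvent 1 B w)) \<le> (\<Sum>s\<in>S. \<bar>c s\<bar> * nsq (u s)) / v\<^sup>2"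
    using resolvent_inverse(1)[OF assms(1) _ w, of 1] resolvent_inverse(1)[OF assms(2) _ w, of 1] by (simp add: nsq_def v_def)
  hence "cmod (ctrace (resolvent 1 A w) - ctrace (resolvent 1 B w)) / real p \<le> (\<Sum>s\<in>S. \<bar>c s\<bar> * nsq (u s)) / v\<^sup>2 / real p"
    by (intro divide_right_mono) auto
  thus ?thesis by (simp add: mt_def diff_divide_distrib[symmetric] norm_divide mult.commute)
qed

section \<open>Sensitivity to a single observation\<close>

text \<open>Both matrices are compared with the one from which all pairs containing the changed
  observation are dropped. There are \<open>N - 1\<close> such pairs, and each has trace norm at most
  \<open>tS / (N (N - 1))\<close> whatever the observation is: this is where the normalisation by norms helps.\<close>
lemma KM_bounded_difference:
  assumes i: "i < N"
  shows "cmod (mt (KM (z(i := y))) - mt (KM z)) \<le> 2 * C / (v\<^sup>2 * real N)"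
proof -
  define Q where "Q = {s \<in> pairs. fst s = i \<or> snd s = i}"
  have fQ: "finite Q" unfolding Q_def using finite_pairs by auto
  have cQ: "real (card Q) \<le> real N - 1"
  proof -
    have "Q \<subseteq> (\<lambda>j. (min i j, max i j)) ` ({..<N} - {i})"
    proof
      fix s assume "s \<in> Q"
      then obtain a b where s: "s = (a, b)" "a < b" "b < N" "a = i \<or> b = i" by (auto simp: Q_def pairs_def)
      show "s \<in> (\<lambda>j. (min i j, max i j)) ` ({..<N} - {i})"
        using s by (intro image_eqI[of _ _ "if a = i then b else a"]) auto
    qed
    hence "card Q \<le> card ({..<N} - {i})" by (meson card_image_le card_mono finite_Diff finite_imageI finite_lessThan order.trans)
    thus ?thesis using i N by (simp add: card_Diff_singleton)
  qed
  define K0 where "K0 z = gram p (pairs - Q) (\<lambda>s. tS / (NN * nsq (d z s))) (d z)" for z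
  have psd0: "psd_mat p (K0 z)" for z
    unfolding K0_def using tS_nonneg NN nsq_nonneg by (intro psd_gram divide_nonneg_nonneg mult_nonneg_nonneg) (auto simp: less_imp_le)
  have near: "cmod (mt (K0 z) - mt (KM z)) \<le> C / (v\<^sup>2 * real N)" for z
  proof -
    have "cmod (mt (K0 z) - mt (KM z)) \<le> (\<Sum>s\<in>Q. \<bar>tS / (NN * nsq (d z s))\<bar> * nsq (d z s)) / (real p * v\<^sup>2)"
    proof (rule mt_perturbation[OF psd0 psd_KM])
      fix a b assume "a < p" "b < p"
      moreover have "Q \<subseteq> pairs" by (auto simp: Q_def)
      ultimately show "KM z $$ (a, b) - K0 z $$ (a, b) = (\<Sum>s\<in>Q. tS / (NN * nsq (d z s)) * (d z s a * d z s b))"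
        by (simp add: KM_def K0_def gram_def sum.subset_diff[OF _ finite_pairs])
    qed
    also have "(\<Sum>s\<in>Q. \<bar>tS / (NN * nsq (d z s))\<bar> * nsq (d z s)) \<le> (\<Sum>s\<in>Q. tS / NN)"
      using tS_nonneg NN nsq_nonneg by (intro sum_mono) (auto simp: abs_mult field_simps)
    also have "\<dots> \<le> (real N - 1) * (C * real p / NN)"
      using cQ tS_le tS_nonneg NN by (simp, intro mult_mono divide_right_mono) auto
    also have "\<dots> = C * real p / real N" using N by (simp add: NN_def field_simps)
    finally show ?thesis using v p by (simp add: divide_right_mono field_simps)
  qed
  have "K0 (z(i := y)) = K0 z"
    unfolding K0_def gram_def
    by (intro cong_mat refl) (auto intro!: sum.cong simp: Q_def d_def X_def nsq_def)
  hence "mt (KM (z(i := y))) - mt (KM z) = (mt (K0 z) - mt (KM z)) - (mt (K0 (z(i := y))) - mt (KM (z(i := y))))" by simp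
  also have "cmod \<dots> \<le> C / (v\<^sup>2 * real N) + C / (v\<^sup>2 * real N)"
    by (intro order.trans[OF norm_triangle_ineq4] add_mono near)
  also have "\<dots> = 2 * C / (v\<^sup>2 * real N)" by simp
  finally show ?thesis .
qed

section \<open>From pairwise differences to the sample covariance matrix\<close>

text \<open>The weight of a summand of the difference, times the squared norm of its vector, is the
  deviation of that squared norm from \<open>tS\<close>, divided by \<open>N (N - 1)\<close>.\<close>
lemma KM_SM_diff: "cmod (mt (KM z) - mt (SM z)) \<le> (\<Sum>s\<in>pairs. \<bar>nsq (d z s) - tS\<bar>) / (NN * real p * v\<^sup>2)"
proof -
  have "cmod (mt (KM z) - mt (SM z)) \<le> (\<Sum>s\<in>pairs. \<bar>1 / NN - tS / (NN * nsq (d z s))\<bar> * nsq (d z s)) / (real p * v\<^sup>2)"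
    by (rule mt_perturbation[OF psd_KM psd_SM]) (simp add: KM_def SM_def gram_def sum_subtractf[symmetric] algebra_simps)
  also have "\<dots> \<le> (\<Sum>s\<in>pairs. \<bar>nsq (d z s) - tS\<bar> / NN) / (real p * v\<^sup>2)"
  proof (intro divide_right_mono sum_mono)
    fix s
    show "\<bar>1 / NN - tS / (NN * nsq (d z s))\<bar> * nsq (d z s) \<le> \<bar>nsq (d z s) - tS\<bar> / NN"
    proof (cases "nsq (d z s) = 0")
      case False
      hence "nsq (d z s) > 0" using nsq_nonneg[of "d z s"] by linarith
      hence "\<bar>1 / NN - tS / (NN * nsq (d z s))\<bar> * nsq (d z s) = \<bar>(1 / NN - tS / (NN * nsq (d z s))) * nsq (d z s)\<bar>"
        by (simp add: abs_mult)
      also have "(1 / NN - tS / (NN * nsq (d z s))) * nsq (d z s) = (nsq (d z s) - tS) / NN"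
        using False NN by (simp add: field_simps)
      finally show ?thesis using NN by (simp add: abs_divide)
    qed (use NN in auto)
  qed auto
  also have "\<dots> = (\<Sum>s\<in>pairs. \<bar>nsq (d z s) - tS\<bar>) / (NN * real p * v\<^sup>2)"
    by (simp add: sum_divide_distrib[symmetric] mult_ac)
  finally show ?thesis .
qed

text \<open>The mean over pairs is the unbiased sample covariance.\<close>
lemma SM_entries:
  assumes "a < p" "b < p"
  shows "SM z $$ (a, b) = (real N * (\<Sum>i<N. X z i a * X z i b) - (\<Sum>i<N. X z i a) * (\<Sum>i<N. X z i b)) / NN"
proof -
  define f where "f i j = (X z i a - X z j a) * (X z i b - X z j b)" for i j
  have "(\<Sum>i<N. \<Sum>j<N. f i j) = (\<Sum>s\<in>pairs. 2 * f (fst s) (snd s))"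
    unfolding double_sum_pairs pairs_def by (simp add: f_def algebra_simps)
  moreover have "(\<Sum>i<N. \<Sum>j<N. f i j) = 2 * (real N * (\<Sum>i<N. X z i a * X z i b) - (\<Sum>i<N. X z i a) * (\<Sum>i<N. X z i b))"
  proof -
    have "(\<Sum>i<N. \<Sum>j<N. f i j) = (\<Sum>i<N. \<Sum>j<N. X z i a * X z i b) + (\<Sum>i<N. \<Sum>j<N. X z j a * X z j b)
        - (\<Sum>i<N. \<Sum>j<N. X z i a * X z j b) - (\<Sum>i<N. \<Sum>j<N. X z j a * X z i b)"
      by (simp add: f_def algebra_simps sum.distrib sum_subtractf)
    also have "(\<Sum>i<N. \<Sum>j<N. X z i a * X z j b) = (\<Sum>i<N. X z i a) * (\<Sum>i<N. X z i b)" by (simp add: sum_product)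
    also have "(\<Sum>i<N. \<Sum>j<N. X z j a * X z i b) = (\<Sum>i<N. X z i a) * (\<Sum>i<N. X z i b)"
      by (subst sum.swap) (simp add: sum_product)
    finally show ?thesis by (simp add: sum_distrib_left[symmetric])
  qed
  ultimately have "(\<Sum>s\<in>pairs. f (fst s) (snd s)) = real N * (\<Sum>i<N. X z i a * X z i b) - (\<Sum>i<N. X z i a) * (\<Sum>i<N. X z i b)"
    by (simp add: sum_distrib_left[symmetric])
  thus ?thesis using assms by (simp add: SM_def gram_def d_def f_def sum_divide_distrib[symmetric])
qed

lemma nsq_of_sum: "nsq (\<lambda>k. \<Sum>i<N. X z i k) = (\<Sum>i<N. \<Sum>j<N. ip (X z i) (X z j))"
proof -
  have "nsq (\<lambda>k. \<Sum>i<N. X z i k) = (\<Sum>k<p. \<Sum>i<N. \<Sum>j<N. X z i k * X z j k)"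
    by (simp add: nsq_def power2_eq_square sum_product)
  also have "\<dots> = (\<Sum>i<N. \<Sum>j<N. \<Sum>k<p. X z i k * X z j k)"
    by (subst sum.swap, rule sum.cong[OF refl], rule sum.swap)
  finally show ?thesis by (simp add: ip_def)
qed

text \<open>By \<open>SM_entries\<close>, \<open>SM\<close> differs from \<open>BM\<close> by the outer product of the sum vector with itself,
  divided by \<open>N (N - 1)\<close>, and by a multiple of \<open>BM\<close> with factor \<open>1 / (N - 1)\<close>.\<close>
lemma SM_BM_diff: "cmod (mt (SM z) - mt (BM z)) \<le> ((\<Sum>i<N. nsq (X z i)) + (\<Sum>i<N. \<Sum>j<N. \<bar>ip (X z i) (X z j)\<bar>)) / (NN * real p * v\<^sup>2)"
proof -
  \<comment> \<open>The index \<open>None\<close> belongs to the sum vector, \<open>Some i\<close> to an observation.\<close>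
  let ?S = "insert None (Some ` {..<N})"
  let ?c = "\<lambda>s. case s of None \<Rightarrow> 1 / NN | Some i \<Rightarrow> - 1 / NN"
  let ?u = "\<lambda>s. case s of None \<Rightarrow> (\<lambda>k. \<Sum>i<N. X z i k) | Some i \<Rightarrow> X z i"
  have sum: "(\<Sum>s\<in>?S. g s) = g None + (\<Sum>i<N. g (Some i))" for g :: "nat option \<Rightarrow> real"
    by (subst sum.insert) (auto simp: sum.reindex)
  have "cmod (mt (SM z) - mt (BM z)) \<le> (\<Sum>s\<in>?S. \<bar>?c s\<bar> * nsq (?u s)) / (real p * v\<^sup>2)"
  proof (rule mt_perturbation[OF psd_SM psd_BM])
    fix a b assume ab: "a < p" "b < p"
    have "BM z $$ (a, b) = (real N - 1) * (\<Sum>i<N. X z i a * X z i b) / NN"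
      using ab N by (simp add: BM_def gram_def NN_def sum_divide_distrib[symmetric])
    thus "BM z $$ (a, b) - SM z $$ (a, b) = (\<Sum>s\<in>?S. ?c s * (?u s a * ?u s b))"
      unfolding sum SM_entries[OF ab] by (simp add: sum_divide_distrib[symmetric] sum_negf diff_divide_distrib[symmetric] algebra_simps)
  qed
  also have "(\<Sum>s\<in>?S. \<bar>?c s\<bar> * nsq (?u s)) = (nsq (\<lambda>k. \<Sum>i<N. X z i k) + (\<Sum>i<N. nsq (X z i))) / NN"
    unfolding sum using NN by (simp add: sum_divide_distrib[symmetric] add_divide_distrib abs_divide)
  also have "\<dots> / (real p * v\<^sup>2) \<le> ((\<Sum>i<N. nsq (X z i)) + (\<Sum>i<N. \<Sum>j<N. \<bar>ip (X z i) (X z j)\<bar>)) / NN / (real p * v\<^sup>2)"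
  proof -
    have "nsq (\<lambda>k. \<Sum>i<N. X z i k) \<le> (\<Sum>i<N. \<Sum>j<N. \<bar>ip (X z i) (X z j)\<bar>)"
      unfolding nsq_of_sum by (intro sum_mono) auto
    thus ?thesis using NN by (intro divide_right_mono) auto
  qed
  finally show ?thesis by (simp add: mult_ac)
qed

lemma nsq_d: "nsq (d z s) = nsq (X z (fst s)) + nsq (X z (snd s)) - 2 * ip (X z (fst s)) (X z (snd s))"
  by (simp add: nsq_def d_def ip_def power2_diff sum.distrib sum_subtractf sum_distrib_left algebra_simps)

lemma KM_BM_diff: "cmod (mt (KM z) - mt (BM z)) \<le>
   ((\<Sum>s\<in>pairs. \<bar>nsq (X z (fst s)) - tS / 2\<bar> + \<bar>nsq (X z (snd s)) - tS / 2\<bar> + 2 * \<bar>ip (X z (fst s)) (X z (snd s))\<bar>)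
     + (\<Sum>i<N. nsq (X z i)) + (\<Sum>i<N. \<Sum>j<N. \<bar>ip (X z i) (X z j)\<bar>)) / (NN * real p * v\<^sup>2)"
proof -
  define c where "c = NN * real p * v\<^sup>2"
  define E where "E = (\<Sum>s\<in>pairs. \<bar>nsq (X z (fst s)) - tS / 2\<bar> + \<bar>nsq (X z (snd s)) - tS / 2\<bar> + 2 * \<bar>ip (X z (fst s)) (X z (snd s))\<bar>)"
  define Q where "Q = (\<Sum>i<N. nsq (X z i)) + (\<Sum>i<N. \<Sum>j<N. \<bar>ip (X z i) (X z j)\<bar>)"
  have c0: "c \<ge> 0" using NN by (simp add: c_def)
  have E: "(\<Sum>s\<in>pairs. \<bar>nsq (d z s) - tS\<bar>) \<le> (\<Sum>s\<in>pairs. \<bar>nsq (X z (fst s)) - tS / 2\<bar> + \<bar>nsq (X z (snd s)) - tS / 2\<bar> + 2 * \<bar>ip (X z (fst s)) (X z (snd s))\<bar>)"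
    unfolding nsq_d by (intro sum_mono) linarith
  have "cmod (mt (KM z) - mt (BM z)) \<le> cmod (mt (KM z) - mt (SM z)) + cmod (mt (SM z) - mt (BM z))"
    using norm_triangle_ineq[of "mt (KM z) - mt (SM z)" "mt (SM z) - mt (BM z)"] by simp
  also have "\<dots> \<le> E / c + Q / c"
  proof (rule add_mono)
    show "cmod (mt (KM z) - mt (SM z)) \<le> E / c"
      using KM_SM_diff[of z, folded c_def] divide_right_mono[OF E c0] by (simp add: E_def)
    show "cmod (mt (SM z) - mt (BM z)) \<le> Q / c" using SM_BM_diff[of z] by (simp add: Q_def c_def)
  qed
  also have "E / c + Q / c = (E + Q) / c" by (rule add_divide_distrib[symmetric])
  finally show ?thesis by (simp add: E_def Q_def c_def add.assoc)
qed

section \<open>Measurability of the empirical transforms\<close>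

lemma KM_measurable: "(\<lambda>z. mt (KM z)) \<in> borel_measurable Om"
proof -
  have dm: "(\<lambda>z. d z s k) \<in> borel_measurable Om" if "s \<in> pairs" "k < p" for s k
    unfolding d_def using that by (intro borel_measurable_diff X_measurable) (auto simp: pairs_def)
  have nm: "(\<lambda>z. nsq (d z s)) \<in> borel_measurable Om" if "s \<in> pairs" for s
    unfolding nsq_def using that by (intro borel_measurable_sum borel_measurable_power dm) auto
  have "(\<lambda>z. KM z $$ (i, j)) \<in> borel_measurable Om" if "i < p" "j < p" for i j
    using that unfolding KM_def gram_def 
    by (simp, intro borel_measurable_sum borel_measurable_times borel_measurable_divide borel_measurable_const dm nm) auto
  thus ?thesis unfolding mt_def
    by (intro borel_measurable_divide borel_measurable_const borel_measurable_ctrace[of _ p] borel_measurable_resolvent[of _ p])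
       (auto simp: KM_def intro: resolvent_inverse(1)[OF psd_KM[unfolded KM_def] _ w])
qed

lemma gram_X_entry_measurable:
  assumes "I \<subseteq> {..<N}" "i < p" "j < p"
  shows "(\<lambda>z. gram p I (\<lambda>_. 1 / real N) (X z) $$ (i, j)) \<in> borel_measurable Om"
  using assms unfolding gram_def
  by (simp, intro borel_measurable_sum borel_measurable_times borel_measurable_divide borel_measurable_const X_measurable) auto

lemma gram_resolvent_measurable:
  assumes "I \<subseteq> {..<N}" "i < p" "j < p"
  shows "(\<lambda>z. resolvent 1 (gram p I (\<lambda>_. 1 / real N) (X z)) w $$ (i, j)) \<in> borel_measurable Om"
  by (intro borel_measurable_resolvent[of _ p] gram_X_entry_measurable assms gram_carrier)

lemma BM_measurable: "(\<lambda>z. mt (BM z)) \<in> borel_measurable Om"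
  unfolding mt_def BM_def
  by (intro borel_measurable_divide borel_measurable_const borel_measurable_ctrace[of _ p] gram_resolvent_measurable)
     (auto intro: resolvent_inverse(1)[OF psd_BM[unfolded BM_def] _ w])

end

section \<open>Expected distance between the two transforms\<close>

context sample_resolvent
begin

text \<open>Constants for the errors of squared norms, of inner products, and of quadratic forms in a
  product of two resolvents and in one resolvent. They depend on the model only through \<open>C\<close>, the
  fourth moment and \<open>w\<close>.\<close>
definition "K1 = Kq 1 + 1"
definition "K2 = C\<^sup>2 / 4 + 1"
definition "K3 = Kq (1 / v\<^sup>2) + 1"
definition "K4 = Kq (1 / v) + 1"

lemma error_constants_nonneg: "K1 \<ge> 0" "K2 \<ge> 0" "K3 \<ge> 0" "K4 \<ge> 0"
  using Kq_nonneg by (auto simp: K1_def K2_def K3_def K4_def)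

lemma nsq_integral:
  assumes "i < N"
  shows "integrable Om (\<lambda>z. nsq (X z i))" "(\<integral>z. nsq (X z i) \<partial>Om) \<le> C * real p / 2"
proof -
  have m: "(\<lambda>z. nsq (X z i)) \<in> borel_measurable Om"
    unfolding nsq_def using assms by (intro borel_measurable_sum borel_measurable_power X_measurable) auto
  have c: "C * real p / 2 \<ge> 0" using C by simp
  show "integrable Om (\<lambda>z. nsq (X z i))" "(\<integral>z. nsq (X z i) \<partial>Om) \<le> C * real p / 2"
    using nn_integral_real_bound[OF m nsq_nonneg row_norm_expectation[OF assms, folded nsq_def] c] by auto
qed

lemma ip_integral:
  assumes "i < N" "j < N" "i \<noteq> j"
  shows "integrable Om (\<lambda>z. \<bar>ip (X z i) (X z j)\<bar>)" "(\<integral>z. \<bar>ip (X z i) (X z j)\<bar> \<partial>Om) \<le> sqrt (real p) * K2"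
proof -
  have m: "(\<lambda>z. \<bar>ip (X z i) (X z j)\<bar>) \<in> borel_measurable Om"
    unfolding ip_def using assms by (intro borel_measurable_abs borel_measurable_sum borel_measurable_times X_measurable) auto
  have c: "sqrt (real p) * K2 \<ge> 0" using error_constants_nonneg by simp
  show "integrable Om (\<lambda>z. \<bar>ip (X z i) (X z j)\<bar>)" "(\<integral>z. \<bar>ip (X z i) (X z j)\<bar> \<partial>Om) \<le> sqrt (real p) * K2"
    using nn_integral_real_bound[OF m abs_ge_zero inner_product_expectation[OF assms, folded ip_def K2_def] c] by auto
qed

lemma quadratic_integral:
  assumes i: "i < N" and H: "\<And>z. H z \<in> carrier_mat p p" "\<And>z. op_bound (H z) b"
    and inv: "\<And>z y. H (z(i := y)) = H z"
    and meas: "\<And>j k. j < p \<Longrightarrow> k < p \<Longrightarrow> (\<lambda>z. H z $$ (j, k)) \<in> borel_measurable Om"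
  shows "integrable Om (\<lambda>z. cmod (qform (H z) (X z i) - ctrace (TC * H z)))" 
    "(\<integral>z. cmod (qform (H z) (X z i) - ctrace (TC * H z)) \<partial>Om) \<le> sqrt (real p) * (Kq b + 1)"
proof -
  have m1: "(\<lambda>z. qform (H z) (X z i)) \<in> borel_measurable Om"
    by (intro borel_measurable_qform[of _ p] H meas X_measurable i) auto
  have m2: "(\<lambda>z. ctrace (TC * H z)) \<in> borel_measurable Om"
    by (intro borel_measurable_ctrace[of _ p] borel_measurable_mat_mult[of _ p] mult_carrier_mat[of _ p p] H meas) auto
  have m: "(\<lambda>z. cmod (qform (H z) (X z i) - ctrace (TC * H z))) \<in> borel_measurable Om" using m1 m2 by simp
  have c: "sqrt (real p) * (Kq b + 1) \<ge> 0" using Kq_nonneg by (simp add: add_nonneg_nonneg)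
  show "integrable Om (\<lambda>z. cmod (qform (H z) (X z i) - ctrace (TC * H z)))" 
    "(\<integral>z. cmod (qform (H z) (X z i) - ctrace (TC * H z)) \<partial>Om) \<le> sqrt (real p) * (Kq b + 1)"
    using nn_integral_real_bound[OF m norm_ge_zero quadratic_error_expectation[OF assms] c] by auto
qed

text \<open>The squared norm is the quadratic form of the identity matrix.\<close>
lemma norm_error_integral:
  assumes i: "i < N"
  shows "integrable Om (\<lambda>z. \<bar>nsq (X z i) - tS / 2\<bar>)" "(\<integral>z. \<bar>nsq (X z i) - tS / 2\<bar> \<partial>Om) \<le> sqrt (real p) * K1"
proof -
  have e: "qform (1\<^sub>m p) f = of_real (nsq f)" for f
  proof -
    have "qform (1\<^sub>m p) f = (\<Sum>i<p. \<Sum>j<p. if j = i then of_real ((f i)\<^sup>2) else 0)"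
      unfolding qform_def by (intro sum.cong) (auto simp: power2_eq_square)
    thus ?thesis by (simp add: nsq_def)
  qed
  have "cmod (qform (1\<^sub>m p) (X z i) - ctrace (TC * 1\<^sub>m p)) = \<bar>nsq (X z i) - tS / 2\<bar>" for z
    using right_mult_one_mat[OF TC_carrier] by (simp only: e ctrace_TC of_real_diff[symmetric] norm_of_real)
  thus "integrable Om (\<lambda>z. \<bar>nsq (X z i) - tS / 2\<bar>)" "(\<integral>z. \<bar>nsq (X z i) - tS / 2\<bar> \<partial>Om) \<le> sqrt (real p) * K1"
    using quadratic_integral[OF i, of "\<lambda>_. 1\<^sub>m p" 1] op_bound_one by (auto simp: K1_def)
qed

lemma mt_integrable: "integrable Om (\<lambda>z. mt (KM z))" "integrable Om (\<lambda>z. mt (BM z))"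
proof -
  interpret prob_space Om by (rule prob_Om)
  show "integrable Om (\<lambda>z. mt (KM z))"
    by (rule integrable_const_bound[of _ "1 / v"]) (use KM_measurable mt_bound[OF psd_KM] in auto)
  show "integrable Om (\<lambda>z. mt (BM z))"
    by (rule integrable_const_bound[of _ "1 / v"]) (use BM_measurable mt_bound[OF psd_BM] in auto)
qed

text \<open>Of the roughly \<open>N\<^sup>2\<close> pairs each contributes an error of order \<open>\<surd>p\<close> to trace norms that are
  normalised by \<open>N\<^sup>2 p\<close>; the diagonal terms are fewer, \<open>N\<close> of order \<open>p\<close>.\<close>
lemma kendall_sample_close:
  "(\<integral>z. cmod (mt (KM z) - mt (BM z)) \<partial>Om) \<le> (2 * (2 * K1 + 3 * K2) / sqrt (real p) + 2 * C / real N) / v\<^sup>2"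
proof -
  define s where "s = sqrt (real p)"
  have s: "s > 0" "s * s = real p" using p by (auto simp: s_def)
  define F where "F z = (\<Sum>u\<in>pairs. \<bar>nsq (X z (fst u)) - tS / 2\<bar> + \<bar>nsq (X z (snd u)) - tS / 2\<bar> + 2 * \<bar>ip (X z (fst u)) (X z (snd u))\<bar>)" for z
  define F2 where "F2 z = (\<Sum>i<N. nsq (X z i))" for z
  define F3 where "F3 z = (\<Sum>i<N. \<Sum>j<N. \<bar>ip (X z i) (X z j)\<bar>)" for z
  have ip_self: "ip f f = nsq f" for f by (simp add: ip_def nsq_def power2_eq_square)
  have iF: "integrable Om F" unfolding F_def
    by (intro Bochner_Integration.integrable_sum Bochner_Integration.integrable_add integrable_mult_right norm_error_integral ip_integral) (auto simp: pairs_def)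
  have iF2: "integrable Om F2" unfolding F2_def by (intro Bochner_Integration.integrable_sum nsq_integral) auto
  have iip: "integrable Om (\<lambda>z. \<bar>ip (X z i) (X z j)\<bar>)" and bip: "(\<integral>z. \<bar>ip (X z i) (X z j)\<bar> \<partial>Om) \<le> s * K2 + (if i = j then C * real p / 2 else 0)"
    if "i < N" "j < N" for i j
    using ip_integral[of i j] nsq_integral[of i] that nsq_nonneg s error_constants_nonneg
    by (cases "i = j"; auto simp: ip_self s_def intro: add_increasing)+
  have iF3: "integrable Om F3" unfolding F3_def by (intro Bochner_Integration.integrable_sum iip) auto
  have cp: "real (card pairs) \<le> real N * real N"
  proof -
    have "card pairs \<le> card ({..<N} \<times> {..<N})" by (intro card_mono) (auto simp: pairs_def)
    thus ?thesis by (simp flip: of_nat_mult)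
  qed
  have "(\<integral>z. F z \<partial>Om) = (\<Sum>u\<in>pairs. (\<integral>z. \<bar>nsq (X z (fst u)) - tS / 2\<bar> \<partial>Om) + (\<integral>z. \<bar>nsq (X z (snd u)) - tS / 2\<bar> \<partial>Om) + 2 * (\<integral>z. \<bar>ip (X z (fst u)) (X z (snd u))\<bar> \<partial>Om))"
    unfolding F_def
  proof (subst Bochner_Integration.integral_sum)
    fix u assume "u \<in> pairs"
    hence u: "fst u < N" "snd u < N" "fst u \<noteq> snd u" by (auto simp: pairs_def)
    note i = norm_error_integral(1)[OF u(1)] norm_error_integral(1)[OF u(2)] ip_integral(1)[OF u]
    show "integrable Om (\<lambda>z. \<bar>nsq (X z (fst u)) - tS / 2\<bar> + \<bar>nsq (X z (snd u)) - tS / 2\<bar> + 2 * \<bar>ip (X z (fst u)) (X z (snd u))\<bar>)"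
      using i by auto
  next
    show "(\<Sum>u\<in>pairs. \<integral>z. \<bar>nsq (X z (fst u)) - tS / 2\<bar> + \<bar>nsq (X z (snd u)) - tS / 2\<bar> + 2 * \<bar>ip (X z (fst u)) (X z (snd u))\<bar> \<partial>Om) =
      (\<Sum>u\<in>pairs. (\<integral>z. \<bar>nsq (X z (fst u)) - tS / 2\<bar> \<partial>Om) + (\<integral>z. \<bar>nsq (X z (snd u)) - tS / 2\<bar> \<partial>Om) + 2 * (\<integral>z. \<bar>ip (X z (fst u)) (X z (snd u))\<bar> \<partial>Om))"
    proof (intro sum.cong refl)
      fix u assume "u \<in> pairs"
      hence u: "fst u < N" "snd u < N" "fst u \<noteq> snd u" by (auto simp: pairs_def)
      note i = norm_error_integral(1)[OF u(1)] norm_error_integral(1)[OF u(2)] ip_integral(1)[OF u]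
      show "(\<integral>z. \<bar>nsq (X z (fst u)) - tS / 2\<bar> + \<bar>nsq (X z (snd u)) - tS / 2\<bar> + 2 * \<bar>ip (X z (fst u)) (X z (snd u))\<bar> \<partial>Om) =
        (\<integral>z. \<bar>nsq (X z (fst u)) - tS / 2\<bar> \<partial>Om) + (\<integral>z. \<bar>nsq (X z (snd u)) - tS / 2\<bar> \<partial>Om) + 2 * (\<integral>z. \<bar>ip (X z (fst u)) (X z (snd u))\<bar> \<partial>Om)"
        using i by simp
    qed
  qed
  also have "\<dots> \<le> (\<Sum>u\<in>pairs. s * K1 + s * K1 + 2 * (s * K2))"
    unfolding s_def by (intro sum_mono add_mono mult_left_mono norm_error_integral ip_integral) (auto simp: pairs_def)
  also have "\<dots> = real (card pairs) * (s * (2 * K1 + 2 * K2))" by (simp add: algebra_simps)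
  also have "\<dots> \<le> real N * real N * (s * (2 * K1 + 2 * K2))"
    using cp s error_constants_nonneg by (intro mult_right_mono) auto
  finally have bF: "(\<integral>z. F z \<partial>Om) \<le> real N * real N * (s * (2 * K1 + 2 * K2))" .
  have "(\<integral>z. F2 z \<partial>Om) = (\<Sum>i<N. \<integral>z. nsq (X z i) \<partial>Om)"
    unfolding F2_def by (intro Bochner_Integration.integral_sum nsq_integral) auto
  also have "\<dots> \<le> (\<Sum>i<N. C * real p / 2)" by (intro sum_mono nsq_integral) auto
  finally have bF2: "(\<integral>z. F2 z \<partial>Om) \<le> real N * (C * real p / 2)" by simp
  have "(\<integral>z. F3 z \<partial>Om) = (\<Sum>i<N. \<integral>z. (\<Sum>j<N. \<bar>ip (X z i) (X z j)\<bar>) \<partial>Om)"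
    unfolding F3_def by (intro Bochner_Integration.integral_sum Bochner_Integration.integrable_sum iip) auto
  also have "\<dots> = (\<Sum>i<N. \<Sum>j<N. \<integral>z. \<bar>ip (X z i) (X z j)\<bar> \<partial>Om)"
    by (intro sum.cong refl Bochner_Integration.integral_sum iip) auto
  also have "\<dots> \<le> (\<Sum>i<N. \<Sum>j<N. s * K2 + (if i = j then C * real p / 2 else 0))"
    by (intro sum_mono bip) auto
  also have "\<dots> = real N * real N * (s * K2) + real N * (C * real p / 2)" by (simp add: sum.distrib algebra_simps)
  finally have bF3: "(\<integral>z. F3 z \<partial>Om) \<le> real N * real N * (s * K2) + real N * (C * real p / 2)" .
  have "(\<integral>z. cmod (mt (KM z) - mt (BM z)) \<partial>Om) \<le> (\<integral>z. (F z + F2 z + F3 z) / (NN * real p * v\<^sup>2) \<partial>Om)"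
  proof (intro integral_mono)
    show "integrable Om (\<lambda>z. cmod (mt (KM z) - mt (BM z)))" using mt_integrable by (intro integrable_norm Bochner_Integration.integrable_diff)
    show "integrable Om (\<lambda>z. (F z + F2 z + F3 z) / (NN * real p * v\<^sup>2))" using iF iF2 iF3 by (intro integrable_divide) auto
    show "cmod (mt (KM z) - mt (BM z)) \<le> (F z + F2 z + F3 z) / (NN * real p * v\<^sup>2)" for z
      using KM_BM_diff[of z] unfolding F_def F2_def F3_def .
  qed
  also have "\<dots> = ((\<integral>z. F z \<partial>Om) + (\<integral>z. F2 z \<partial>Om) + (\<integral>z. F3 z \<partial>Om)) / (NN * real p * v\<^sup>2)"
    using iF iF2 iF3 by simp
  also have "\<dots> \<le> (real N * real N * (s * (2 * K1 + 3 * K2)) + real N * (C * real p)) / (NN * real p * v\<^sup>2)"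
    using bF bF2 bF3 NN by (intro divide_right_mono) (auto simp: algebra_simps)
  also have "\<dots> = (real N / (real N - 1)) * ((2 * K1 + 3 * K2) / s + C / real N) / v\<^sup>2"
    using N s v unfolding NN_def s(2)[symmetric] by (simp add: field_simps)
  also have "\<dots> \<le> 2 * ((2 * K1 + 3 * K2) / s + C / real N) / v\<^sup>2"
    using N s error_constants_nonneg C by (intro divide_right_mono mult_right_mono) (auto simp: field_simps)
  finally show ?thesis unfolding s_def by (simp add: algebra_simps)
qed

section \<open>The deterministic equivalent in expectation\<close>

text \<open>\<open>av\<close> is the expectation of the average of the leave-one-out factors
  \<open>1 / (1 + x\<^sub>i\<^sup>T H\<^sub>i x\<^sub>i / N)\<close>.\<close>
definition "EB = (\<integral>z. mt (BM z) \<partial>Om)"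
definition "av = 1 - of_nat p / of_nat N - w * (of_nat p / of_nat N) * EB"
definition "\<zeta> = cmod w / v"

lemma \<zeta>_nonneg: "\<zeta> \<ge> 0" using v by (simp add: \<zeta>_def)

lemma EB_bound: "cmod EB \<le> 1 / v"
proof -
  interpret prob_space Om by (rule prob_Om)
  have "cmod EB \<le> (\<integral>z. cmod (mt (BM z)) \<partial>Om)" unfolding EB_def by (rule integral_norm_bound)
  also have "\<dots> \<le> (\<integral>z. 1 / v \<partial>Om)" using mt_integrable by (intro integral_mono mt_bound psd_BM) auto
  finally show ?thesis by (simp add: prob_space)
qed

lemma av_bound: "cmod av \<le> 1 + real p / real N * (1 + \<zeta>)"
proof -
  have "cmod av \<le> cmod (1 - of_nat p / of_nat N) + cmod (w * (of_nat p / of_nat N) * EB)"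
    unfolding av_def by (rule norm_triangle_ineq4)
  also have "cmod (1 - of_nat p / of_nat N) \<le> 1 + real p / real N"
    using norm_triangle_ineq4[of 1 "of_nat p / of_nat N :: complex"] by (simp add: norm_divide)
  also have "cmod (w * (of_nat p / of_nat N) * EB) \<le> cmod w * (real p / real N) * (1 / v)"
    unfolding norm_mult using EB_bound by (intro mult_mono) (auto simp: norm_divide)
  finally show ?thesis by (simp add: \<zeta>_def algebra_simps)
qed

text \<open>By \<open>gram_resolvent_trace\<close> this is an average of inverses of numbers in the closed upper half
  plane. The sign is what makes the resolvent of \<open>av T\<close> well behaved.\<close>
lemma av_pointwise_Im: "Im (1 - of_nat p / of_nat N - w * (of_nat p / of_nat N) * mt (BM z)) \<le> 0"
proof -
  define q where "q i = qform (resolvent 1 (gram p ({..<N} - {i}) (\<lambda>_. 1 / real N) (X z)) w) (X z i)" for i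
  have psd: "psd_mat p (gram p ({..<N} - {i}) (\<lambda>_. 1 / real N) (X z))" for i by (rule psd_gram) auto
  have "of_nat p + w * ctrace (resolvent 1 (BM z) w) = (\<Sum>i<N. 1 - 1 / (1 + of_real (1 / real N) * q i))"
    unfolding q_def BM_def by (rule gram_resolvent_trace) (use w in auto)
  moreover define A where "A = (\<Sum>i<N. 1 / (1 + of_real (1 / real N) * q i))"
  ultimately have "of_nat p + w * (of_nat p * mt (BM z)) = of_nat N - A"
    using p by (simp add: mt_def sum_subtractf)
  hence A_eq: "A = of_nat N - of_nat p - w * (of_nat p * mt (BM z))" by (simp add: algebra_simps)
  have "1 - of_nat p / of_nat N - w * (of_nat p / of_nat N) * mt (BM z) = A / of_nat N"
    unfolding A_eq using N by (simp add: diff_divide_distrib)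
  moreover have "Im (1 / (1 + of_real (1 / real N) * q i)) \<le> 0" for i
  proof -
    have "Im (q i) \<ge> 0" unfolding q_def by (rule qform_resolvent_Im[OF psd w])
    hence "Im (1 + of_real (1 / real N) * q i) \<ge> 0" by simp
    moreover have "Im (1 / x) \<le> 0" if "Im x \<ge> 0" for x :: complex
      using that by (simp add: Im_divide)
    ultimately show ?thesis by blast
  qed
  hence "Im A \<le> 0" unfolding A_def Im_sum by (intro sum_nonpos) auto
  ultimately show ?thesis by (simp add: divide_nonpos_nonneg)
qed

lemma av_Im: "Im av \<le> 0"
proof -
  interpret prob_space Om by (rule prob_Om)
  let ?f = "\<lambda>z. 1 - of_nat p / of_nat N - w * (of_nat p / of_nat N) * mt (BM z)"
  have i: "integrable Om ?f" using mt_integrable by auto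
  have "(\<integral>z. ?f z \<partial>Om) = av" using mt_integrable by (simp add: av_def EB_def prob_space)
  hence "Im av = (\<integral>z. Im (?f z) \<partial>Om)" using integral_Im[OF i] by simp
  moreover have "0 \<le> (\<integral>z. - Im (?f z) \<partial>Om)" by (intro integral_nonneg_AE AE_I2) (simp only: neg_0_le_iff_le av_pointwise_Im)
  ultimately show ?thesis by simp
qed

text \<open>The pointwise bound is integrated term by term. All its errors are of order \<open>\<surd>p\<close> or smaller
  before division by \<open>p\<close>, except the deviation of \<open>mt (BM z)\<close> from its mean, for which \<open>L\<close> stands.\<close>
lemma deterministic_equivalent_expectation:
  fixes L :: real
  assumes L: "(\<integral>z. cmod (mt (BM z) - EB) \<partial>Om) \<le> L"
  shows "cmod (ctrace (resolvent av T w) / of_nat p - EB) \<le>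
    (\<zeta> * (sqrt (real p) * K3) + real p * (C / 2) / v\<^sup>2 * (2 * \<zeta>\<^sup>2 / real N * (sqrt (real p) * K4 + C / 2 * (C * real p / 2) / (v\<^sup>2 * real N))
       + cmod w * (real p / real N) * L) + (1 + real p / real N * (1 + \<zeta>)) * (C / 2) * (C * real p / 2) / (v ^ 3 * real N)) / real p"
proof -
  interpret prob_space Om by (rule prob_Om)
  let ?D = "resolvent av T w"
  define H where "H i z = resolvent 1 (gram p ({..<N} - {i}) (\<lambda>_. 1 / real N) (X z)) w" for i z
  define \<rho> where "\<rho> z = (\<Sum>i<N. nsq (X z i)) / real N" for z
  define \<delta> where "\<delta> z = (\<Sum>i<N. cmod (qform (H i z) (X z i) - ctrace (TC * H i z))) / real N" for z
  define \<eta> where "\<eta> z = (\<Sum>i<N. cmod (qform (H i z * ?D) (X z i) - ctrace (TC * (H i z * ?D)))) / real N" for z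
  define \<gamma> where "\<gamma> z = cmod (mt (BM z) - EB)" for z
  have psdi: "psd_mat p (gram p ({..<N} - {i}) (\<lambda>_. 1 / real N) (X z))" for i z by (rule psd_gram) auto
  have i1: "Im (1::complex) \<le> 0" by simp
  have Hc: "H i z \<in> carrier_mat p p" and Hop: "op_bound (H i z) (1 / v)" for i z
    unfolding H_def v_def by (rule resolvent_inverse[OF psdi i1 w])+
  have Dc: "?D \<in> carrier_mat p p" and Dop: "op_bound ?D (1 / v)"
    unfolding v_def by (rule resolvent_inverse[OF psd_T av_Im w])+
  have Hinv: "H i (z(i := y)) = H i z" for i z y
    unfolding H_def gram_def by (intro arg_cong2[of _ _ _ _ "resolvent 1"] cong_mat refl) (auto simp: X_def intro!: sum.cong)
  have Hm: "(\<lambda>z. H i z $$ (j, k)) \<in> borel_measurable Om" if "j < p" "k < p" for i j k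
    unfolding H_def by (rule gram_resolvent_measurable) (use that in auto)
  have HD: "H i z * ?D \<in> carrier_mat p p" for i z by (rule mult_carrier_mat[OF Hc Dc])
  have HDop: "op_bound (H i z * ?D) (1 / v\<^sup>2)" for i z
    using op_bound_mult[OF Hop Dop Hc Dc] by (simp add: power2_eq_square)
  have HDm: "(\<lambda>z. (H i z * ?D) $$ (j, k)) \<in> borel_measurable Om" if "j < p" "k < p" for i j k
    by (intro borel_measurable_mat_mult[of _ p] Hc Dc Hm that) auto
  have pt: "cmod (ctrace ?D / of_nat p - mt (BM z)) * real p \<le> 
      \<zeta> * \<eta> z + real p * (C / 2) / v\<^sup>2 * (2 * \<zeta>\<^sup>2 / real N * (\<delta> z + C / 2 * \<rho> z / (v\<^sup>2 * real N)) + cmod w * (real p / real N) * \<gamma> z)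
      + (1 + real p / real N * (1 + \<zeta>)) * (C / 2) * \<rho> z / (v ^ 3 * real N)" for z
  proof -
    have \<rho>0: "\<rho> z \<ge> 0" unfolding \<rho>_def by (intro divide_nonneg_nonneg sum_nonneg nsq_nonneg) auto
    have N0: "N > 0" using N by simp
    have "cmod (ctrace ?D - ctrace (resolvent 1 (BM z) w)) \<le> cmod w / Im w * \<eta> z + real p * (C / 2) / (Im w)\<^sup>2 *
      (2 * (cmod w / Im w)\<^sup>2 / real N * (\<delta> z + C / 2 * \<rho> z / ((Im w)\<^sup>2 * real N)) 
        + cmod (1 - of_nat p / of_nat N - w / of_nat N * ctrace (resolvent 1 (BM z) w) - av))
      + cmod av * (C / 2) * \<rho> z / ((Im w) ^ 3 * real N)"
      unfolding \<eta>_def \<delta>_def \<rho>_def nsq_def H_def BM_def TC_def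
      by (rule deterministic_equivalent_bound[OF N0 w av_Im T_def _ op_bound_TC[unfolded TC_def]]) simp
    moreover have "1 - of_nat p / of_nat N - w / of_nat N * ctrace (resolvent 1 (BM z) w) - av = w * (of_nat p / of_nat N) * (EB - mt (BM z))"
      using p N by (simp add: av_def mt_def field_simps)
    moreover have "cmod (w * (of_nat p / of_nat N) * (EB - mt (BM z))) = cmod w * (real p / real N) * \<gamma> z"
      by (simp add: norm_mult norm_divide \<gamma>_def norm_minus_commute)
    moreover have "cmod av * (C / 2) * \<rho> z / ((Im w) ^ 3 * real N) \<le> (1 + real p / real N * (1 + \<zeta>)) * (C / 2) * \<rho> z / (v ^ 3 * real N)"
      using av_bound C \<rho>0 v unfolding v_def by (intro divide_right_mono mult_right_mono) auto
    moreover have "cmod (ctrace ?D / of_nat p - mt (BM z)) * real p = cmod (ctrace ?D - ctrace (resolvent 1 (BM z) w))"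
      using p by (simp add: mt_def diff_divide_distrib[symmetric] norm_divide)
    ultimately show ?thesis by (simp add: \<zeta>_def v_def)
  qed
  have i\<rho>: "integrable Om \<rho>" and b\<rho>: "(\<integral>z. \<rho> z \<partial>Om) \<le> C * real p / 2"
  proof -
    show "integrable Om \<rho>" unfolding \<rho>_def by (intro integrable_divide Bochner_Integration.integrable_sum nsq_integral) auto
    have "(\<integral>z. \<rho> z \<partial>Om) = (\<Sum>i<N. \<integral>z. nsq (X z i) \<partial>Om) / real N"
      unfolding \<rho>_def by (simp add: nsq_integral Bochner_Integration.integral_sum)
    also have "\<dots> \<le> (\<Sum>i<N. C * real p / 2) / real N" by (intro divide_right_mono sum_mono nsq_integral) auto
    finally show "(\<integral>z. \<rho> z \<partial>Om) \<le> C * real p / 2" using N by simp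
  qed
  have i\<delta>: "integrable Om \<delta>" and b\<delta>: "(\<integral>z. \<delta> z \<partial>Om) \<le> sqrt (real p) * K4"
  proof -
    note qi = quadratic_integral[OF _ Hc Hop Hinv Hm]
    show "integrable Om \<delta>" unfolding \<delta>_def by (intro integrable_divide Bochner_Integration.integrable_sum qi) auto
    have "(\<integral>z. \<delta> z \<partial>Om) = (\<Sum>i<N. \<integral>z. cmod (qform (H i z) (X z i) - ctrace (TC * H i z)) \<partial>Om) / real N"
      unfolding \<delta>_def by (simp add: qi Bochner_Integration.integral_sum)
    also have "\<dots> \<le> (\<Sum>i<N. sqrt (real p) * K4) / real N" unfolding K4_def by (intro divide_right_mono sum_mono qi) auto
    finally show "(\<integral>z. \<delta> z \<partial>Om) \<le> sqrt (real p) * K4" using N by simp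
  qed
  have HDinv: "H i (z(i := y)) * ?D = H i z * ?D" for i z y by (simp add: Hinv)
  have i\<eta>: "integrable Om \<eta>" and b\<eta>: "(\<integral>z. \<eta> z \<partial>Om) \<le> sqrt (real p) * K3"
  proof -
    note qi = quadratic_integral[OF _ HD HDop HDinv HDm]
    show "integrable Om \<eta>" unfolding \<eta>_def by (intro integrable_divide Bochner_Integration.integrable_sum qi) auto
    have "(\<integral>z. \<eta> z \<partial>Om) = (\<Sum>i<N. \<integral>z. cmod (qform (H i z * ?D) (X z i) - ctrace (TC * (H i z * ?D))) \<partial>Om) / real N"
      unfolding \<eta>_def by (simp add: qi Bochner_Integration.integral_sum)
    also have "\<dots> \<le> (\<Sum>i<N. sqrt (real p) * K3) / real N" unfolding K3_def by (intro divide_right_mono sum_mono qi) auto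
    finally show "(\<integral>z. \<eta> z \<partial>Om) \<le> sqrt (real p) * K3" using N by simp
  qed
  have i\<gamma>: "integrable Om \<gamma>" unfolding \<gamma>_def using mt_integrable by auto
  have idiff: "integrable Om (\<lambda>z. cmod (ctrace ?D / of_nat p - mt (BM z)))" using mt_integrable by auto
  have "cmod (ctrace ?D / of_nat p - EB) = cmod (\<integral>z. ctrace ?D / of_nat p - mt (BM z) \<partial>Om)"
    using mt_integrable by (simp add: EB_def prob_space)
  also have "\<dots> \<le> (\<integral>z. cmod (ctrace ?D / of_nat p - mt (BM z)) \<partial>Om)" by (rule integral_norm_bound)
  finally have "cmod (ctrace ?D / of_nat p - EB) * real p \<le> (\<integral>z. cmod (ctrace ?D / of_nat p - mt (BM z)) * real p \<partial>Om)"
    using idiff by (simp add: mult_right_mono)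
  also have "\<dots> \<le> (\<integral>z. \<zeta> * \<eta> z + real p * (C / 2) / v\<^sup>2 * (2 * \<zeta>\<^sup>2 / real N * (\<delta> z + C / 2 * \<rho> z / (v\<^sup>2 * real N)) + cmod w * (real p / real N) * \<gamma> z)
      + (1 + real p / real N * (1 + \<zeta>)) * (C / 2) * \<rho> z / (v ^ 3 * real N) \<partial>Om)"
    using idiff i\<rho> i\<delta> i\<eta> i\<gamma> by (intro integral_mono pt) auto
  also have "\<dots> = \<zeta> * (\<integral>z. \<eta> z \<partial>Om) + real p * (C / 2) / v\<^sup>2 * (2 * \<zeta>\<^sup>2 / real N * ((\<integral>z. \<delta> z \<partial>Om) + C / 2 * (\<integral>z. \<rho> z \<partial>Om) / (v\<^sup>2 * real N)) + cmod w * (real p / real N) * (\<integral>z. \<gamma> z \<partial>Om))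
      + (1 + real p / real N * (1 + \<zeta>)) * (C / 2) * (\<integral>z. \<rho> z \<partial>Om) / (v ^ 3 * real N)"
    using i\<rho> i\<delta> i\<eta> i\<gamma> by simp
  also have "\<dots> \<le> \<zeta> * (sqrt (real p) * K3) + real p * (C / 2) / v\<^sup>2 * (2 * \<zeta>\<^sup>2 / real N * (sqrt (real p) * K4 + C / 2 * (C * real p / 2) / (v\<^sup>2 * real N))
       + cmod w * (real p / real N) * L) + (1 + real p / real N * (1 + \<zeta>)) * (C / 2) * (C * real p / 2) / (v ^ 3 * real N)"
    using C v \<zeta>_nonneg L by (intro add_mono mult_left_mono divide_right_mono b\<rho> b\<delta> b\<eta>) (auto simp: \<gamma>_def)
  finally show ?thesis using p by (simp add: pos_le_divide_eq)
qed

end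

section \<open>Stieltjes transforms and weak convergence\<close>

abbreviation cauchy_kernel :: "real \<Rightarrow> real \<Rightarrow> real" where
  "cauchy_kernel e x \<equiv> 1 / e * inverse (1 + (x / e)\<^sup>2)"

lemma integrable_inverse_one_plus_square: "integrable lborel (\<lambda>x::real. inverse (1 + x\<^sup>2))"
  and integral_inverse_one_plus_square: "(\<integral>x. inverse (1 + x\<^sup>2) \<partial>lborel) = pi"
proof -
  have e: "einterval (-\<infinity>) \<infinity> = UNIV" by (auto simp: einterval_def)
  show "integrable lborel (\<lambda>x::real. inverse (1 + x\<^sup>2))"
    using integrable_inverse_1_plus_square unfolding set_integrable_def e by simp
  show "(\<integral>x. inverse (1 + x\<^sup>2) \<partial>lborel) = pi"
    using LBINT_inverse_1_plus_square unfolding interval_lebesgue_integral_def set_lebesgue_integral_def e by simp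
qed

lemma integrable_cauchy_kernel: 
  assumes "e > 0" shows "integrable lborel (\<lambda>x. cauchy_kernel e (x - l))"
  using lborel_integrable_real_affine[OF integrable_inverse_one_plus_square, of "1 / e" "- l / e"] assms
  by (simp add: diff_divide_distrib)

lemma stieltjes_Im:
  assumes F: "real_distribution F" and e: "e > 0"
  shows "Im (stieltjes F (Complex x e)) = (\<integral>l. cauchy_kernel e (x - l) \<partial>F)"
    and "integrable F (\<lambda>l. 1 / (complex_of_real l - Complex x e))"
proof -
  interpret real_distribution F by (rule F)
  have nz: "cmod (1 / (complex_of_real l - Complex x e)) \<le> 1 / e" for l
  proof -
    have "e \<le> cmod (complex_of_real l - Complex x e)"
      using abs_Im_le_cmod[of "complex_of_real l - Complex x e"] e by simp
    thus ?thesis using e by (simp add: norm_divide frac_le)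
  qed
  show i: "integrable F (\<lambda>l. 1 / (complex_of_real l - Complex x e))"
    by (rule integrable_const_bound[of _ "1 / e"]) (use nz in auto)
  have "Im (1 / (complex_of_real l - Complex x e)) = cauchy_kernel e (x - l)" for l
    using e by (simp add: Im_divide power2_eq_square field_simps)
  thus "Im (stieltjes F (Complex x e)) = (\<integral>l. cauchy_kernel e (x - l) \<partial>F)"
    unfolding stieltjes_def using integral_Im[OF i] by simp
qed

text \<open>At height \<open>e\<close> above the real line, the imaginary part of the Stieltjes transform is the
  convolution of \<open>F\<close> with a Cauchy kernel of width \<open>e\<close>, so its Fourier transform factorises.\<close>
lemma stieltjes_fourier:
  assumes F: "real_distribution F" and e: "e > 0"
  shows "(\<integral>x. iexp (t * x) * of_real (Im (stieltjes F (Complex x e))) \<partial>lborel) =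
     char F t * (\<integral>x. iexp (t * (e * x)) * of_real (inverse (1 + x\<^sup>2)) \<partial>lborel)"
proof -
  interpret F: real_distribution F by (rule F)
  interpret P: pair_sigma_finite F lborel by standard
  let ?f = "\<lambda>l x. iexp (t * x) * complex_of_real (cauchy_kernel e (x - l))"
  have k0: "cauchy_kernel e x \<ge> 0" for x using e by auto
  have [measurable]: "(\<lambda>x. x) \<in> borel_measurable F" by (simp add: measurable_ident_sets)
  have m1[measurable]: "(\<lambda>p. fst p) \<in> borel_measurable (F \<Otimes>\<^sub>M lborel)"
    using measurable_compose[OF measurable_fst[of F lborel], of "\<lambda>x. x" borel] by simp
  have m2[measurable]: "(\<lambda>p. snd p) \<in> borel_measurable (F \<Otimes>\<^sub>M lborel)"
    using measurable_compose[OF measurable_snd[of F lborel], of "\<lambda>x. x" borel] by simp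
  have meas: "case_prod ?f \<in> borel_measurable (F \<Otimes>\<^sub>M lborel)"
    unfolding case_prod_unfold by measurable
  have shift: "(\<integral>x. g (x - l) \<partial>lborel) = (\<integral>x. g x \<partial>lborel)" for l and g :: "real \<Rightarrow> 'b::{banach, second_countable_topology}"
    using lborel_integral_real_affine[of 1 g "- l"] by simp
  have int_x: "integrable lborel (?f l)" for l
  proof (rule Bochner_Integration.integrable_bound[OF integrable_cauchy_kernel[OF e, of l]])
    show "AE x in lborel. norm (?f l x) \<le> norm (cauchy_kernel e (x - l))"
      by (rule AE_I2) (simp only: norm_mult norm_exp_i_times norm_of_real real_norm_def mult_1 order.refl)
  qed simp
  have int: "integrable (F \<Otimes>\<^sub>M lborel) (case_prod ?f)"
  proof (rule P.Fubini_integrable[OF meas])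
    have "(\<integral>x. norm (case_prod ?f (l, x)) \<partial>lborel) = (\<integral>x. cauchy_kernel e x \<partial>lborel)" for l
    proof -
      have "norm (case_prod ?f (l, x)) = cauchy_kernel e (x - l)" for x
        by (simp only: case_prod_conv norm_mult norm_exp_i_times norm_of_real mult_1 abs_of_nonneg[OF k0])
      thus ?thesis using shift[of "cauchy_kernel e" l] by simp
    qed
    thus "integrable F (\<lambda>l. \<integral>x. norm (case_prod ?f (l, x)) \<partial>lborel)" by simp
    show "AE l in F. integrable lborel (\<lambda>x. case_prod ?f (l, x))" using int_x by simp
  qed
  have "(\<integral>x. iexp (t * x) * of_real (Im (stieltjes F (Complex x e))) \<partial>lborel) = (\<integral>x. (\<integral>l. ?f l x \<partial>F) \<partial>lborel)"
    unfolding stieltjes_Im[OF F e] integral_complex_of_real[symmetric] by simp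
  also have "\<dots> = (\<integral>l. (\<integral>x. ?f l x \<partial>lborel) \<partial>F)" by (rule P.Fubini_integral[OF int])
  also have "\<dots> = (\<integral>l. iexp (t * l) * (\<integral>x. iexp (t * x) * complex_of_real (cauchy_kernel e x) \<partial>lborel) \<partial>F)"
  proof (intro Bochner_Integration.integral_cong refl)
    fix l
    have "(\<integral>x. ?f l x \<partial>lborel) = (\<integral>x. iexp (t * l) * (iexp (t * (x - l)) * complex_of_real (cauchy_kernel e (x - l))) \<partial>lborel)"
    proof (intro Bochner_Integration.integral_cong refl)
      fix x
      have "iexp (t * x) = iexp (t * l) * iexp (t * (x - l))"
        by (subst exp_add[symmetric]) (simp add: algebra_simps)
      thus "?f l x = iexp (t * l) * (iexp (t * (x - l)) * complex_of_real (cauchy_kernel e (x - l)))"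
        by (simp only: mult.assoc)
    qed
    also have "\<dots> = iexp (t * l) * (\<integral>x. iexp (t * (x - l)) * complex_of_real (cauchy_kernel e (x - l)) \<partial>lborel)"
      by simp
    also have "(\<integral>x. iexp (t * (x - l)) * complex_of_real (cauchy_kernel e (x - l)) \<partial>lborel) = (\<integral>x. iexp (t * x) * complex_of_real (cauchy_kernel e x) \<partial>lborel)"
      by (rule shift[of "\<lambda>x. iexp (t * x) * complex_of_real (cauchy_kernel e x)"])
    finally show "(\<integral>x. ?f l x \<partial>lborel) = iexp (t * l) * (\<integral>x. iexp (t * x) * complex_of_real (cauchy_kernel e x) \<partial>lborel)" .
  qed
  also have "\<dots> = char F t * (\<integral>x. iexp (t * x) * complex_of_real (cauchy_kernel e x) \<partial>lborel)"
    by (simp add: char_def)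
  also have "(\<integral>x. iexp (t * x) * complex_of_real (cauchy_kernel e x) \<partial>lborel) = (\<integral>x. iexp (t * (e * x)) * of_real (inverse (1 + x\<^sup>2)) \<partial>lborel)"
  proof -
    let ?g = "\<lambda>x. iexp (t * x) * complex_of_real (cauchy_kernel e x)"
    have "(\<integral>x. ?g x \<partial>lborel) = \<bar>e\<bar> *\<^sub>R (\<integral>x. ?g (0 + e * x) \<partial>lborel)"
      by (rule lborel_integral_real_affine) (use e in simp)
    also have "\<dots> = (\<integral>x. e *\<^sub>R ?g (0 + e * x) \<partial>lborel)"
      using e by (simp only: integral_scaleR_right abs_of_pos)
    also have "\<dots> = (\<integral>x. iexp (t * (e * x)) * of_real (inverse (1 + x\<^sup>2)) \<partial>lborel)"
    proof (intro Bochner_Integration.integral_cong refl)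
      fix x
      have "e * cauchy_kernel e (e * x) = inverse (1 + x\<^sup>2)" using e by simp
      hence "complex_of_real e * of_real (cauchy_kernel e (e * x)) = of_real (inverse (1 + x\<^sup>2))"
        by (simp only: of_real_mult[symmetric])
      thus "e *\<^sub>R ?g (0 + e * x) = iexp (t * (e * x)) * of_real (inverse (1 + x\<^sup>2))"
        unfolding scaleR_conv_of_real add_0 by (simp only: mult.left_commute[of "complex_of_real e"])
    qed
    finally show ?thesis .
  qed
  finally show ?thesis .
qed

text \<open>As \<open>e\<close> tends to zero the second factor in \<open>stieltjes_fourier\<close> tends to \<open>pi\<close>, so for some \<open>e\<close>
  it is nonzero and can be cancelled. This determines the characteristic function.\<close>
theorem stieltjes_unique:
  assumes F: "real_distribution F" and G: "real_distribution G"
    and eq: "\<And>z. Im z > 0 \<Longrightarrow> stieltjes F z = stieltjes G z"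
  shows "F = G"
proof (rule Levy_uniqueness[OF F G], rule ext)
  fix t
  let ?c = "\<lambda>e. \<integral>x. iexp (t * (e * x)) * of_real (inverse (1 + x\<^sup>2)) \<partial>lborel"
  have "(\<lambda>n. ?c (1 / real (Suc n))) \<longlonglongrightarrow> (\<integral>x. of_real (inverse (1 + x\<^sup>2)) \<partial>lborel)"
  proof (rule integral_dominated_convergence)
    show "integrable lborel (\<lambda>x::real. inverse (1 + x\<^sup>2))" by (rule integrable_inverse_one_plus_square)
    show "AE x in lborel. norm (iexp (t * (1 / real (Suc n) * x)) * complex_of_real (inverse (1 + x\<^sup>2))) \<le> inverse (1 + x\<^sup>2)" for n
      by (simp add: norm_mult norm_exp_i_times del: of_real_inverse)
    show "AE x in lborel. (\<lambda>n. iexp (t * (1 / real (Suc n) * x)) * complex_of_real (inverse (1 + x\<^sup>2))) \<longlonglongrightarrow> complex_of_real (inverse (1 + x\<^sup>2))"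
    proof (rule AE_I2)
      fix x :: real
      have "(\<lambda>n. t * (1 / real (Suc n) * x)) \<longlonglongrightarrow> t * (0 * x)"
        by (intro tendsto_intros LIMSEQ_Suc[OF lim_1_over_n])
      hence "(\<lambda>n. iexp (t * (1 / real (Suc n) * x)) * complex_of_real (inverse (1 + x\<^sup>2))) \<longlonglongrightarrow> iexp (t * (0 * x)) * complex_of_real (inverse (1 + x\<^sup>2))"
        by (rule tendsto_mult[OF tendsto_exp[OF tendsto_mult[OF tendsto_const tendsto_of_real]] tendsto_const])
      thus "(\<lambda>n. iexp (t * (1 / real (Suc n) * x)) * complex_of_real (inverse (1 + x\<^sup>2))) \<longlonglongrightarrow> complex_of_real (inverse (1 + x\<^sup>2))" by simp
    qed
  qed measurable
  moreover have "(\<integral>x. complex_of_real (inverse (1 + x\<^sup>2)) \<partial>lborel) \<noteq> 0"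
    using integral_inverse_one_plus_square by (simp only: integral_complex_of_real) simp
  ultimately have "\<forall>\<^sub>F n in sequentially. ?c (1 / real (Suc n)) \<noteq> 0" by (rule tendsto_imp_eventually_ne)
  then obtain n where n: "?c (1 / real (Suc n)) \<noteq> 0" using eventually_happens'[OF sequentially_bot] by blast
  have e: "1 / real (Suc n) > 0" by simp
  have "char F t * ?c (1 / real (Suc n)) = char G t * ?c (1 / real (Suc n))"
    unfolding stieltjes_fourier[OF F e, symmetric] stieltjes_fourier[OF G e, symmetric] using e by (simp add: eq)
  thus "char F t = char G t" using n by simp
qed

lemma stieltjes_lipschitz:
  assumes F: "real_distribution F" and z: "Im z > 0" and w: "Im w > 0"
  shows "cmod (stieltjes F z - stieltjes F w) \<le> cmod (z - w) / (Im z * Im w)"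
proof -
  interpret real_distribution F by (rule F)
  have iz: "integrable F (\<lambda>l. 1 / (complex_of_real l - z))" if "Im z > 0" for z
    using stieltjes_Im(2)[OF F that, of "Re z"] by simp
  have lb: "Im z \<le> cmod (complex_of_real l - z)" if "Im z > 0" for z l
    using abs_Im_le_cmod[of "complex_of_real l - z"] that by simp
  have "stieltjes F z - stieltjes F w = (\<integral>l. 1 / (complex_of_real l - z) - 1 / (complex_of_real l - w) \<partial>F)"
    unfolding stieltjes_def using iz z w by simp
  also have "cmod \<dots> \<le> (\<integral>l. cmod (1 / (complex_of_real l - z) - 1 / (complex_of_real l - w)) \<partial>F)" by (rule integral_norm_bound)
  also have "\<dots> \<le> (\<integral>l. cmod (z - w) / (Im z * Im w) \<partial>F)"
  proof (intro integral_mono)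
    fix l
    have "complex_of_real l - z \<noteq> 0" "complex_of_real l - w \<noteq> 0" using lb[OF z, of l] lb[OF w, of l] z w by auto
    hence "1 / (complex_of_real l - z) - 1 / (complex_of_real l - w) = (z - w) / ((complex_of_real l - z) * (complex_of_real l - w))"
      by (simp add: field_simps)
    hence "cmod (1 / (complex_of_real l - z) - 1 / (complex_of_real l - w)) = cmod (z - w) / (cmod (complex_of_real l - z) * cmod (complex_of_real l - w))"
      by (simp add: norm_divide norm_mult)
    also have "\<dots> \<le> cmod (z - w) / (Im z * Im w)"
      using z w by (intro divide_left_mono mult_mono lb) (auto intro!: mult_pos_pos less_le_trans[OF _ lb])
    finally show "cmod (1 / (complex_of_real l - z) - 1 / (complex_of_real l - w)) \<le> cmod (z - w) / (Im z * Im w)" .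
  qed (use iz z w in auto)
  finally show ?thesis using prob_space by simp
qed

text \<open>A countable dense set of points, so that almost sure statements can be intersected over it.\<close>
definition rational_upper :: "complex set" where
  "rational_upper = (\<lambda>(x, y). Complex x y) ` (\<rat> \<times> {y \<in> \<rat>. y > 0})"

lemma countable_rational_upper: "countable rational_upper"
  unfolding rational_upper_def by (intro countable_image countable_SIGMA countable_rat countable_subset[OF _ countable_rat]) auto

lemma rational_upper_Im: "z \<in> rational_upper \<Longrightarrow> Im z > 0"
  by (auto simp: rational_upper_def)

lemma stieltjes_unique_rational:
  assumes F: "real_distribution F" and G: "real_distribution G"
    and eq: "\<And>z. z \<in> rational_upper \<Longrightarrow> stieltjes F z = stieltjes G z"
  shows "F = G"
proof (rule stieltjes_unique[OF F G], rule ccontr)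
  fix z :: complex assume z: "Im z > 0" and ne: "stieltjes F z \<noteq> stieltjes G z"
  define e where "e = cmod (stieltjes F z - stieltjes G z)"
  \<comment> \<open>A rational point within \<open>2 \<delta>\<close> of \<open>z\<close> changes each transform by less than \<open>e / 4\<close>.\<close>
  define \<delta> where "\<delta> = e * (Im z)\<^sup>2 / 8"
  have e: "e > 0" using ne by (simp add: e_def)
  have \<delta>: "\<delta> > 0" using e z by (simp add: \<delta>_def)
  obtain q where q: "q \<in> \<rat>" "Re z < q" "q < Re z + \<delta>" using Rats_dense_in_real[of "Re z" "Re z + \<delta>"] \<delta> by auto
  obtain r where r: "r \<in> \<rat>" "Im z < r" "r < Im z + \<delta>" using Rats_dense_in_real[of "Im z" "Im z + \<delta>"] \<delta> by auto
  let ?w = "Complex q r"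
  have w: "?w \<in> rational_upper" using q r z by (auto simp: rational_upper_def)
  have "cmod (z - ?w) \<le> \<bar>Re (z - ?w)\<bar> + \<bar>Im (z - ?w)\<bar>" by (rule cmod_le)
  also have "\<dots> < 2 * \<delta>" using q r by simp
  finally have d: "cmod (z - ?w) < 2 * \<delta>" .
  have near: "cmod (stieltjes K z - stieltjes K ?w) < 2 * \<delta> / (Im z)\<^sup>2" if K: "real_distribution K" for K
  proof -
    have "cmod (stieltjes K z - stieltjes K ?w) \<le> cmod (z - ?w) / (Im z * r)" using stieltjes_lipschitz[OF K z, of ?w] r z by simp
    also have "\<dots> \<le> cmod (z - ?w) / (Im z * Im z)" using r z by (intro divide_left_mono mult_left_mono) auto
    also have "\<dots> < 2 * \<delta> / (Im z * Im z)" using d z by (intro divide_strict_right_mono) auto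
    finally show ?thesis by (simp add: power2_eq_square)
  qed
  have "e = cmod ((stieltjes F z - stieltjes F ?w) - (stieltjes G z - stieltjes G ?w))" unfolding e_def using eq[OF w] by simp
  also have "\<dots> \<le> cmod (stieltjes F z - stieltjes F ?w) + cmod (stieltjes G z - stieltjes G ?w)" by (rule norm_triangle_ineq4)
  also have "\<dots> < 2 * \<delta> / (Im z)\<^sup>2 + 2 * \<delta> / (Im z)\<^sup>2" by (intro add_strict_mono near F G)
  also have "\<dots> = e / 2" using z by (simp add: \<delta>_def field_simps)
  finally show False using e by simp
qed

lemma weak_conv_stieltjes:
  assumes "\<And>n. real_distribution (\<mu> n)" "real_distribution F" "weak_conv_m \<mu> F" and z: "Im z > 0"
  shows "(\<lambda>n. stieltjes (\<mu> n) z) \<longlonglongrightarrow> stieltjes F z"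
  unfolding stieltjes_def
proof (rule weak_conv_imp_integral_bdd_continuous_conv[OF assms(1-3)])
  have lb: "Im z \<le> cmod (complex_of_real l - z)" for l
    using abs_Im_le_cmod[of "complex_of_real l - z"] z by simp
  thus "cmod (1 / (complex_of_real l - z)) \<le> 1 / Im z" for l using z by (simp add: norm_divide frac_le)
  have "complex_of_real l - z \<noteq> 0" for l using lb[of l] z by auto
  thus "isCont (\<lambda>l. 1 / (complex_of_real l - z)) x" for x by (intro continuous_intros) auto
qed

text \<open>By tightness every subsequence has a weakly convergent subsequence, and the transforms at
  the countably many points identify its limit.\<close>
theorem stieltjes_continuity:
  assumes \<mu>: "tight \<mu>" and s: "\<And>z. z \<in> rational_upper \<Longrightarrow> (\<lambda>n. stieltjes (\<mu> n) z) \<longlonglongrightarrow> s z"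
  shows "\<exists>F. real_distribution F \<and> weak_conv_m \<mu> F"
    and "real_distribution F \<Longrightarrow> (\<And>z. z \<in> rational_upper \<Longrightarrow> stieltjes F z = s z) \<Longrightarrow> weak_conv_m \<mu> F"
proof -
  have rd: "real_distribution (\<mu> n)" for n using \<mu> by (simp add: tight_def)
  have main: "weak_conv_m \<mu> F" if F: "real_distribution F" and Fs: "\<And>z. z \<in> rational_upper \<Longrightarrow> stieltjes F z = s z" for F
  proof (rule tight_subseq_weak_converge[OF rd F \<mu>])
    fix r :: "nat \<Rightarrow> nat" and \<nu> assume r: "strict_mono r" and \<nu>: "real_distribution \<nu>" and wc: "weak_conv_m (\<mu> \<circ> r) \<nu>"
    have "\<nu> = F"
    proof (rule stieltjes_unique_rational[OF \<nu> F])
      fix z assume z: "z \<in> rational_upper"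
      have "(\<lambda>n. stieltjes ((\<mu> \<circ> r) n) z) \<longlonglongrightarrow> stieltjes \<nu> z"
        by (intro weak_conv_stieltjes \<nu> wc rational_upper_Im z) (simp add: rd)
      moreover have "(\<lambda>n. stieltjes ((\<mu> \<circ> r) n) z) \<longlonglongrightarrow> s z"
        using LIMSEQ_subseq_LIMSEQ[OF s[OF z] r] by (simp add: o_def)
      ultimately show "stieltjes \<nu> z = stieltjes F z" using LIMSEQ_unique Fs[OF z] by metis
    qed
    thus "weak_conv_m (\<mu> \<circ> r) F" using wc by simp
  qed
  thus "real_distribution F \<Longrightarrow> (\<And>z. z \<in> rational_upper \<Longrightarrow> stieltjes F z = s z) \<Longrightarrow> weak_conv_m \<mu> F" .
  obtain r F where r: "strict_mono (r :: nat \<Rightarrow> nat)" and F: "real_distribution F" and wc: "weak_conv_m (\<mu> \<circ> id \<circ> r) F"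
    using tight_imp_convergent_subsubsequence[OF \<mu>, of id] strict_mono_id by auto
  have "stieltjes F z = s z" if z: "z \<in> rational_upper" for z
  proof -
    have "(\<lambda>n. stieltjes ((\<mu> \<circ> id \<circ> r) n) z) \<longlonglongrightarrow> stieltjes F z"
      by (intro weak_conv_stieltjes F wc rational_upper_Im z) (simp add: rd)
    moreover have "(\<lambda>n. stieltjes ((\<mu> \<circ> id \<circ> r) n) z) \<longlonglongrightarrow> s z"
      using LIMSEQ_subseq_LIMSEQ[OF s[OF z] r] by (simp add: o_def)
    ultimately show ?thesis using LIMSEQ_unique by metis
  qed
  thus "\<exists>F. real_distribution F \<and> weak_conv_m \<mu> F" using main F by blast
qed

section \<open>The spectral distribution as a measure\<close>

text \<open>The uniform distribution on the eigenvalues. The tail estimate is Markov's inequality for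
  the sum of the non-negative eigenvalues; it yields tightness.\<close>
lemma esd_measure:
  assumes A: "psd_mat n A" and n: "n > 0"
  obtains \<mu> where "real_distribution \<mu>" "cdf \<mu> = esd A"
    "\<And>a z. Im a \<le> 0 \<Longrightarrow> Im z > 0 \<Longrightarrow> (\<integral>t. 1 / (a * of_real t - z) \<partial>\<mu>) = ctrace (resolvent a A z) / of_nat n"
    "\<And>b. b > 0 \<Longrightarrow> measure \<mu> {-1<..b} \<ge> 1 - mat_trace A / (real n * b)"
    "\<And>C. (\<And>u. (\<Sum>i<n. \<Sum>j<n. A $$ (i, j) * (u i * u j)) \<le> C * (\<Sum>i<n. (u i)\<^sup>2)) \<Longrightarrow> AE t in \<mu>. 0 \<le> t \<and> t \<le> C"
proof -
  obtain l where l: "\<And>i. i < n \<Longrightarrow> 0 \<le> l i"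
    "\<And>x. esd A x = real (card {i. i < n \<and> l i \<le> x}) / real n"
    "mat_trace A = (\<Sum>i<n. l i)"
    "\<And>a z. Im a \<le> 0 \<Longrightarrow> Im z > 0 \<Longrightarrow> ctrace (resolvent a A z) = (\<Sum>i<n. 1 / (a * of_real (l i) - z))"
    "\<And>C i. (\<And>u. (\<Sum>i<n. \<Sum>j<n. A $$ (i, j) * (u i * u j)) \<le> C * (\<Sum>i<n. (u i)\<^sup>2)) \<Longrightarrow> i < n \<Longrightarrow> l i \<le> C"
    using psd_mat_eigenvalues[OF A] by blast
  define P where "P = pmf_of_set {..<n}"
  have ne: "{..<n} \<noteq> {}" using n by auto
  have set: "set_pmf P = {..<n}" unfolding P_def using ne by simp
  have lm: "l \<in> measurable (measure_pmf P) borel" by simp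
  define \<mu> where "\<mu> = distr (measure_pmf P) borel l"
  have rd: "real_distribution \<mu>" unfolding \<mu>_def by (intro prob_space.real_distribution_distr[OF measure_pmf.prob_space_axioms]) simp
  have meas: "measure \<mu> B = real (card {i. i < n \<and> l i \<in> B}) / real n" if "B \<in> sets borel" for B
  proof -
    have "{..<n} \<inter> l -` B = {i. i < n \<and> l i \<in> B}" by auto
    thus ?thesis using that ne unfolding \<mu>_def P_def by (simp add: measure_distr measure_pmf_of_set)
  qed
  have cdf: "cdf \<mu> = esd A"
    by (rule ext) (simp add: cdf_def meas l(2))
  have st: "(\<integral>t. 1 / (a * of_real t - z) \<partial>\<mu>) = ctrace (resolvent a A z) / of_nat n" if "Im a \<le> 0" "Im z > 0" for a z
  proof -
    have "(\<integral>t. 1 / (a * of_real t - z) \<partial>\<mu>) = measure_pmf.expectation P (\<lambda>i. 1 / (a * of_real (l i) - z))"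
      unfolding \<mu>_def by (rule integral_distr) auto
    also have "\<dots> = (\<Sum>i<n. 1 / (a * of_real (l i) - z)) / of_nat n"
      unfolding P_def using ne by (subst integral_measure_pmf[of "{..<n}"]) (auto simp: scaleR_conv_of_real sum_divide_distrib mult.commute)
    finally show ?thesis using l(4)[OF that] by simp
  qed
  have tail: "measure \<mu> {-1<..b} \<ge> 1 - mat_trace A / (real n * b)" if b: "b > 0" for b
  proof -
    let ?G = "{i. i < n \<and> l i \<in> {-1<..b}}" and ?B = "{i. i < n \<and> b < l i}"
    have "{..<n} = ?G \<union> ?B" using l(1) by force
    moreover have "card (?G \<union> ?B) = card ?G + card ?B" by (intro card_Un_disjoint) auto
    ultimately have c: "real n = real (card ?G) + real (card ?B)" by (metis card_lessThan of_nat_add)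
    have "b * real (card ?B) = (\<Sum>i\<in>?B. b)" by simp
    also have "\<dots> \<le> (\<Sum>i\<in>?B. l i)" by (intro sum_mono) auto
    also have "\<dots> \<le> (\<Sum>i<n. l i)" using l(1) by (intro sum_mono2) auto
    finally have "real (card ?B) \<le> mat_trace A / b" using b by (simp add: l(3) field_simps)
    hence "real (card ?B) / real n \<le> mat_trace A / b / real n" by (intro divide_right_mono) auto
    moreover have "measure \<mu> {-1<..b} = real (card ?G) / real n" by (rule meas) simp
    moreover have "real (card ?G) / real n + real (card ?B) / real n = 1"
      unfolding add_divide_distrib[symmetric] c[symmetric] using n by simp
    moreover have "mat_trace A / b / real n = mat_trace A / (real n * b)" by simp
    ultimately show ?thesis by linarith
  qed
  have supp: "AE t in \<mu>. 0 \<le> t \<and> t \<le> C" if "\<And>u. (\<Sum>i<n. \<Sum>j<n. A $$ (i, j) * (u i * u j)) \<le> C * (\<Sum>i<n. (u i)\<^sup>2)" for C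
    unfolding \<mu>_def using l(1) l(5)[OF that] set by (subst AE_distr_iff) (auto simp: AE_measure_pmf_iff)
  show ?thesis by (rule that[OF rd cdf st tail supp])
qed

section \<open>The limiting equation\<close>

lemma denominator_lower_bound:
  assumes "Im a \<le> 0" "t \<ge> 0"
  shows "Im z \<le> cmod (a * complex_of_real t - z)"
proof -
  have "Im a * t \<le> 0" using assms by (intro mult_nonpos_nonneg)
  thus ?thesis using abs_Im_le_cmod[of "a * complex_of_real t - z"] by simp
qed

lemma weak_limit_support:
  assumes \<nu>: "\<And>n. real_distribution (\<nu> n)" and H: "real_distribution H" and wc: "weak_conv_m \<nu> H"
    and supp: "\<And>n. AE t in \<nu> n. 0 \<le> t \<and> t \<le> (C::real)"
  shows "AE t in H. 0 \<le> t \<and> t \<le> C"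
proof -
  interpret H: real_distribution H by (rule H)
  define g :: "real \<Rightarrow> real" where "g t = min 1 (max 0 (t - C) + max 0 (- t))" for t
  have g0: "g t \<ge> 0" and g1: "norm (g t) \<le> 1" for t by (auto simp: g_def)
  have gc: "isCont g t" for t unfolding g_def by (intro continuous_intros)
  have gm: "g \<in> borel_measurable borel" unfolding g_def by measurable
  have "(\<lambda>n. integral\<^sup>L (\<nu> n) g) \<longlonglongrightarrow> integral\<^sup>L H g"
    by (rule weak_conv_imp_integral_bdd_continuous_conv[OF \<nu> H wc gc g1])
  moreover have "integral\<^sup>L (\<nu> n) g = 0" for n
  proof -
    have "AE t in \<nu> n. g t = 0" using supp[of n] by eventually_elim (auto simp: g_def)
    thus ?thesis by (rule integral_eq_zero_AE)
  qed
  ultimately have "integral\<^sup>L H g = 0" using LIMSEQ_unique[OF _ tendsto_const[of 0]] by simp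
  moreover have "integrable H g" by (rule H.integrable_const_bound[of _ 1]) (use g1 gm in auto)
  ultimately have "AE t in H. g t = 0" using g0 by (subst (asm) integral_nonneg_eq_0_iff_AE) auto
  thus ?thesis by eventually_elim (auto simp: g_def min_def max_def split: if_splits)
qed

lemma integrable_resolvent_kernel:
  assumes \<nu>: "real_distribution \<nu>" and supp: "AE t in \<nu>. 0 \<le> t \<and> t \<le> C" and z: "Im z > 0" and a: "Im a \<le> 0"
  shows "integrable \<nu> (\<lambda>t. 1 / (a * complex_of_real t - z))"
proof -
  interpret real_distribution \<nu> by (rule \<nu>)
  show ?thesis
  proof (rule integrable_const_bound[of _ "1 / Im z"])
    show "AE t in \<nu>. cmod (1 / (a * complex_of_real t - z)) \<le> 1 / Im z"
      using supp
    proof eventually_elim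
      case (elim t)
      thus ?case using denominator_lower_bound[OF a, of t z] z by (simp add: norm_divide frac_le)
    qed
  qed simp
qed

text \<open>Weak convergence handles the fixed coefficient \<open>l\<close>, and on the common support \<open>[0, C]\<close> the
  kernel is Lipschitz in the coefficient, uniformly in \<open>t\<close>.\<close>
lemma resolvent_kernel_limit:
  assumes \<nu>: "\<And>n. real_distribution (\<nu> n)" and H: "real_distribution H" and wc: "weak_conv_m \<nu> H"
    and supp: "\<And>n. AE t in \<nu> n. 0 \<le> t \<and> t \<le> C" and C: "C \<ge> 0" and z: "Im z > 0"
    and a: "a \<longlonglongrightarrow> l" and aI: "\<And>n. Im (a n) \<le> 0"
  shows "(\<lambda>n. \<integral>t. 1 / (a n * complex_of_real t - z) \<partial>\<nu> n) \<longlonglongrightarrow> (\<integral>t. 1 / (l * complex_of_real t - z) \<partial>H)" and "Im l \<le> 0"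
proof -
  show l: "Im l \<le> 0"
    by (rule LIMSEQ_le_const2[OF tendsto_Im[OF a]]) (use aI in auto)
  have suppH: "AE t in H. 0 \<le> t \<and> t \<le> C" by (rule weak_limit_support[OF \<nu> H wc supp])
  \<comment> \<open>For negative \<open>t\<close> the denominator may vanish; clamping to the support gives a bounded
    continuous function on the whole line.\<close>
  define cl where "cl t = max 0 (min C t)" for t :: real
  have cl: "0 \<le> cl t" for t using C by (auto simp: cl_def)
  let ?f = "\<lambda>t. 1 / (l * complex_of_real (cl t) - z)"
  have nz: "l * complex_of_real (cl t) - z \<noteq> 0" for t using denominator_lower_bound[OF l cl[of t], of z] z by auto
  have "(\<lambda>n. integral\<^sup>L (\<nu> n) ?f) \<longlonglongrightarrow> integral\<^sup>L H ?f"
  proof (rule weak_conv_imp_integral_bdd_continuous_conv[OF \<nu> H wc])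
    show "cmod (?f t) \<le> 1 / Im z" for t
      using denominator_lower_bound[OF l cl[of t], of z] z by (simp add: norm_divide frac_le)
    show "isCont ?f t" for t unfolding cl_def using nz[of t, unfolded cl_def] by (intro continuous_intros)
  qed
  moreover have e: "integral\<^sup>L K ?f = (\<integral>t. 1 / (l * complex_of_real t - z) \<partial>K)" if K: "real_distribution K" and s: "AE t in K. 0 \<le> t \<and> t \<le> C" for K
  proof -
    interpret K: real_distribution K by (rule K)
    show ?thesis
    proof (rule integral_cong_AE)
      show "AE t in K. ?f t = 1 / (l * complex_of_real t - z)" using s by eventually_elim (simp add: cl_def)
    qed (auto simp: cl_def)
  qed
  ultimately have lim: "(\<lambda>n. \<integral>t. 1 / (l * complex_of_real t - z) \<partial>\<nu> n) \<longlonglongrightarrow> (\<integral>t. 1 / (l * complex_of_real t - z) \<partial>H)"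
    using e[OF \<nu> supp] e[OF H suppH] by simp
  have close: "cmod ((\<integral>t. 1 / (a n * complex_of_real t - z) \<partial>\<nu> n) - (\<integral>t. 1 / (l * complex_of_real t - z) \<partial>\<nu> n)) \<le> cmod (a n - l) * (C / (Im z)\<^sup>2)" for n
  proof -
    interpret N: real_distribution "\<nu> n" by (rule \<nu>)
    note i = integrable_resolvent_kernel[OF \<nu> supp z aI, of n n] integrable_resolvent_kernel[OF \<nu> supp z l, of n]
    have "(\<integral>t. 1 / (a n * complex_of_real t - z) \<partial>\<nu> n) - (\<integral>t. 1 / (l * complex_of_real t - z) \<partial>\<nu> n) = (\<integral>t. 1 / (a n * complex_of_real t - z) - 1 / (l * complex_of_real t - z) \<partial>\<nu> n)"
      using i by simp
    also have "cmod \<dots> \<le> (\<integral>t. cmod (1 / (a n * complex_of_real t - z) - 1 / (l * complex_of_real t - z)) \<partial>\<nu> n)" by (rule integral_norm_bound)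
    also have "\<dots> \<le> (\<integral>t. cmod (a n - l) * (C / (Im z)\<^sup>2) \<partial>\<nu> n)"
    proof (rule integral_mono_AE)
      show "AE t in \<nu> n. cmod (1 / (a n * complex_of_real t - z) - 1 / (l * complex_of_real t - z)) \<le> cmod (a n - l) * (C / (Im z)\<^sup>2)"
        using supp[of n]
      proof eventually_elim
        case (elim t)
        have b: "Im z \<le> cmod (a n * complex_of_real t - z)" "Im z \<le> cmod (l * complex_of_real t - z)"
          using denominator_lower_bound[OF aI] denominator_lower_bound[OF l] elim by auto
        hence "a n * complex_of_real t - z \<noteq> 0" "l * complex_of_real t - z \<noteq> 0" using z by auto
        hence "1 / (a n * complex_of_real t - z) - 1 / (l * complex_of_real t - z) = (l - a n) * complex_of_real t / ((a n * complex_of_real t - z) * (l * complex_of_real t - z))"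
          by (simp add: field_simps)
        hence "cmod (1 / (a n * complex_of_real t - z) - 1 / (l * complex_of_real t - z)) = cmod (a n - l) * t / (cmod (a n * complex_of_real t - z) * cmod (l * complex_of_real t - z))"
          using elim by (simp add: norm_divide norm_mult norm_minus_commute)
        also have "\<dots> \<le> cmod (a n - l) * C / (Im z * Im z)"
          using z elim b by (intro frac_le mult_mono) auto
        finally show ?case by (simp add: power2_eq_square)
      qed
    qed (use i in auto)
    finally show ?thesis using N.prob_space by simp
  qed
  have "(\<lambda>n. cmod (a n - l) * (C / (Im z)\<^sup>2)) \<longlonglongrightarrow> 0 * (C / (Im z)\<^sup>2)"
    using a by (intro tendsto_intros) (simp add: tendsto_norm_zero LIM_zero)
  hence g0: "(\<lambda>n. cmod (a n - l) * (C / (Im z)\<^sup>2)) \<longlonglongrightarrow> 0" by simp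
  have "(\<lambda>n. (\<integral>t. 1 / (a n * complex_of_real t - z) \<partial>\<nu> n) - (\<integral>t. 1 / (l * complex_of_real t - z) \<partial>\<nu> n)) \<longlonglongrightarrow> 0"
    by (rule Lim_null_comparison[OF always_eventually[OF allI[OF close]] g0])
  from tendsto_add[OF this lim] show "(\<lambda>n. \<integral>t. 1 / (a n * complex_of_real t - z) \<partial>\<nu> n) \<longlonglongrightarrow> (\<integral>t. 1 / (l * complex_of_real t - z) \<partial>H)"
    by simp
qed

text \<open>Uniqueness for the limiting equation, written for the coefficient \<open>a = 1 - y - y z m\<close>
  instead of the transform \<open>m\<close>. In terms of \<open>Q\<close> the equation reads \<open>1 / a - 1 = y Q(a)\<close>, and \<open>J\<close>
  and \<open>K\<close> are the integrals from which the imaginary part of \<open>Q\<close> is composed.\<close>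
locale mp_equation = real_distribution H for H :: "real measure" +
  fixes C y :: real and z :: complex
  assumes supp: "AE t in H. 0 \<le> t \<and> t \<le> C" and y: "y > 0" and z: "Im z > 0"
begin

definition sol :: "complex \<Rightarrow> bool" where
  "sol a \<longleftrightarrow> Im a \<le> 0 \<and> a = 1 - of_real y - of_real y * z * (\<integral>t. 1 / (a * complex_of_real t - z) \<partial>H)"

definition "Q a = (\<integral>t. complex_of_real t / (a * complex_of_real t - z) \<partial>H)"
definition "J a = (\<integral>t. t / (cmod (a * complex_of_real t - z))\<^sup>2 \<partial>H)"
definition "K a = (\<integral>t. t\<^sup>2 / (cmod (a * complex_of_real t - z))\<^sup>2 \<partial>H)"

context
  fixes a :: complex assumes a: "Im a \<le> 0"
begin

lemma AE_denominator: "AE t in H. 0 \<le> t \<and> t \<le> C \<and> Im z \<le> cmod (a * complex_of_real t - z) \<and> a * complex_of_real t - z \<noteq> 0"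
  using supp
proof eventually_elim
  case (elim t)
  thus ?case using denominator_lower_bound[OF a, of t z] z by auto
qed

lemma int_Q: "integrable H (\<lambda>t. complex_of_real t / (a * complex_of_real t - z))"
proof (rule integrable_const_bound[of _ "C / Im z"])
  show "AE t in H. cmod (complex_of_real t / (a * complex_of_real t - z)) \<le> C / Im z"
    using AE_denominator by eventually_elim (use z in \<open>auto simp: norm_divide intro!: frac_le\<close>)
qed simp

lemma int_J: "integrable H (\<lambda>t. t / (cmod (a * complex_of_real t - z))\<^sup>2)"
proof (rule integrable_const_bound[of _ "C / (Im z)\<^sup>2"])
  show "AE t in H. norm (t / (cmod (a * complex_of_real t - z))\<^sup>2) \<le> C / (Im z)\<^sup>2"
    using AE_denominator by eventually_elim (use z in \<open>auto intro!: frac_le power_mono\<close>)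
qed simp

lemma int_K: "integrable H (\<lambda>t. t\<^sup>2 / (cmod (a * complex_of_real t - z))\<^sup>2)"
proof (rule integrable_const_bound[of _ "C\<^sup>2 / (Im z)\<^sup>2"])
  show "AE t in H. norm (t\<^sup>2 / (cmod (a * complex_of_real t - z))\<^sup>2) \<le> C\<^sup>2 / (Im z)\<^sup>2"
    using AE_denominator by eventually_elim (use z in \<open>auto intro!: frac_le power_mono\<close>)
qed simp

lemma Im_Q: "Im (Q a) = Im z * J a - Im a * K a"
proof -
  have "Im (Q a) = (\<integral>t. Im (complex_of_real t / (a * complex_of_real t - z)) \<partial>H)"
    unfolding Q_def using integral_Im[OF int_Q] by simp
  also have "\<dots> = (\<integral>t. Im z * (t / (cmod (a * complex_of_real t - z))\<^sup>2) - Im a * (t\<^sup>2 / (cmod (a * complex_of_real t - z))\<^sup>2) \<partial>H)"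
  proof (intro Bochner_Integration.integral_cong refl)
    fix t
    define d where "d = a * complex_of_real t - z"
    have "Im (complex_of_real t / d) = t * (- Im d) / (cmod d)\<^sup>2" by (simp add: Im_divide cmod_power2)
    moreover have "- Im d = Im z - Im a * t" by (simp add: d_def)
    moreover have "t * (Im z - Im a * t) / D = Im z * (t / D) - Im a * (t\<^sup>2 / D)" for D
      by (simp add: power2_eq_square diff_divide_distrib right_diff_distrib mult_ac)
    ultimately show "Im (complex_of_real t / (a * complex_of_real t - z)) =
        Im z * (t / (cmod (a * complex_of_real t - z))\<^sup>2) - Im a * (t\<^sup>2 / (cmod (a * complex_of_real t - z))\<^sup>2)"
      unfolding d_def by (simp only:)
  qed
  also have "\<dots> = Im z * J a - Im a * K a" unfolding J_def K_def
    by (subst Bochner_Integration.integral_diff[OF integrable_mult_right[OF int_J] integrable_mult_right[OF int_K]])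
       (simp only: integral_mult_right_zero)
  finally show ?thesis .
qed

lemma sol_Q: assumes "sol a" shows "1 - a = a * of_real y * Q a"
proof -
  note i = integrable_resolvent_kernel[OF real_distribution_axioms supp z a]
  have "a * Q a = (\<integral>t. a * (complex_of_real t / (a * complex_of_real t - z)) \<partial>H)"
    unfolding Q_def by (rule integral_mult_right_zero[symmetric])
  also have "\<dots> = (\<integral>t. 1 + z * (1 / (a * complex_of_real t - z)) \<partial>H)"
  proof (rule integral_cong_AE)
    show "AE t in H. a * (complex_of_real t / (a * complex_of_real t - z)) = 1 + z * (1 / (a * complex_of_real t - z))"
      using AE_denominator by eventually_elim (simp add: field_simps)
  qed auto
  also have "\<dots> = 1 + z * (\<integral>t. 1 / (a * complex_of_real t - z) \<partial>H)"
  proof -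
    have c1: "(\<integral>t. (1::complex) \<partial>H) = 1" using prob_space by simp
    have "(\<integral>t. 1 + z * (1 / (a * complex_of_real t - z)) \<partial>H) = (\<integral>t. 1 \<partial>H) + (\<integral>t. z * (1 / (a * complex_of_real t - z)) \<partial>H)"
      by (rule Bochner_Integration.integral_add[OF _ integrable_mult_right[OF i]]) simp
    thus ?thesis unfolding c1 integral_mult_right_zero .
  qed
  finally have "a * Q a = 1 + z * (\<integral>t. 1 / (a * complex_of_real t - z) \<partial>H)" .
  hence "a * of_real y * Q a = of_real y * (1 + z * (\<integral>t. 1 / (a * complex_of_real t - z) \<partial>H))" by (metis mult.assoc mult.left_commute)
  also have "\<dots> = 1 - a" using assms by (simp add: sol_def algebra_simps)
  finally show ?thesis by simp
qed

lemma J_nonneg: "J a \<ge> 0" 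
  unfolding J_def by (intro integral_nonneg_AE, use supp in eventually_elim) auto

lemma J_zero: "J a = 0 \<Longrightarrow> AE t in H. t = 0"
proof -
  assume "J a = 0"
  moreover have "AE t in H. 0 \<le> t / (cmod (a * complex_of_real t - z))\<^sup>2" using supp by eventually_elim auto
  ultimately have "AE t in H. t / (cmod (a * complex_of_real t - z))\<^sup>2 = 0"
    unfolding J_def using int_J by (subst (asm) integral_nonneg_eq_0_iff_AE) auto
  thus "AE t in H. t = 0" using AE_denominator by eventually_elim auto
qed

text \<open>Imaginary parts in \<open>1 / a - 1 = y Q(a)\<close> give
  \<open>- Im a (1 - y \<bar>a\<bar>\<^sup>2 K(a)) = y Im z \<bar>a\<bar>\<^sup>2 J(a) > 0\<close>, while \<open>Im a \<le> 0\<close>.\<close>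
lemma sol_contraction: 
  assumes s: "sol a" and J: "J a > 0" shows "y * (cmod a)\<^sup>2 * K a < 1"
proof -
  have a0: "a \<noteq> 0" using sol_Q[OF s] by auto
  hence "1 / a - 1 = of_real y * Q a" using sol_Q[OF s] by (simp add: field_simps)
  hence "Im (1 / a - 1) = Im (of_real y * Q a)" by simp
  hence "Im (1 / a) = y * (Im z * J a - Im a * K a)" using Im_Q by simp
  moreover have "Im (1 / a) = - Im a / (cmod a)\<^sup>2" by (simp add: Im_divide cmod_power2)
  ultimately have "- Im a = (cmod a)\<^sup>2 * (y * (Im z * J a - Im a * K a))" using a0 by (simp add: field_simps)
  hence e: "(- Im a) * (1 - y * (cmod a)\<^sup>2 * K a) = y * Im z * (cmod a)\<^sup>2 * J a" by (simp add: algebra_simps)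
  have pos: "y * Im z * (cmod a)\<^sup>2 * J a > 0" using y z a0 J by simp
  show ?thesis
  proof (rule ccontr)
    assume "\<not> ?thesis"
    hence "(- Im a) * (1 - y * (cmod a)\<^sup>2 * K a) \<le> 0" using a by (intro mult_nonneg_nonpos) auto
    thus False using e pos by linarith
  qed
qed

end

text \<open>Subtracting the equations of two distinct solutions and dividing by \<open>b - a\<close> gives
  \<open>1 = y a b \<integral> t\<^sup>2 / ((a t - z) (b t - z)) dH\<close>. By the inequality between geometric and arithmetic
  mean the modulus of the right-hand side is at most the mean of \<open>y \<bar>a\<bar>\<^sup>2 K(a)\<close> and \<open>y \<bar>b\<bar>\<^sup>2 K(b)\<close>,
  both less than one by \<open>sol_contraction\<close>.\<close>
lemma sol_unique:
  assumes s: "sol a" and s': "sol b"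
  shows "a = b"
proof (rule ccontr)
  assume ne: "a \<noteq> b"
  have aI: "Im a \<le> 0" and bI: "Im b \<le> 0" using s s' by (auto simp: sol_def)
  note qa = sol_Q[OF aI s] and qb = sol_Q[OF bI s']
  have a0: "a \<noteq> 0" and b0: "b \<noteq> 0" using qa qb by auto
  \<comment> \<open>The degenerate case of a point mass at zero, where \<open>Q\<close> vanishes and \<open>1\<close> is the only solution.\<close>
  have "AE t in H. t = 0" if "J a = 0 \<or> J b = 0" using J_zero[OF aI] J_zero[OF bI] that by blast
  moreover have "False" if t0: "AE t in H. t = 0"
  proof -
    have "Q c = 0" for c unfolding Q_def by (rule integral_eq_zero_AE) (use t0 in eventually_elim, auto)
    thus False using qa qb ne by simp
  qed
  ultimately have J: "J a > 0" "J b > 0" using J_nonneg[OF aI] J_nonneg[OF bI] by force+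
  let ?d = "\<lambda>a t. a * complex_of_real t - z"
  have intP: "integrable H (\<lambda>t. complex_of_real (t\<^sup>2) / (?d a t * ?d b t))"
  proof (rule integrable_const_bound[of _ "C\<^sup>2 / (Im z * Im z)"])
    show "AE t in H. cmod (complex_of_real (t\<^sup>2) / (?d a t * ?d b t)) \<le> C\<^sup>2 / (Im z * Im z)"
      using AE_denominator[OF aI] AE_denominator[OF bI]
      by eventually_elim (use z in \<open>auto simp: norm_divide norm_mult norm_power intro!: frac_le mult_mono power_mono\<close>)
  qed simp
  have "Q a - Q b = (\<integral>t. complex_of_real t / ?d a t - complex_of_real t / ?d b t \<partial>H)"
    unfolding Q_def using int_Q[OF aI] int_Q[OF bI] by simp
  also have "\<dots> = (\<integral>t. (b - a) * (complex_of_real (t\<^sup>2) / (?d a t * ?d b t)) \<partial>H)"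
  proof (rule integral_cong_AE)
    show "AE t in H. complex_of_real t / ?d a t - complex_of_real t / ?d b t = (b - a) * (complex_of_real (t\<^sup>2) / (?d a t * ?d b t))"
      using AE_denominator[OF aI] AE_denominator[OF bI]
    proof eventually_elim
      case (elim t)
      have "u / A - u / B = u * (B - A) / (A * B)" if "A \<noteq> 0" "B \<noteq> 0" for u A B :: complex
        using that by (simp add: field_simps)
      moreover have "?d b t - ?d a t = (b - a) * complex_of_real t" by (simp add: algebra_simps)
      ultimately have "complex_of_real t / ?d a t - complex_of_real t / ?d b t = complex_of_real t * ((b - a) * complex_of_real t) / (?d a t * ?d b t)"
        using elim by simp
      thus ?case by (simp add: power2_eq_square mult_ac)
    qed
  qed auto
  also have "\<dots> = (b - a) * (\<integral>t. complex_of_real (t\<^sup>2) / (?d a t * ?d b t) \<partial>H)" by (rule integral_mult_right_zero)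
  finally have QQ: "Q a - Q b = (b - a) * (\<integral>t. complex_of_real (t\<^sup>2) / (?d a t * ?d b t) \<partial>H)" .
  have "1 / a - 1 = of_real y * Q a" "1 / b - 1 = of_real y * Q b" using qa qb a0 b0 by (simp_all add: field_simps)
  hence "1 / a - 1 / b = of_real y * (Q a - Q b)" by (simp add: algebra_simps)
  moreover have "1 / a - 1 / b = (b - a) / (a * b)" using a0 b0 by (simp add: field_simps)
  ultimately have h1: "(b - a) / (a * b) = of_real y * ((b - a) * (\<integral>t. complex_of_real (t\<^sup>2) / (?d a t * ?d b t) \<partial>H))"
    unfolding QQ by simp
  have h2: "W / (a * b) = of_real y * (W * V) \<Longrightarrow> W \<noteq> 0 \<Longrightarrow> 1 = of_real y * (a * b) * V" for W V
    using a0 b0 by (simp add: field_simps)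
  have "1 = of_real y * (a * b) * (\<integral>t. complex_of_real (t\<^sup>2) / (?d a t * ?d b t) \<partial>H)"
    by (rule h2[OF h1]) (use ne in simp)
  hence "1 = cmod (of_real y * (a * b) * (\<integral>t. complex_of_real (t\<^sup>2) / (?d a t * ?d b t) \<partial>H))" by (metis norm_one)
  also have "\<dots> = y * (cmod a * cmod b) * cmod (\<integral>t. complex_of_real (t\<^sup>2) / (?d a t * ?d b t) \<partial>H)" using y by (simp add: norm_mult)
  also have "\<dots> \<le> y * (cmod a * cmod b) * (\<integral>t. cmod (complex_of_real (t\<^sup>2) / (?d a t * ?d b t)) \<partial>H)"
    using y by (intro mult_left_mono integral_norm_bound) auto
  also have "\<dots> = (\<integral>t. y * (cmod a * cmod b) * cmod (complex_of_real (t\<^sup>2) / (?d a t * ?d b t)) \<partial>H)" by simp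
  also have "\<dots> \<le> (\<integral>t. y / 2 * ((cmod a)\<^sup>2 * (t\<^sup>2 / (cmod (?d a t))\<^sup>2)) + y / 2 * ((cmod b)\<^sup>2 * (t\<^sup>2 / (cmod (?d b t))\<^sup>2)) \<partial>H)"
  proof (rule integral_mono)
    fix t
    define A where "A = cmod a * (\<bar>t\<bar> / cmod (?d a t))"
    define B where "B = cmod b * (\<bar>t\<bar> / cmod (?d b t))"
    have "2 * (A * B) \<le> A\<^sup>2 + B\<^sup>2" using zero_le_power2[of "A - B"] by (simp add: power2_eq_square algebra_simps)
    hence "y * (A * B) \<le> y * ((A\<^sup>2 + B\<^sup>2) / 2)" using y by (intro mult_left_mono) auto
    moreover have "y * (cmod a * cmod b) * cmod (complex_of_real (t\<^sup>2) / (?d a t * ?d b t)) = y * (A * B)"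
      by (simp add: A_def B_def norm_divide norm_mult norm_power power2_eq_square)
    moreover have "y * ((A\<^sup>2 + B\<^sup>2) / 2) = y / 2 * A\<^sup>2 + y / 2 * B\<^sup>2" by (simp add: add_divide_distrib distrib_left)
    moreover have "(cmod a)\<^sup>2 * (t\<^sup>2 / (cmod (?d a t))\<^sup>2) = A\<^sup>2" "(cmod b)\<^sup>2 * (t\<^sup>2 / (cmod (?d b t))\<^sup>2) = B\<^sup>2"
      by (simp_all add: A_def B_def power_mult_distrib power_divide)
    ultimately show "y * (cmod a * cmod b) * cmod (complex_of_real (t\<^sup>2) / (?d a t * ?d b t)) \<le> y / 2 * ((cmod a)\<^sup>2 * (t\<^sup>2 / (cmod (?d a t))\<^sup>2)) + y / 2 * ((cmod b)\<^sup>2 * (t\<^sup>2 / (cmod (?d b t))\<^sup>2))"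
      by (simp only:)
  qed (intro Bochner_Integration.integrable_add integrable_mult_right integrable_norm intP int_K aI bI)+
  also have "\<dots> = (y * (cmod a)\<^sup>2 * K a + y * (cmod b)\<^sup>2 * K b) / 2"
  proof -
    have "(\<integral>t. y / 2 * ((cmod a)\<^sup>2 * (t\<^sup>2 / (cmod (?d a t))\<^sup>2)) + y / 2 * ((cmod b)\<^sup>2 * (t\<^sup>2 / (cmod (?d b t))\<^sup>2)) \<partial>H) =
      (\<integral>t. y / 2 * ((cmod a)\<^sup>2 * (t\<^sup>2 / (cmod (?d a t))\<^sup>2)) \<partial>H) + (\<integral>t. y / 2 * ((cmod b)\<^sup>2 * (t\<^sup>2 / (cmod (?d b t))\<^sup>2)) \<partial>H)"
      by (intro Bochner_Integration.integral_add integrable_mult_right int_K aI bI)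
    also have "\<dots> = y / 2 * ((cmod a)\<^sup>2 * K a) + y / 2 * ((cmod b)\<^sup>2 * K b)"
      unfolding integral_mult_right_zero K_def ..
    finally show ?thesis by (simp add: add_divide_distrib mult_ac)
  qed
  also have "\<dots> < 1" using sol_contraction[OF aI s J(1)] sol_contraction[OF bI s' J(2)] by simp
  finally show False by simp
qed

end

text \<open>The coefficients \<open>a n\<close> stay in a compact disc, every limit point of them is a solution of
  the limiting equation, and there is only one.\<close>
theorem fixed_point_limit:
  fixes E :: "nat \<Rightarrow> complex" and r :: "nat \<Rightarrow> real"
  assumes \<nu>: "\<And>n. real_distribution (\<nu> n)" and H: "real_distribution H" and wc: "weak_conv_m \<nu> H"
    and \<nu>_supp: "\<And>n. AE t in \<nu> n. 0 \<le> t \<and> t \<le> C" and C: "C \<ge> 0" and z: "Im z > 0"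
    and r: "r \<longlonglongrightarrow> y" and y: "y > 0" and bdd: "\<And>n. cmod (E n) \<le> B"
  defines "a \<equiv> \<lambda>n. 1 - of_real (r n) - of_real (r n) * z * E n"
  assumes aI: "\<And>n. Im (a n) \<le> 0"
    and eqn: "(\<lambda>n. (\<integral>t. 1 / (a n * complex_of_real t - z) \<partial>\<nu> n) - E n) \<longlonglongrightarrow> 0"
  shows "\<exists>s. E \<longlonglongrightarrow> s \<and> s = (\<integral>t. 1 / (complex_of_real t * (1 - of_real y - of_real y * z * s) - z) \<partial>H)"
proof -
  have suppH: "AE t in H. 0 \<le> t \<and> t \<le> C" by (rule weak_limit_support[OF \<nu> H wc \<nu>_supp])
  interpret mp_equation H C y z
    using H suppH y z by (intro mp_equation.intro mp_equation_axioms.intro)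
  let ?m = "\<lambda>a. \<integral>t. 1 / (a * complex_of_real t - z) \<partial>H"
  obtain S where S: "\<And>n. \<bar>r n\<bar> \<le> S" using convergent_imp_Bseq[OF convergentI[OF r]] by (auto simp: Bseq_def)
  have B0: "B \<ge> 0" and S0: "S \<ge> 0" using order.trans[OF norm_ge_zero bdd[of 0]] order.trans[OF abs_ge_zero S[of 0]] by auto
  have a_cball: "a n \<in> cball 0 (1 + S + S * cmod z * B)" for n
  proof -
    have "cmod (a n) \<le> cmod (1 - of_real (r n)) + cmod (of_real (r n) * z * E n)" unfolding a_def by (rule norm_triangle_ineq4)
    also have "cmod (1 - of_real (r n)) \<le> 1 + S" using norm_triangle_ineq4[of 1 "complex_of_real (r n)"] S[of n] by simp
    also have "cmod (of_real (r n) * z * E n) \<le> S * cmod z * B"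
      unfolding norm_mult using S[of n] bdd[of n] S0 by (intro mult_mono) auto
    finally show ?thesis by simp
  qed
  have sub: "(\<lambda>n. E (q n)) \<longlonglongrightarrow> ?m l \<and> sol l" if q: "strict_mono q" and l: "(\<lambda>n. a (q n)) \<longlonglongrightarrow> l" for q l
  proof -
    have wq: "weak_conv_m (\<lambda>n. \<nu> (q n)) H"
      using wc LIMSEQ_subseq_LIMSEQ[OF _ q] unfolding weak_conv_m_def weak_conv_def o_def by blast
    note k = resolvent_kernel_limit[of "\<lambda>n. \<nu> (q n)" H C z "\<lambda>n. a (q n)" l, OF \<nu> H wq \<nu>_supp C z l aI]
    have "(\<lambda>n. (\<integral>t. 1 / (a (q n) * complex_of_real t - z) \<partial>\<nu> (q n)) - E (q n)) \<longlonglongrightarrow> 0"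
      using LIMSEQ_subseq_LIMSEQ[OF eqn q] by (simp add: o_def)
    from tendsto_diff[OF k(1) this] have E: "(\<lambda>n. E (q n)) \<longlonglongrightarrow> ?m l" by simp
    have "(\<lambda>n. r (q n)) \<longlonglongrightarrow> y" using LIMSEQ_subseq_LIMSEQ[OF r q] by (simp add: o_def)
    hence "(\<lambda>n. a (q n)) \<longlonglongrightarrow> 1 - of_real y - of_real y * z * ?m l"
      unfolding a_def by (intro tendsto_diff tendsto_mult tendsto_const tendsto_of_real E)
    hence "l = 1 - of_real y - of_real y * z * ?m l" using l LIMSEQ_unique by blast
    thus ?thesis using E k(2) by (simp add: sol_def)
  qed
  have sc: "seq_compact (cball (0::complex) (1 + S + S * cmod z * B))" by (intro compact_imp_seq_compact compact_cball)
  obtain l and q :: "nat \<Rightarrow> nat" where q: "strict_mono q" "(a \<circ> q) \<longlonglongrightarrow> l" using seq_compactE[OF sc] a_cball by blast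
  have l: "sol l" using sub[OF q(1)] q(2) by (simp add: o_def)
  have al: "a \<longlonglongrightarrow> l"
  proof (rule ccontr)
    assume "\<not> a \<longlonglongrightarrow> l"
    then obtain e where e: "e > 0" "\<not> (\<forall>\<^sub>F n in sequentially. dist (a n) l < e)" unfolding tendsto_iff by blast
    hence "\<exists>\<^sub>F n in sequentially. \<not> dist (a n) l < e" by (simp add: not_eventually)
    hence inf: "infinite {n. \<not> dist (a n) l < e}" by (simp add: cofinite_eq_sequentially[symmetric] frequently_cofinite)
    obtain q :: "nat \<Rightarrow> nat" where q: "strict_mono q" "\<And>n. q n \<in> {n. \<not> dist (a n) l < e}" using infinite_enumerate[OF inf] by auto
    have "(a \<circ> q) n \<in> cball 0 (1 + S + S * cmod z * B)" for n using a_cball by simp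
    then obtain l' and q' :: "nat \<Rightarrow> nat" where q': "strict_mono q'" "((a \<circ> q) \<circ> q') \<longlonglongrightarrow> l'"
      using seq_compactE[OF sc, of "a \<circ> q"] by blast
    have "sol l'" using sub[OF strict_mono_o[OF q(1) q'(1)]] q'(2) by (simp add: o_def)
    hence "l' = l" by (rule sol_unique[OF _ l])
    hence "\<forall>\<^sub>F n in sequentially. dist (((a \<circ> q) \<circ> q') n) l < e" using q'(2) e(1) by (auto dest: tendstoD)
    then obtain n where "dist (((a \<circ> q) \<circ> q') n) l < e" using eventually_happens'[OF sequentially_bot] by blast
    thus False using q(2)[of "q' n"] by simp
  qed
  have "E \<longlonglongrightarrow> ?m l" using sub[of "\<lambda>n. n" l] al by (simp add: strict_mono_def)
  moreover have "?m l = (\<integral>t. 1 / (complex_of_real t * (1 - of_real y - of_real y * z * ?m l) - z) \<partial>H)"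
  proof -
    have "1 - of_real y - of_real y * z * ?m l = l" using l by (simp add: sol_def)
    thus ?thesis by (simp only: mult.commute)
  qed
  ultimately show ?thesis by blast
qed

section \<open>Deviation estimates for the Kendall matrix\<close>

context sample_resolvent
begin

text \<open>The bounded differences inequality is for real functions; hence real and imaginary parts are
  treated separately.\<close>
lemma mt_KM_tail:
  assumes h: "h = Re \<or> h = Im" and \<epsilon>: "\<epsilon> > 0"
  shows "measure Om {z \<in> space Om. \<bar>h (mt (KM z)) - h (\<integral>z. mt (KM z) \<partial>Om)\<bar> \<ge> \<epsilon>} \<le> 2 * exp (- (\<epsilon>\<^sup>2 * v ^ 4 / (8 * C\<^sup>2)) * real N)"
proof -
  have hle: "\<bar>h u\<bar> \<le> cmod u" for u using h abs_Re_le_cmod abs_Im_le_cmod by auto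
  have hd: "h u - h u' = h (u - u')" for u u' using h by auto
  have hm: "(\<lambda>z. h (mt (KM z))) \<in> borel_measurable Om" using h KM_measurable by auto
  have hi: "(\<integral>z. h (mt (KM z)) \<partial>Om) = h (\<integral>z. mt (KM z) \<partial>Om)"
    using h integral_Re[OF mt_integrable(1)] integral_Im[OF mt_integrable(1)] by auto
  define c where "c = 2 * C / (v\<^sup>2 * real N)"
  have c: "c > 0" using C v N by (simp add: c_def)
  have "measure (PiM {..<N} (\<lambda>_. Pr)) {z \<in> space (PiM {..<N} (\<lambda>_. Pr)). \<bar>h (mt (KM z)) - (\<integral>z. h (mt (KM z)) \<partial>PiM {..<N} (\<lambda>_. Pr))\<bar> \<ge> \<epsilon>} \<le> 2 * exp (- \<epsilon>\<^sup>2 / (2 * c\<^sup>2 * real (card {..<N})))"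
  proof (rule bounded_differences_tail[OF prob_Pr _ _ c \<epsilon>])
    show "(\<lambda>z. h (mt (KM z))) \<in> borel_measurable (PiM {..<N} (\<lambda>_. Pr))" using hm by (simp add: Om_def)
    show "\<bar>h (mt (KM z))\<bar> \<le> 1 / v" for z using hle[of "mt (KM z)"] mt_bound[OF psd_KM[of z]] by linarith
    show "\<bar>h (mt (KM (z(i := y)))) - h (mt (KM z))\<bar> \<le> c" if "i \<in> {..<N}" for i z y
      unfolding hd c_def using order.trans[OF hle KM_bounded_difference[of i z y]] that by simp
  qed (use N in \<open>auto simp: lessThan_empty_iff\<close>)
  moreover have "- \<epsilon>\<^sup>2 / (2 * c\<^sup>2 * real (card {..<N})) = - (\<epsilon>\<^sup>2 * v ^ 4 / (8 * C\<^sup>2)) * real N"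
    using C v N by (simp add: c_def power_divide power_mult_distrib power2_eq_square power4_eq_xxxx field_simps)
  ultimately show ?thesis unfolding Om_def[symmetric] hi by simp
qed

lemma T_form: "(\<Sum>i<p. \<Sum>j<p. T $$ (i, j) * (u i * u j)) \<le> C / 2 * (\<Sum>i<p. (u i)\<^sup>2)"
proof -
  have "(\<Sum>i<p. \<Sum>j<p. T $$ (i, j) * (u i * u j)) = (\<Sum>i<p. \<Sum>j<p. \<Sum>k<p. 1 / 2 * ((R $$ (k, i) * u i) * (R $$ (k, j) * u j)))"
    by (intro sum.cong refl) (simp add: T_def gram_def sum_distrib_left sum_distrib_right mult_ac)
  also have "\<dots> = (\<Sum>i<p. \<Sum>k<p. \<Sum>j<p. 1 / 2 * ((R $$ (k, i) * u i) * (R $$ (k, j) * u j)))"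
    by (rule sum.cong[OF refl], rule sum.swap)
  also have "\<dots> = (\<Sum>k<p. \<Sum>i<p. \<Sum>j<p. 1 / 2 * ((R $$ (k, i) * u i) * (R $$ (k, j) * u j)))" by (rule sum.swap)
  also have "\<dots> = 1 / 2 * (\<Sum>k<p. (\<Sum>l<p. R $$ (k, l) * u l)\<^sup>2)"
    unfolding power2_eq_square sum_product by (simp add: sum_distrib_left)
  also have "\<dots> \<le> 1 / 2 * (C * (\<Sum>i<p. (u i)\<^sup>2))" by (intro mult_left_mono R_bound) auto
  finally show ?thesis by simp
qed

text \<open>Every summand has trace at most \<open>tS / (N (N - 1))\<close>; this will give tightness.\<close>
lemma KM_trace: "mat_trace (KM z) \<le> 2 * C * real p"
proof -
  have "mat_trace (KM z) = (\<Sum>i<p. \<Sum>s\<in>pairs. tS / (NN * nsq (d z s)) * (d z s i * d z s i))"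
    by (simp add: mat_trace_def KM_def gram_def)
  also have "\<dots> = (\<Sum>s\<in>pairs. \<Sum>i<p. tS / (NN * nsq (d z s)) * (d z s i * d z s i))" by (rule sum.swap)
  also have "\<dots> = (\<Sum>s\<in>pairs. tS / (NN * nsq (d z s)) * nsq (d z s))"
    by (intro sum.cong refl) (simp only: nsq_def sum_distrib_left power2_eq_square)
  also have "\<dots> \<le> (\<Sum>s\<in>pairs. tS / NN)" using tS_nonneg NN by (intro sum_mono) (auto simp: field_simps)
  also have "\<dots> = real (card pairs) * (tS / NN)" by simp
  also have "\<dots> \<le> (real N * real N) * (tS / NN)"
  proof (intro mult_right_mono)
    have "card pairs \<le> card ({..<N} \<times> {..<N})" by (intro card_mono) (auto simp: pairs_def)
    thus "real (card pairs) \<le> real N * real N" by (simp flip: of_nat_mult)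
  qed (use tS_nonneg NN in auto)
  also have "\<dots> = (real N / (real N - 1)) * tS" using N by (simp add: NN_def field_simps)
  also have "\<dots> \<le> 2 * tS" using N tS_nonneg by (intro mult_right_mono) (auto simp: field_simps)
  also have "\<dots> \<le> 2 * (C * real p)" using tS_le by simp
  finally show ?thesis by simp
qed

text \<open>Concentration is available for the Kendall matrix only, whose summands are bounded.
  Closeness in mean transfers it to the sample covariance matrix.\<close>
lemma mt_mean_deviation:
  assumes "(\<integral>z. cmod (mt (KM z) - mt (BM z)) \<partial>Om) \<le> D"
    and "(\<integral>z. cmod (mt (KM z) - (\<integral>z. mt (KM z) \<partial>Om)) \<partial>Om) \<le> V"
  shows "(\<integral>z. cmod (mt (BM z) - EB) \<partial>Om) \<le> 2 * D + V" and "cmod ((\<integral>z. mt (KM z) \<partial>Om) - EB) \<le> D"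
proof -
  interpret prob_space Om by (rule prob_Om)
  define EK where "EK = (\<integral>z. mt (KM z) \<partial>Om)"
  have "EK - EB = (\<integral>z. mt (KM z) - mt (BM z) \<partial>Om)" unfolding EK_def EB_def using mt_integrable by simp
  also have "cmod \<dots> \<le> (\<integral>z. cmod (mt (KM z) - mt (BM z)) \<partial>Om)" by (rule integral_norm_bound)
  finally show E: "cmod ((\<integral>z. mt (KM z) \<partial>Om) - EB) \<le> D" using assms(1) by (simp add: EK_def)
  have "(\<integral>z. cmod (mt (BM z) - EB) \<partial>Om) \<le> (\<integral>z. cmod (mt (KM z) - mt (BM z)) + cmod (mt (KM z) - EK) + cmod (EK - EB) \<partial>Om)"
  proof (intro integral_mono)
    fix z
    have "mt (BM z) - EB = (mt (KM z) - EK) + (EK - EB) - (mt (KM z) - mt (BM z))" by simp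
    also have "cmod \<dots> \<le> cmod ((mt (KM z) - EK) + (EK - EB)) + cmod (mt (KM z) - mt (BM z))" by (rule norm_triangle_ineq4)
    also have "cmod ((mt (KM z) - EK) + (EK - EB)) \<le> cmod (mt (KM z) - EK) + cmod (EK - EB)" by (rule norm_triangle_ineq)
    finally show "cmod (mt (BM z) - EB) \<le> cmod (mt (KM z) - mt (BM z)) + cmod (mt (KM z) - EK) + cmod (EK - EB)" by simp
  qed (use mt_integrable in auto)
  also have "\<dots> = (\<integral>z. cmod (mt (KM z) - mt (BM z)) \<partial>Om) + (\<integral>z. cmod (mt (KM z) - EK) \<partial>Om) + cmod (EK - EB)"
  proof -
    have "integrable Om (\<lambda>z. cmod (mt (KM z) - mt (BM z)))" "integrable Om (\<lambda>z. cmod (mt (KM z) - EK))"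
      using mt_integrable by auto
    thus ?thesis using prob_space by simp
  qed
  also have "\<dots> \<le> D + V + D" using assms E by (intro add_mono) (auto simp: EK_def)
  finally show "(\<integral>z. cmod (mt (BM z) - EB) \<partial>Om) \<le> 2 * D + V" by simp
qed

end

section \<open>Almost sure convergence\<close>

text \<open>A sequence of models on one probability space, described by the distribution of each sample
  \<open>W n\<close>; the Borel-Cantelli lemma copes with any dependence between the samples. The sample sizes
  are \<open>n + 2\<close> because pairs need two observations.\<close>
locale mp_model = prob_space M for M :: "'a measure" +
  fixes \<nu> :: "real measure" and p :: "nat \<Rightarrow> nat" and R :: "nat \<Rightarrow> real mat" and C y :: real
    and W :: "nat \<Rightarrow> 'a \<Rightarrow> nat \<Rightarrow> nat \<Rightarrow> real" and H :: "real measure"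
  assumes setting: "\<And>n. sample_setting \<nu> (p n) (n + 2) (R n) C"
    and ratio: "(\<lambda>n. real (p n) / real (n + 2)) \<longlonglongrightarrow> y" and y: "y > 0"
    and W: "\<And>n. W n \<in> measurable M (sample_setting.Om \<nu> (p n) (n + 2))"
    and W_distr: "\<And>n. distr M (sample_setting.Om \<nu> (p n) (n + 2)) (W n) = sample_setting.Om \<nu> (p n) (n + 2)"
    and H: "real_distribution H" 
    and H_limit: "weak_conv (\<lambda>n. esd (sample_setting.T (p n) (R n))) (cdf H)"
begin

definition "Om n = sample_setting.Om \<nu> (p n) (n + 2)"
definition "KM n z = sample_resolvent.KM (p n) (n + 2) (R n) z"
definition "mK w n z = sample_resolvent.mt (p n) w (KM n z)"
definition "eK w n = (\<integral>z. mK w n z \<partial>Om n)"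
definition "eB w n = sample_resolvent.EB \<nu> (p n) (n + 2) (R n) w"

lemma resolvent_setting: "Im w > 0 \<Longrightarrow> sample_resolvent \<nu> (p n) (n + 2) (R n) C w"
  using setting by (intro sample_resolvent.intro sample_resolvent_axioms.intro)

lemma C_pos: "C > 0" using sample_setting.C[OF setting[of 0]] .
lemma p_pos: "p n > 0" using sample_setting.p[OF setting[of n]] .

lemma KM_psd: "psd_mat (p n) (KM n z)"
  unfolding KM_def by (rule sample_resolvent.psd_KM[OF resolvent_setting[of \<i>]]) simp

lemma mK_measurable: "Im w > 0 \<Longrightarrow> mK w n \<in> borel_measurable (Om n)"
  using sample_resolvent.KM_measurable[OF resolvent_setting[of w n]] by (simp add: mK_def[abs_def] KM_def Om_def)

lemma mK_bound: "Im w > 0 \<Longrightarrow> cmod (mK w n z) \<le> 1 / Im w"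
  using sample_resolvent.mt_bound[OF resolvent_setting[of w n] KM_psd] sample_resolvent.v_def[OF resolvent_setting[of w n]]
  by (simp add: mK_def)

lemma eK_bound: "Im w > 0 \<Longrightarrow> cmod (eK w n) \<le> 1 / Im w"
proof -
  assume w: "Im w > 0"
  interpret O: prob_space "Om n" unfolding Om_def by (rule sample_setting.prob_Om[OF setting])
  have i: "integrable (Om n) (mK w n)" by (rule O.integrable_const_bound[of _ "1 / Im w"]) (use mK_measurable mK_bound w in auto)
  have "cmod (eK w n) \<le> (\<integral>z. cmod (mK w n z) \<partial>Om n)" unfolding eK_def by (rule integral_norm_bound)
  also have "\<dots> \<le> (\<integral>z. 1 / Im w \<partial>Om n)" using i w by (intro integral_mono mK_bound) auto
  finally show ?thesis using O.prob_space by simp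
qed

text \<open>The tail bounds are geometric in the sample size, hence summable, and the Borel-Cantelli
  lemma applies for each of countably many thresholds.\<close>
lemma concentration_AE:
  assumes w: "Im w > 0"
  shows "AE \<omega> in M. (\<lambda>n. mK w n (W n \<omega>) - eK w n) \<longlonglongrightarrow> 0"
proof -
  have *: "AE \<omega> in M. (\<lambda>n. h (mK w n (W n \<omega>)) - h (eK w n)) \<longlonglongrightarrow> 0" if h: "h = Re \<or> h = Im" for h :: "complex \<Rightarrow> real"
  proof -
    have hm: "h \<in> borel_measurable borel" using h by auto
    have "AE \<omega> in M. \<forall>\<^sub>F n in sequentially. \<bar>h (mK w n (W n \<omega>)) - h (eK w n)\<bar> < 1 / real (Suc k)" for k
    proof -
      define \<epsilon> where "\<epsilon> = 1 / real (Suc k)"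
      define \<kappa> where "\<kappa> = \<epsilon>\<^sup>2 * (Im w) ^ 4 / (8 * C\<^sup>2)"
      have \<epsilon>: "\<epsilon> > 0" by (simp add: \<epsilon>_def)
      have \<kappa>: "\<kappa> > 0" using \<epsilon> w C_pos by (simp add: \<kappa>_def)
      define B where "B n = {z \<in> space (Om n). \<bar>h (mK w n z) - h (eK w n)\<bar> \<ge> \<epsilon>}" for n
      define A where "A n = W n -` B n \<inter> space M" for n
      have Bm: "B n \<in> sets (Om n)" for n
        unfolding B_def using measurable_compose[OF mK_measurable[OF w] hm] by measurable
      have Wn: "W n \<in> measurable M (Om n)" for n using W by (simp add: Om_def)
      have Am: "A n \<in> sets M" for n unfolding A_def using Wn Bm by (rule measurable_sets)
      have "measure M (A n) \<le> 2 * exp (- \<kappa> * real (n + 2))" for n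
      proof -
        have "measure M (A n) = measure (distr M (Om n) (W n)) (B n)" unfolding A_def using Wn Bm by (simp add: measure_distr)
        also have "\<dots> = measure (Om n) (B n)" using W_distr by (simp add: Om_def)
        also have "\<dots> \<le> 2 * exp (- (\<epsilon>\<^sup>2 * sample_resolvent.v w ^ 4 / (8 * C\<^sup>2)) * real (n + 2))"
          using sample_resolvent.mt_KM_tail[OF resolvent_setting[OF w] h \<epsilon>, of n] unfolding B_def Om_def mK_def eK_def KM_def .
        finally show ?thesis unfolding \<kappa>_def sample_resolvent.v_def[OF resolvent_setting[OF w]] .
      qed
      moreover have "2 * exp (- \<kappa> * real (n + 2)) = 2 * exp (- \<kappa>) ^ (n + 2)" for n
        by (subst exp_of_nat_mult[symmetric]) (simp add: mult.commute)
      ultimately have le: "measure M (A n) \<le> 2 * exp (- \<kappa>) ^ (n + 2)" for n by metis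
      have "summable (\<lambda>n. 2 * exp (- \<kappa>) ^ (n + 2))"
        using \<kappa> by (intro summable_mult) (simp add: summable_iff_shift summable_geometric)
      hence "summable (\<lambda>n. measure M (A n))"
        by (rule summable_comparison_test'[of _ 0]) (use le in auto)
      hence "AE \<omega> in M. \<forall>\<^sub>F n in sequentially. \<omega> \<in> space M - A n"
        using Am by (intro borel_cantelli_AE1) (auto simp: emeasure_eq_measure)
      thus ?thesis
      proof (rule AE_mp, intro AE_I2 impI)
        fix \<omega> assume \<omega>: "\<omega> \<in> space M" and ev: "\<forall>\<^sub>F n in sequentially. \<omega> \<in> space M - A n"
        from ev show "\<forall>\<^sub>F n in sequentially. \<bar>h (mK w n (W n \<omega>)) - h (eK w n)\<bar> < 1 / real (Suc k)"
        proof eventually_elim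
          case (elim n)
          have "W n \<omega> \<in> space (Om n)" using measurable_space[OF Wn \<omega>] .
          thus ?case using elim \<omega> by (auto simp: A_def B_def \<epsilon>_def not_le)
        qed
      qed
    qed
    hence "AE \<omega> in M. \<forall>k. \<forall>\<^sub>F n in sequentially. \<bar>h (mK w n (W n \<omega>)) - h (eK w n)\<bar> < 1 / real (Suc k)"
      by (simp only: AE_all_countable) simp
    thus ?thesis
    proof eventually_elim
      case (elim \<omega>)
      show ?case
      proof (rule tendstoI)
        fix e :: real assume "e > 0"
        then obtain k where k: "1 / real (Suc k) < e" using nat_approx_posE by metis
        show "\<forall>\<^sub>F n in sequentially. dist (h (mK w n (W n \<omega>)) - h (eK w n)) 0 < e"
          using elim[rule_format, of k] by eventually_elim (use k in auto)
      qed
    qed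
  qed
  have "AE \<omega> in M. (\<lambda>n. Re (mK w n (W n \<omega>)) - Re (eK w n)) \<longlonglongrightarrow> 0" "AE \<omega> in M. (\<lambda>n. Im (mK w n (W n \<omega>)) - Im (eK w n)) \<longlonglongrightarrow> 0"
    using *[of Re] *[of Im] by auto
  thus ?thesis
  proof eventually_elim
    case (elim \<omega>)
    thus ?case by (simp add: tendsto_complex_iff)
  qed
qed

lemma concentration_L1:
  assumes w: "Im w > 0"
  shows "(\<lambda>n. \<integral>z. cmod (mK w n z - eK w n) \<partial>Om n) \<longlonglongrightarrow> 0"
proof -
  have Wn: "W n \<in> measurable M (Om n)" for n using W by (simp add: Om_def)
  have m: "(\<lambda>z. cmod (mK w n z - eK w n)) \<in> borel_measurable (Om n)" for n using mK_measurable[OF w] by simp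
  have "(\<integral>z. cmod (mK w n z - eK w n) \<partial>Om n) = (\<integral>\<omega>. cmod (mK w n (W n \<omega>) - eK w n) \<partial>M)" for n
    using integral_distr[OF Wn m] W_distr by (simp add: Om_def)
  moreover have "(\<lambda>n. \<integral>\<omega>. cmod (mK w n (W n \<omega>) - eK w n) \<partial>M) \<longlonglongrightarrow> (\<integral>\<omega>. 0 \<partial>M)"
  proof (rule integral_dominated_convergence[where w = "\<lambda>_. 2 / Im w"])
    show "AE \<omega> in M. (\<lambda>n. cmod (mK w n (W n \<omega>) - eK w n)) \<longlonglongrightarrow> 0"
      using concentration_AE[OF w] by eventually_elim (rule tendsto_norm_zero)
    show "AE \<omega> in M. norm (cmod (mK w n (W n \<omega>) - eK w n)) \<le> 2 / Im w" for n
    proof (rule AE_I2)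
      fix \<omega>
      have "cmod (mK w n (W n \<omega>) - eK w n) \<le> 1 / Im w + 1 / Im w"
        by (intro order.trans[OF norm_triangle_ineq4] add_mono mK_bound eK_bound w)
      thus "norm (cmod (mK w n (W n \<omega>) - eK w n)) \<le> 2 / Im w" by simp
    qed
    show "(\<lambda>\<omega>. cmod (mK w n (W n \<omega>) - eK w n)) \<in> borel_measurable M" for n
      using measurable_compose[OF Wn m] .
  qed auto
  ultimately show ?thesis by simp
qed

lemma p_at_top: "filterlim (\<lambda>n. real (p n)) at_top sequentially"
proof -
  have "filterlim (\<lambda>n. real (n + 2)) at_top sequentially"
    by (intro filterlim_compose[OF filterlim_real_sequentially] filterlim_add_const_nat_at_top)
  from filterlim_tendsto_pos_mult_at_top[OF ratio y this] show ?thesis by simp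
qed

lemma kendall_close:
  assumes w: "Im w > 0"
  obtains D where "D \<longlonglongrightarrow> 0" "\<And>n. (\<integral>z. cmod (mK w n z - sample_resolvent.mt (p n) w (sample_resolvent.BM (p n) (n + 2) (R n) z)) \<partial>Om n) \<le> D n"
proof -
  let ?K1 = "sample_resolvent.K1 \<nu> C" and ?K2 = "sample_resolvent.K2 C"
  define D where "D n = (2 * (2 * ?K1 + 3 * ?K2) / sqrt (real (p n)) + 2 * C / real (n + 2)) / (Im w)\<^sup>2" for n
  have "(\<lambda>n. 2 * (2 * ?K1 + 3 * ?K2) / sqrt (real (p n))) \<longlonglongrightarrow> 0"
    by (intro real_tendsto_divide_at_top[OF tendsto_const] filterlim_compose[OF sqrt_at_top p_at_top])
  moreover have "(\<lambda>n. 2 * C / real (n + 2)) \<longlonglongrightarrow> 0"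
    by (intro real_tendsto_divide_at_top[OF tendsto_const] filterlim_compose[OF filterlim_real_sequentially] filterlim_add_const_nat_at_top)
  ultimately have "D \<longlonglongrightarrow> (0 + 0) / (Im w)\<^sup>2" unfolding D_def using w by (intro tendsto_divide tendsto_add tendsto_const) auto
  hence "D \<longlonglongrightarrow> 0" by simp
  moreover have "(\<integral>z. cmod (mK w n z - sample_resolvent.mt (p n) w (sample_resolvent.BM (p n) (n + 2) (R n) z)) \<partial>Om n) \<le> D n" for n
    using sample_resolvent.kendall_sample_close[OF resolvent_setting[OF w], of n] sample_resolvent.v_def[OF resolvent_setting[OF w]]
    by (simp add: mK_def KM_def Om_def D_def)
  ultimately show ?thesis by (rule that)
qed

text \<open>The means of the transforms of the sample covariance matrices satisfy the hypotheses of
  \<open>fixed_point_limit\<close> with the spectral measures of \<open>T\<close>, and those of the Kendall matrices have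
  the same limit.\<close>
theorem expectation_limit:
  assumes w: "Im w > 0"
  shows "\<exists>s. eK w \<longlonglongrightarrow> s \<and> s = (\<integral>t. 1 / (complex_of_real t * (1 - of_real y - of_real y * w * s) - w) \<partial>H)"
proof -
  note RS = resolvent_setting[OF w]
  note vdef = sample_resolvent.v_def[OF RS]
  obtain D where D: "D \<longlonglongrightarrow> 0" "\<And>n. (\<integral>z. cmod (mK w n z - sample_resolvent.mt (p n) w (sample_resolvent.BM (p n) (n + 2) (R n) z)) \<partial>Om n) \<le> D n"
    using kendall_close[OF w] by blast
  define V where "V n = (\<integral>z. cmod (mK w n z - eK w n) \<partial>Om n)" for n
  have V: "V \<longlonglongrightarrow> 0" unfolding V_def by (rule concentration_L1[OF w])
  define L where "L n = 2 * D n + V n" for n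
  have L: "L \<longlonglongrightarrow> 0" unfolding L_def using tendsto_add[OF tendsto_mult[OF tendsto_const[of 2] D(1)] V] by simp
  have dev: "(\<integral>z. cmod (sample_resolvent.mt (p n) w (sample_resolvent.BM (p n) (n + 2) (R n) z) - eB w n) \<partial>Om n) \<le> L n"
    and close: "cmod (eK w n - eB w n) \<le> D n" for n
    using sample_resolvent.mt_mean_deviation[OF RS, of n "D n" "V n"] D(2)[of n]
    by (auto simp: mK_def KM_def Om_def eK_def eB_def V_def L_def)
  have KB: "(\<lambda>n. eK w n - eB w n) \<longlonglongrightarrow> 0"
    by (rule Lim_null_comparison[OF always_eventually[OF allI[OF close]] D(1)])
  let ?\<zeta> = "cmod w / Im w" and ?K3 = "sample_resolvent.K3 \<nu> C w" and ?K4 = "sample_resolvent.K4 \<nu> C w"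
  define r where "r n = real (p n) / real (n + 2)" for n
  define a where "a n = 1 - of_real (r n) - of_real (r n) * w * eB w n" for n
  have av: "sample_resolvent.av \<nu> (p n) (n + 2) (R n) w = a n" for n
    unfolding sample_resolvent.av_def[OF RS] a_def r_def eB_def
    by (simp only: of_real_divide of_real_of_nat_eq mult.commute[of w])
  \<comment> \<open>The bound of \<open>deterministic_equivalent_expectation\<close>, with \<open>p\<close> cancelled so that every term
    visibly tends to zero.\<close>
  define U where "U n = ?\<zeta> * ?K3 / sqrt (real (p n)) + (C / 2) / (Im w)\<^sup>2 * (2 * ?\<zeta>\<^sup>2 * (r n / sqrt (real (p n)) * ?K4 + C / 2 * (C * r n / 2) / ((Im w)\<^sup>2 * real (n + 2))) + cmod w * r n * L n)
     + (1 + r n * (1 + ?\<zeta>)) * (C / 2) * (C / 2) / ((Im w) ^ 3 * real (n + 2))" for n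
  have bound: "cmod (ctrace (resolvent (a n) (sample_setting.T (p n) (R n)) w) / of_nat (p n) - eB w n) \<le> U n" for n
  proof -
    define s where "s = sqrt (real (p n))"
    have s: "s > 0" "s * s = real (p n)" using p_pos[of n] by (auto simp: s_def)
    have n2: "real (n + 2) > 0" by simp
    have "cmod (ctrace (resolvent (a n) (sample_setting.T (p n) (R n)) w) / of_nat (p n) - eB w n) \<le>
      (?\<zeta> * (s * ?K3) + real (p n) * (C / 2) / (Im w)\<^sup>2 * (2 * ?\<zeta>\<^sup>2 / real (n + 2) * (s * ?K4 + C / 2 * (C * real (p n) / 2) / ((Im w)\<^sup>2 * real (n + 2)))
       + cmod w * (real (p n) / real (n + 2)) * L n) + (1 + real (p n) / real (n + 2) * (1 + ?\<zeta>)) * (C / 2) * (C * real (p n) / 2) / ((Im w) ^ 3 * real (n + 2))) / real (p n)"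
      using sample_resolvent.deterministic_equivalent_expectation[OF RS dev[of n, unfolded Om_def eB_def]]
      unfolding av eB_def[symmetric] sample_resolvent.\<zeta>_def[OF RS] vdef s_def .
    also have "\<dots> = U n"
    proof -
      have alg: "(A * (s * B) + s * s * c * (d / m * (s * e + f * (g * (s * s) / 2) / (h * m)) + i * (s * s / m) * l) + j * k * (g * (s * s) / 2) / (q * m)) / (s * s) =
         A * B / s + c * (d * ((s * s / m) / s * e + f * (g * (s * s / m) / 2) / (h * m)) + i * (s * s / m) * l) + j * k * (g / 2) / (q * m)"
        if "m > 0" "h > 0" "q > 0" for A B c d e f g h i j k l m q :: real
        using s(1) that by (simp add: field_simps)
      have "real (p n) * (C / 2) / (Im w)\<^sup>2 = s * s * ((C / 2) / (Im w)\<^sup>2)" unfolding s(2) by simp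
      thus ?thesis
        unfolding U_def r_def s_def[symmetric]
        using alg[of "real (n + 2)" "(Im w)\<^sup>2" "Im w ^ 3" ?\<zeta> ?K3 "(C / 2) / (Im w)\<^sup>2" "2 * ?\<zeta>\<^sup>2" ?K4 "C / 2" C "cmod w" "L n" "1 + real (p n) / real (n + 2) * (1 + ?\<zeta>)" "C / 2"] w
        unfolding s(2) by simp
    qed
    finally show ?thesis .
  qed
  have rl: "r \<longlonglongrightarrow> y" unfolding r_def by (rule ratio)
  have U: "U \<longlonglongrightarrow> 0"
  proof -
    have sp: "filterlim (\<lambda>n. sqrt (real (p n))) at_top sequentially" by (rule filterlim_compose[OF sqrt_at_top p_at_top])
    have nt: "filterlim (\<lambda>n. real (n + 2)) at_top sequentially"
      by (intro filterlim_compose[OF filterlim_real_sequentially] filterlim_add_const_nat_at_top)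
    have nt': "filterlim (\<lambda>n. c * real (n + 2)) at_top sequentially" if "c > 0" for c
      by (rule filterlim_tendsto_pos_mult_at_top[OF tendsto_const that nt])
    have 1: "(\<lambda>n. ?\<zeta> * ?K3 / sqrt (real (p n))) \<longlonglongrightarrow> 0" by (rule real_tendsto_divide_at_top[OF tendsto_const sp])
    have 2: "(\<lambda>n. r n / sqrt (real (p n)) * ?K4) \<longlonglongrightarrow> 0 * ?K4" by (intro tendsto_mult tendsto_const real_tendsto_divide_at_top[OF rl sp])
    have 3: "(\<lambda>n. C / 2 * (C * r n / 2) / ((Im w)\<^sup>2 * real (n + 2))) \<longlonglongrightarrow> 0"
    proof (rule real_tendsto_divide_at_top[OF _ nt'])
      show "(\<lambda>n. C / 2 * (C * r n / 2)) \<longlonglongrightarrow> C / 2 * (C * y / 2)"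
        by (intro tendsto_mult tendsto_divide tendsto_const rl) simp
    qed (use w in simp)
    have 4: "(\<lambda>n. cmod w * r n * L n) \<longlonglongrightarrow> cmod w * y * 0" by (intro tendsto_mult tendsto_const rl L)
    have 5: "(\<lambda>n. (1 + r n * (1 + ?\<zeta>)) * (C / 2) * (C / 2) / ((Im w) ^ 3 * real (n + 2))) \<longlonglongrightarrow> 0"
    proof (rule real_tendsto_divide_at_top[OF _ nt'])
      show "(\<lambda>n. (1 + r n * (1 + ?\<zeta>)) * (C / 2) * (C / 2)) \<longlonglongrightarrow> (1 + y * (1 + ?\<zeta>)) * (C / 2) * (C / 2)"
        by (intro tendsto_mult tendsto_add tendsto_const rl)
    qed (use w in simp)
    have "U \<longlonglongrightarrow> 0 + (C / 2) / (Im w)\<^sup>2 * (2 * ?\<zeta>\<^sup>2 * (0 * ?K4 + 0) + cmod w * y * 0) + 0"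
      unfolding U_def by (intro tendsto_add tendsto_mult[OF tendsto_const] 1 2 3 4 5)
    thus ?thesis by simp
  qed
  have "\<exists>\<mu>. real_distribution \<mu> \<and> cdf \<mu> = esd (sample_setting.T (p n) (R n)) \<and>
     (\<forall>a z. Im a \<le> 0 \<longrightarrow> Im z > 0 \<longrightarrow> (\<integral>t. 1 / (a * complex_of_real t - z) \<partial>\<mu>) = ctrace (resolvent a (sample_setting.T (p n) (R n)) z) / of_nat (p n)) \<and>
     (AE t in \<mu>. 0 \<le> t \<and> t \<le> C / 2)" for n
  proof -
    show ?thesis
    proof (rule esd_measure[OF sample_setting.psd_T[OF setting[of n]] p_pos[of n]])
      fix \<mu>
      assume \<mu>: "real_distribution \<mu>" "cdf \<mu> = esd (sample_setting.T (p n) (R n))"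
        and st: "\<And>a z. Im a \<le> 0 \<Longrightarrow> Im z > 0 \<Longrightarrow> (\<integral>t. 1 / (a * complex_of_real t - z) \<partial>\<mu>) = ctrace (resolvent a (sample_setting.T (p n) (R n)) z) / of_nat (p n)"
        and bd: "\<And>C'. (\<And>u. (\<Sum>i<p n. \<Sum>j<p n. sample_setting.T (p n) (R n) $$ (i, j) * (u i * u j)) \<le> C' * (\<Sum>i<p n. (u i)\<^sup>2)) \<Longrightarrow> AE t in \<mu>. 0 \<le> t \<and> t \<le> C'"
      have "AE t in \<mu>. 0 \<le> t \<and> t \<le> C / 2" by (rule bd[OF sample_resolvent.T_form[OF RS]])
      thus ?thesis using \<mu> st by blast
    qed
  qed
  hence "\<exists>\<mu>. \<forall>n. real_distribution (\<mu> n) \<and> cdf (\<mu> n) = esd (sample_setting.T (p n) (R n)) \<and>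
     (\<forall>a z. Im a \<le> 0 \<longrightarrow> Im z > 0 \<longrightarrow> (\<integral>t. 1 / (a * complex_of_real t - z) \<partial>\<mu> n) = ctrace (resolvent a (sample_setting.T (p n) (R n)) z) / of_nat (p n)) \<and>
     (AE t in \<mu> n. 0 \<le> t \<and> t \<le> C / 2)"
    by (rule choice[OF allI])
  then obtain \<mu> where \<mu>all: "\<forall>n. real_distribution (\<mu> n) \<and> cdf (\<mu> n) = esd (sample_setting.T (p n) (R n)) \<and>
     (\<forall>a z. Im a \<le> 0 \<longrightarrow> Im z > 0 \<longrightarrow> (\<integral>t. 1 / (a * complex_of_real t - z) \<partial>\<mu> n) = ctrace (resolvent a (sample_setting.T (p n) (R n)) z) / of_nat (p n)) \<and>
     (AE t in \<mu> n. 0 \<le> t \<and> t \<le> C / 2)" by (rule exE)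
  note \<mu>d = \<mu>all[rule_format, THEN conjunct1] and \<mu>c = \<mu>all[rule_format, THEN conjunct2, THEN conjunct1]
    and \<mu>s = \<mu>all[rule_format, THEN conjunct2, THEN conjunct2, THEN conjunct1, rule_format]
    and \<mu>b = \<mu>all[rule_format, THEN conjunct2, THEN conjunct2, THEN conjunct2]
  note \<mu> = \<mu>d \<mu>c \<mu>s \<mu>b
  have wc: "weak_conv_m \<mu> H" using H_limit by (simp add: weak_conv_m_def \<mu>(2))
  have aI: "Im (a n) \<le> 0" for n using sample_resolvent.av_Im[OF RS, of n] by (simp only: av)
  have eqn: "(\<lambda>n. (\<integral>t. 1 / (a n * complex_of_real t - w) \<partial>\<mu> n) - eB w n) \<longlonglongrightarrow> 0"
    by (rule Lim_null_comparison[OF always_eventually U]) (use bound \<mu>(3)[OF aI w] in simp)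
  have eB_le: "cmod (eB w n) \<le> 1 / Im w" for n using sample_resolvent.EB_bound[OF RS, of n] by (simp add: eB_def vdef)
  have "\<exists>s. eB w \<longlonglongrightarrow> s \<and> s = (\<integral>t. 1 / (complex_of_real t * (1 - of_real y - of_real y * w * s) - w) \<partial>H)"
    by (rule fixed_point_limit[OF \<mu>(1) H wc \<mu>(4) _ w rl y eB_le aI[unfolded a_def] eqn[unfolded a_def]]) (use C_pos in simp)
  moreover have "eK w \<longlonglongrightarrow> s" if "eB w \<longlonglongrightarrow> s" for s
    using tendsto_add[OF KB that] by simp
  ultimately show ?thesis by blast
qed

text \<open>On the event where the transforms converge at all points of \<open>rational_upper\<close>, the spectral
  distributions converge weakly. The limits \<open>s\<close> of the transforms are deterministic, so a single
  outcome in the event provides the limit distribution for all of them.\<close>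
theorem kendall_limit:
  "\<exists>F. real_distribution F \<and> (AE \<omega> in M. weak_conv (\<lambda>n. esd (KM n (W n \<omega>))) (cdf F)) \<and>
    (\<forall>z. Im z > 0 \<longrightarrow> stieltjes F z = (\<integral>t. 1 / (complex_of_real t * (1 - of_real y - of_real y * z * stieltjes F z) - z) \<partial>H))"
proof -
  define s where "s z = (SOME s. eK z \<longlonglongrightarrow> s \<and> s = (\<integral>t. 1 / (complex_of_real t * (1 - of_real y - of_real y * z * s) - z) \<partial>H))" for z
  have s: "eK z \<longlonglongrightarrow> s z" "s z = (\<integral>t. 1 / (complex_of_real t * (1 - of_real y - of_real y * z * s z) - z) \<partial>H)" if "Im z > 0" for z
    using someI_ex[OF expectation_limit[OF that]] unfolding s_def[symmetric] by auto
  have conv: "AE \<omega> in M. (\<lambda>n. mK z n (W n \<omega>)) \<longlonglongrightarrow> s z" if z: "Im z > 0" for z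
    using concentration_AE[OF z] by eventually_elim (use tendsto_add[OF _ s(1)[OF z]] in fastforce)
  have "\<exists>\<mu>. real_distribution \<mu> \<and> cdf \<mu> = esd (KM n z) \<and> (\<forall>w. Im w > 0 \<longrightarrow> stieltjes \<mu> w = mK w n z) \<and>
     (\<forall>b>0. measure \<mu> {-1<..b} \<ge> 1 - 2 * C / b)" for n z
  proof -
    obtain \<mu> where \<mu>: "real_distribution \<mu>" "cdf \<mu> = esd (KM n z)"
      "\<And>a w. Im a \<le> 0 \<Longrightarrow> Im w > 0 \<Longrightarrow> (\<integral>t. 1 / (a * complex_of_real t - w) \<partial>\<mu>) = ctrace (resolvent a (KM n z) w) / of_nat (p n)"
      "\<And>b. b > 0 \<Longrightarrow> measure \<mu> {-1<..b} \<ge> 1 - mat_trace (KM n z) / (real (p n) * b)"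
      by (rule esd_measure[OF KM_psd[of n z] p_pos[of n]], rule that)
    have "stieltjes \<mu> w = mK w n z" if "Im w > 0" for w
      using \<mu>(3)[of 1 w] that by (simp add: stieltjes_def mK_def sample_resolvent.mt_def[OF resolvent_setting])
    moreover have "measure \<mu> {-1<..b} \<ge> 1 - 2 * C / b" if b: "b > 0" for b
    proof -
      have "mat_trace (KM n z) \<le> 2 * C * real (p n)"
        unfolding KM_def by (rule sample_resolvent.KM_trace[OF resolvent_setting[of \<i>]]) simp
      hence "mat_trace (KM n z) / (real (p n) * b) \<le> 2 * C * real (p n) / (real (p n) * b)"
        using b p_pos[of n] by (intro divide_right_mono) auto
      also have "\<dots> = 2 * C / b" using p_pos[of n] by simp
      finally show ?thesis using \<mu>(4)[OF b] by linarith
    qed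
    ultimately show ?thesis using \<mu>(1,2) by blast
  qed
  then obtain \<mu> where \<mu>: "\<And>n z. real_distribution (\<mu> n z)" "\<And>n z. cdf (\<mu> n z) = esd (KM n z)"
    "\<And>n z w. Im w > 0 \<Longrightarrow> stieltjes (\<mu> n z) w = mK w n z" "\<And>n z b. b > 0 \<Longrightarrow> measure (\<mu> n z) {-1<..b} \<ge> 1 - 2 * C / b"
    by metis
  have tight: "tight (\<lambda>n. \<mu> n (W n \<omega>))" for \<omega>
    unfolding tight_def
  proof (intro conjI allI impI \<mu>(1))
    fix \<epsilon> :: real assume \<epsilon>: "\<epsilon> > 0"
    \<comment> \<open>Chosen such that \<open>2 * C / b = \<epsilon> / 2\<close>.\<close>
    define b where "b = 4 * C / \<epsilon>"
    have b: "b > 0" using \<epsilon> C_pos by (simp add: b_def)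
    have "2 * C / b < \<epsilon>" using \<epsilon> C_pos by (simp add: b_def)
    hence "\<forall>n. measure (\<mu> n (W n \<omega>)) {-1<..b} > 1 - \<epsilon>" using \<mu>(4)[OF b] by (smt (verit))
    moreover have "-1 < b" using b by simp
    ultimately show "\<exists>a b. a < b \<and> (\<forall>n. 1 - \<epsilon> < measure (\<mu> n (W n \<omega>)) {a<..b})" by blast
  qed
  define good where "good \<omega> \<longleftrightarrow> (\<forall>z\<in>rational_upper. (\<lambda>n. mK z n (W n \<omega>)) \<longlonglongrightarrow> s z)" for \<omega>
  have good: "AE \<omega> in M. good \<omega>"
    unfolding good_def using countable_rational_upper conv rational_upper_Im by (simp add: AE_ball_countable)
  have st: "(\<lambda>n. stieltjes (\<mu> n (W n \<omega>)) z) \<longlonglongrightarrow> s z" if "good \<omega>" "z \<in> rational_upper" for \<omega> z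
    using that rational_upper_Im[OF that(2)] by (simp add: good_def \<mu>(3))
  obtain \<omega>0 where \<omega>0: "good \<omega>0" using good eventually_happens'[OF ae_filter_bot] by blast
  obtain F where F: "real_distribution F" "weak_conv_m (\<lambda>n. \<mu> n (W n \<omega>0)) F"
    using stieltjes_continuity(1)[OF tight st[OF \<omega>0]] by blast
  have Fs: "stieltjes F z = s z" if z: "z \<in> rational_upper" for z
  proof -
    have "(\<lambda>n. stieltjes (\<mu> n (W n \<omega>0)) z) \<longlonglongrightarrow> stieltjes F z"
      by (rule weak_conv_stieltjes[OF \<mu>(1) F rational_upper_Im[OF z]])
    thus ?thesis using st[OF \<omega>0 z] LIMSEQ_unique by blast
  qed
  have wc: "weak_conv_m (\<lambda>n. \<mu> n (W n \<omega>)) F" if "good \<omega>" for \<omega>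
    by (rule stieltjes_continuity(2)[OF tight st[OF that] F(1) Fs])
  have "AE \<omega> in M. weak_conv (\<lambda>n. esd (KM n (W n \<omega>))) (cdf F)"
    using good by eventually_elim (use wc in \<open>simp add: weak_conv_m_def \<mu>(2)\<close>)
  moreover have "stieltjes F z = (\<integral>t. 1 / (complex_of_real t * (1 - of_real y - of_real y * z * stieltjes F z) - z) \<partial>H)" if z: "Im z > 0" for z
  proof -
    have "AE \<omega> in M. good \<omega> \<and> (\<lambda>n. mK z n (W n \<omega>)) \<longlonglongrightarrow> s z" using good conv[OF z] by eventually_elim auto
    then obtain \<omega> where \<omega>: "good \<omega>" "(\<lambda>n. mK z n (W n \<omega>)) \<longlonglongrightarrow> s z" using eventually_happens'[OF ae_filter_bot] by blast
    have "(\<lambda>n. stieltjes (\<mu> n (W n \<omega>)) z) \<longlonglongrightarrow> stieltjes F z"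
      by (rule weak_conv_stieltjes[OF \<mu>(1) F(1) wc[OF \<omega>(1)] z])
    hence "stieltjes F z = s z" using \<omega>(2) LIMSEQ_unique by (simp add: \<mu>(3)[OF z]) blast
    thus ?thesis using s(2)[OF z] by simp
  qed
  ultimately show ?thesis using F(1) by blast
qed

end

section \<open>From random variables to product measures\<close>

lemma (in prob_space) distr_restrict_iid:
  assumes ind: "indep_vars (\<lambda>_. N) X {..<n}" and n: "n > 0"
    and id: "\<And>i. i < n \<Longrightarrow> distr M N (X i) = \<mu>" and s: "sets \<mu> = sets N"
  shows "(\<lambda>\<omega>. \<lambda>i\<in>{..<n}. X i \<omega>) \<in> measurable M (PiM {..<n} (\<lambda>_. \<mu>))"
    and "distr M (PiM {..<n} (\<lambda>_. \<mu>)) (\<lambda>\<omega>. \<lambda>i\<in>{..<n}. X i \<omega>) = PiM {..<n} (\<lambda>_. \<mu>)"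
proof -
  have rv: "X i \<in> measurable M N" if "i \<in> {..<n}" for i using ind that by (simp add: indep_vars_def)
  have eq: "sets (PiM {..<n} (\<lambda>_. \<mu>)) = sets (PiM {..<n} (\<lambda>_. N))" by (rule sets_PiM_cong[OF refl s])
  have "(\<lambda>\<omega>. \<lambda>i\<in>{..<n}. X i \<omega>) \<in> measurable M (PiM {..<n} (\<lambda>_. N))" by (intro measurable_restrict rv)
  thus "(\<lambda>\<omega>. \<lambda>i\<in>{..<n}. X i \<omega>) \<in> measurable M (PiM {..<n} (\<lambda>_. \<mu>))"
    by (subst measurable_cong_sets[OF refl eq])
  have "distr M (PiM {..<n} (\<lambda>_. \<mu>)) (\<lambda>\<omega>. \<lambda>i\<in>{..<n}. X i \<omega>) = distr M (PiM {..<n} (\<lambda>_. N)) (\<lambda>\<omega>. \<lambda>i\<in>{..<n}. X i \<omega>)"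
    by (rule distr_cong[OF refl eq refl])
  also have "\<dots> = (\<Pi>\<^sub>M i\<in>{..<n}. distr M N (X i))"
    by (rule iffD1[OF indep_vars_iff_distr_eq_PiM' ind]) (use n rv in auto)
  also have "\<dots> = PiM {..<n} (\<lambda>_. \<mu>)" using id by (intro PiM_cong) auto
  finally show "distr M (PiM {..<n} (\<lambda>_. \<mu>)) (\<lambda>\<omega>. \<lambda>i\<in>{..<n}. X i \<omega>) = PiM {..<n} (\<lambda>_. \<mu>)" .
qed

text \<open>Grouping an independent array into rows: first the entries of a row are independent, then
  the rows are, and both steps identify a joint distribution with a product measure.\<close>
lemma (in prob_space) distr_iid_array:
  fixes Z :: "nat \<Rightarrow> nat \<Rightarrow> 'a \<Rightarrow> real"
  assumes ind: "indep_vars (\<lambda>_. borel) (\<lambda>(i, k). Z i k) ({1..} \<times> {1..})"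
    and id: "\<And>i k. 1 \<le> i \<Longrightarrow> 1 \<le> k \<Longrightarrow> distr M borel (Z i k) = \<nu>" and Np: "N > 0" "p > 0"
  shows "(\<lambda>\<omega>. \<lambda>i\<in>{..<N}. \<lambda>k\<in>{..<p}. Z (Suc i) (Suc k) \<omega>) \<in> measurable M (PiM {..<N} (\<lambda>_. PiM {..<p} (\<lambda>_. \<nu>)))"
    and "distr M (PiM {..<N} (\<lambda>_. PiM {..<p} (\<lambda>_. \<nu>))) (\<lambda>\<omega>. \<lambda>i\<in>{..<N}. \<lambda>k\<in>{..<p}. Z (Suc i) (Suc k) \<omega>)
      = PiM {..<N} (\<lambda>_. PiM {..<p} (\<lambda>_. \<nu>))"
proof -
  have s: "sets \<nu> = sets borel" using id[of 1 1] by auto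
  have row: "(\<lambda>\<omega>. \<lambda>k\<in>{..<p}. Z (Suc i) (Suc k) \<omega>) \<in> measurable M (PiM {..<p} (\<lambda>_. \<nu>))"
    "distr M (PiM {..<p} (\<lambda>_. \<nu>)) (\<lambda>\<omega>. \<lambda>k\<in>{..<p}. Z (Suc i) (Suc k) \<omega>) = PiM {..<p} (\<lambda>_. \<nu>)" for i
  proof -
    have "indep_vars (\<lambda>k. PiM {(Suc i, Suc k)} (\<lambda>_. borel)) (\<lambda>k \<omega>. restrict (\<lambda>q. (case q of (i, k) \<Rightarrow> Z i k) \<omega>) {(Suc i, Suc k)}) {..<p}"
      by (rule indep_vars_restrict[OF ind]) (auto simp: disjoint_family_on_def)
    from indep_vars_compose2[OF this, of "\<lambda>k f. f (Suc i, Suc k)" "\<lambda>_. borel"]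
    have ind': "indep_vars (\<lambda>_. borel) (\<lambda>k. Z (Suc i) (Suc k)) {..<p}" by simp
    show "(\<lambda>\<omega>. \<lambda>k\<in>{..<p}. Z (Suc i) (Suc k) \<omega>) \<in> measurable M (PiM {..<p} (\<lambda>_. \<nu>))"
      by (rule distr_restrict_iid(1)[OF ind' Np(2) _ s]) (simp add: id)
    show "distr M (PiM {..<p} (\<lambda>_. \<nu>)) (\<lambda>\<omega>. \<lambda>k\<in>{..<p}. Z (Suc i) (Suc k) \<omega>) = PiM {..<p} (\<lambda>_. \<nu>)"
      by (rule distr_restrict_iid(2)[OF ind' Np(2) _ s]) (simp add: id)
  qed
  have "indep_vars (\<lambda>i. PiM ({Suc i} \<times> {1..p}) (\<lambda>_. borel)) (\<lambda>i \<omega>. restrict (\<lambda>q. (case q of (i, k) \<Rightarrow> Z i k) \<omega>) ({Suc i} \<times> {1..p})) {..<N}"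
    by (rule indep_vars_restrict[OF ind]) (auto simp: disjoint_family_on_def)
  moreover have "(\<lambda>f. \<lambda>k\<in>{..<p}. f (Suc i, Suc k)) \<in> measurable (PiM ({Suc i} \<times> {1..p}) (\<lambda>_. borel)) (PiM {..<p} (\<lambda>_. \<nu>))" for i
  proof -
    have "(\<lambda>f. \<lambda>k\<in>{..<p}. f (Suc i, Suc k)) \<in> measurable (PiM ({Suc i} \<times> {1..p}) (\<lambda>_. borel)) (PiM {..<p} (\<lambda>_. borel :: real measure))"
      by (intro measurable_restrict measurable_component_singleton) auto
    thus ?thesis by (subst measurable_cong_sets[OF refl sets_PiM_cong[OF refl s]])
  qed
  ultimately have "indep_vars (\<lambda>_. PiM {..<p} (\<lambda>_. \<nu>)) (\<lambda>i \<omega>. \<lambda>k\<in>{..<p}. restrict (\<lambda>q. (case q of (i, k) \<Rightarrow> Z i k) \<omega>) ({Suc i} \<times> {1..p}) (Suc i, Suc k)) {..<N}"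
    by (rule indep_vars_compose2)
  moreover have "(\<lambda>k\<in>{..<p}. restrict (\<lambda>q. (case q of (i, k) \<Rightarrow> Z i k) \<omega>) ({Suc i} \<times> {1..p}) (Suc i, Suc k)) = (\<lambda>k\<in>{..<p}. Z (Suc i) (Suc k) \<omega>)" for i \<omega>
    by (rule restrict_ext) auto
  ultimately have ind': "indep_vars (\<lambda>_. PiM {..<p} (\<lambda>_. \<nu>)) (\<lambda>i \<omega>. \<lambda>k\<in>{..<p}. Z (Suc i) (Suc k) \<omega>) {..<N}" by simp
  show "(\<lambda>\<omega>. \<lambda>i\<in>{..<N}. \<lambda>k\<in>{..<p}. Z (Suc i) (Suc k) \<omega>) \<in> measurable M (PiM {..<N} (\<lambda>_. PiM {..<p} (\<lambda>_. \<nu>)))"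
    and "distr M (PiM {..<N} (\<lambda>_. PiM {..<p} (\<lambda>_. \<nu>))) (\<lambda>\<omega>. \<lambda>i\<in>{..<N}. \<lambda>k\<in>{..<p}. Z (Suc i) (Suc k) \<omega>)
      = PiM {..<N} (\<lambda>_. PiM {..<p} (\<lambda>_. \<nu>))"
    by (rule distr_restrict_iid[OF ind' Np(1) row(2) refl])+
qed

section \<open>The Kendall matrix in coordinates\<close>

lemma vec_norm_sq: "v \<in> carrier_vec n \<Longrightarrow> (vec_norm v)\<^sup>2 = (\<Sum>i<n. (v $ i)\<^sup>2)"
  by (auto simp: vec_norm_def scalar_prod_def power2_eq_square lessThan_atLeast0 sum_nonneg)

lemma vec_norm_nonneg: "vec_norm v \<ge> 0"
  by (auto simp: vec_norm_def scalar_prod_def intro!: sum_nonneg)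

text \<open>The supremum defining the spectral norm is finite because the Frobenius norm is a bound.\<close>
lemma spectral_norm_bound:
  assumes A: "A \<in> carrier_mat n n" and v: "v \<in> carrier_vec n"
  shows "vec_norm (A *\<^sub>v v) \<le> spectral_norm A * vec_norm v"
proof -
  let ?S = "{v \<in> carrier_vec (dim_col A). vec_norm v = 1}"
  define F where "F = sqrt (\<Sum>i<n. \<Sum>j<n. (A $$ (i, j))\<^sup>2)"
  have entry: "(A *\<^sub>v u) $ i = (\<Sum>j<n. A $$ (i, j) * u $ j)" if "u \<in> carrier_vec n" "i < n" for u i
    using A that by (auto simp: scalar_prod_def lessThan_atLeast0 intro!: sum.cong)
  have bd: "bdd_above ((\<lambda>v. vec_norm (A *\<^sub>v v)) ` ?S)"
  proof (rule bdd_aboveI2)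
    fix u assume u: "u \<in> ?S"
    hence uc: "u \<in> carrier_vec n" using A by auto
    have "(\<Sum>j<n. (u $ j)\<^sup>2) = 1" using vec_norm_sq[OF uc] u by simp
    hence "((A *\<^sub>v u) $ i)\<^sup>2 \<le> (\<Sum>j<n. (A $$ (i, j))\<^sup>2)" if "i < n" for i
      using Cauchy_Schwarz_ineq_sum[of "\<lambda>j. A $$ (i, j)" "\<lambda>j. u $ j" "{..<n}"] entry[OF uc that] by simp
    hence "(vec_norm (A *\<^sub>v u))\<^sup>2 \<le> (\<Sum>i<n. \<Sum>j<n. (A $$ (i, j))\<^sup>2)"
      unfolding vec_norm_sq[OF mult_mat_vec_carrier[OF A uc]] by (intro sum_mono) auto
    thus "vec_norm (A *\<^sub>v u) \<le> F" unfolding F_def by (rule real_le_rsqrt)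
  qed
  show ?thesis
  proof (cases "vec_norm v = 0")
    case True
    hence "(\<Sum>i<n. (v $ i)\<^sup>2) = 0" using vec_norm_sq[OF v] by simp
    hence "\<forall>i<n. v $ i = 0" by (subst (asm) sum_nonneg_eq_0_iff) auto
    hence "\<forall>i<n. (A *\<^sub>v v) $ i = 0" using entry[OF v] by simp
    hence "(vec_norm (A *\<^sub>v v))\<^sup>2 = 0" unfolding vec_norm_sq[OF mult_mat_vec_carrier[OF A v]] by simp
    thus ?thesis using True by simp
  next
    case False
    define c where "c = vec_norm v"
    have c: "c > 0" using False vec_norm_nonneg[of v] by (simp add: c_def)
    define u where "u = (1 / c) \<cdot>\<^sub>v v"
    have uc: "u \<in> carrier_vec n" using v by (simp add: u_def)
    have nu: "(vec_norm u)\<^sup>2 = 1"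
      unfolding vec_norm_sq[OF uc] using v c
      by (simp add: u_def power_divide vec_norm_sq[OF v, folded c_def, symmetric] flip: sum_divide_distrib)
    have "vec_norm u = 1" using nu vec_norm_nonneg[of u] by (simp add: power2_eq_1_iff)
    hence "vec_norm (A *\<^sub>v u) \<le> spectral_norm A"
      unfolding spectral_norm_def using uc A by (intro cSUP_upper[OF _ bd]) auto
    moreover have "vec_norm (A *\<^sub>v v) = c * vec_norm (A *\<^sub>v u)"
    proof -
      have "A *\<^sub>v u = (1 / c) \<cdot>\<^sub>v (A *\<^sub>v v)" unfolding u_def by (rule mult_mat_vec[OF A v])
      hence "(vec_norm (A *\<^sub>v u))\<^sup>2 = (vec_norm (A *\<^sub>v v) / c)\<^sup>2"
        unfolding vec_norm_sq[OF mult_mat_vec_carrier[OF A uc]] power_divide vec_norm_sq[OF mult_mat_vec_carrier[OF A v]]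
        using A by (simp add: power_divide flip: sum_divide_distrib)
      hence "vec_norm (A *\<^sub>v u) = vec_norm (A *\<^sub>v v) / c"
        by (subst (asm) power2_eq_iff_nonneg) (use c vec_norm_nonneg in auto)
      thus ?thesis using c by simp
    qed
    ultimately show ?thesis using c unfolding c_def[symmetric] by (simp add: mult.commute mult_left_mono)
  qed
qed

text \<open>For symmetric \<open>R\<close> the left-hand side is \<open>u \<bullet> R\<^sup>2 u\<close>.\<close>
lemma square_root_bound:
  assumes R: "R \<in> carrier_mat n n" "transpose_mat R = R" and C: "spectral_norm (R * R) \<le> C"
  shows "(\<Sum>k<n. (\<Sum>l<n. R $$ (k, l) * u l)\<^sup>2) \<le> C * (\<Sum>l<n. (u l)\<^sup>2)"
proof -
  define U where "U = vec n u"
  have U: "U \<in> carrier_vec n" by (simp add: U_def)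
  have RR: "R * R \<in> carrier_mat n n" using R(1) by simp
  note nn = vec_norm_nonneg
  have "(\<Sum>k<n. (\<Sum>l<n. R $$ (k, l) * u l)\<^sup>2) = (\<Sum>k<n. ((R *\<^sub>v U) $ k)\<^sup>2)"
    using R(1) by (intro sum.cong arg_cong[where f = "\<lambda>x. x\<^sup>2"]) (auto simp: scalar_prod_def U_def lessThan_atLeast0 intro!: sum.cong)
  also have "\<dots> = (R *\<^sub>v U) \<bullet> (R *\<^sub>v U)"
    using R(1) by (simp add: scalar_prod_def power2_eq_square lessThan_atLeast0)
  also have "\<dots> = U \<bullet> (R *\<^sub>v (R *\<^sub>v U))"
    using transpose_vec_mult_scalar[OF R(1) mult_mat_vec_carrier[OF R(1) U] U] R(2) by simp
  also have "R *\<^sub>v (R *\<^sub>v U) = (R * R) *\<^sub>v U" by (rule assoc_mult_mat_vec[OF R(1) R(1) U, symmetric])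
  also have "U \<bullet> ((R * R) *\<^sub>v U) \<le> vec_norm U * vec_norm ((R * R) *\<^sub>v U)"
  proof (rule power2_le_imp_le)
    let ?V = "(R * R) *\<^sub>v U"
    have V: "?V \<in> carrier_vec n" by (rule mult_mat_vec_carrier[OF RR U])
    have "U \<bullet> ?V = (\<Sum>i<n. U $ i * ?V $ i)" using V by (simp only: scalar_prod_def lessThan_atLeast0 carrier_vecD)
    thus "(U \<bullet> ?V)\<^sup>2 \<le> (vec_norm U * vec_norm ?V)\<^sup>2"
      using Cauchy_Schwarz_ineq_sum[of "\<lambda>j. U $ j" "\<lambda>j. ?V $ j" "{..<n}"] unfolding power_mult_distrib vec_norm_sq[OF U] vec_norm_sq[OF V] by simp
  qed (intro mult_nonneg_nonneg nn)
  also have "\<dots> \<le> vec_norm U * (C * vec_norm U)"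
    using spectral_norm_bound[OF RR U] mult_right_mono[OF C nn[of U]] nn[of U] by (intro mult_left_mono) linarith+
  also have "\<dots> = C * (\<Sum>l<n. (u l)\<^sup>2)"
    using vec_norm_sq[OF U] by (simp add: power2_eq_square U_def)
  finally show ?thesis .
qed

lemma (in sample_setting) T_eq_half_square: "R * R = S \<Longrightarrow> T = (1 / 2) \<cdot>\<^sub>m S"
  using R symmetric_mat_entries[OF R R_sym]
  by (intro eq_matI) (auto simp: T_def gram_def scalar_prod_def lessThan_atLeast0 simp flip: sum_divide_distrib intro!: sum.cong)

context sample_resolvent
begin

lemma mat_trace_square: "R * R = S \<Longrightarrow> mat_trace S = tS"
  using R symmetric_mat_entries[OF R R_sym]
  by (auto simp: mat_trace_def tS_def scalar_prod_def lessThan_atLeast0 power2_eq_square intro!: sum.cong)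

text \<open>The mean vector cancels in differences. Observations are numbered from 1 in \<open>kendall_tau\<close>
  and from 0 in a sample.\<close>
lemma kendall_tau_KM:
  fixes Z :: "nat \<Rightarrow> nat \<Rightarrow> 'a \<Rightarrow> real"
  assumes mu: "mu \<in> carrier_vec p" and Rs: "R = mat_sqrt Sig" and RR: "R * R = Sig"
  shows "(1 / 2 * mat_trace Sig) \<cdot>\<^sub>m kendall_tau p N (observation p mu Sig Z \<omega>) = KM (\<lambda>i\<in>{..<N}. \<lambda>k\<in>{..<p}. Z (Suc i) (Suc k) \<omega>)"
proof -
  define z where "z = (\<lambda>i\<in>{..<N}. \<lambda>k\<in>{..<p}. Z (Suc i) (Suc k) \<omega>)"
  define obs where "obs = observation p mu Sig Z \<omega>"
  have obs_carrier: "obs i \<in> carrier_vec p" for i using R mu by (auto simp: obs_def observation_def Rs[symmetric])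
  have obs_entry: "obs (Suc i) $ k = mu $ k + X z i k" if "i < N" "k < p" for i k
    using that R mu by (auto simp: obs_def observation_def Rs[symmetric] X_def row_def scalar_prod_def z_def lessThan_atLeast0 intro!: sum.cong)
  have dk: "(obs (Suc i) - obs (Suc j)) $ k = d z (i, j) k" if "i < N" "j < N" "k < p" for i j k
    using that by (simp add: d_def obs_entry carrier_vecD[OF obs_carrier])
  have sm: "kendall_summand (obs (Suc i)) (obs (Suc j)) $$ (a, b) = 1 / nsq (d z (i, j)) * (d z (i, j) a * d z (i, j) b)"
    if "i < N" "j < N" "a < p" "b < p" for i j a b
  proof (cases "obs (Suc i) = obs (Suc j)")
    case True
    hence "d z (i, j) k = 0" if "k < p" for k using dk[OF \<open>i < N\<close> \<open>j < N\<close> that] obs_carrier[of "Suc j"] that by auto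
    moreover have "dim_vec (obs (Suc j)) = p" using obs_carrier by auto
    ultimately show ?thesis using True that by (simp add: kendall_summand_def)
  next
    case False
    have Dc: "obs (Suc i) - obs (Suc j) \<in> carrier_vec p" using obs_carrier by auto
    hence "(vec_norm (obs (Suc i) - obs (Suc j)))\<^sup>2 = nsq (d z (i, j))"
      unfolding nsq_def using dk that by (simp only: vec_norm_sq[OF Dc]) (auto intro!: sum.cong)
    moreover have "outer_prod (obs (Suc i) - obs (Suc j)) $$ (a, b) = d z (i, j) a * d z (i, j) b"
      "outer_prod (obs (Suc i) - obs (Suc j)) \<in> carrier_mat p p"
      using Dc dk that unfolding outer_prod_def by (auto simp del: index_minus_vec)
    ultimately show ?thesis using False that by (simp add: kendall_summand_def)
  qed
  have "(\<Sum>(i, j)\<in>{(i, j). 1 \<le> i \<and> i < j \<and> j \<le> N}. kendall_summand (obs i) (obs j) $$ (a, b))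
    = (\<Sum>s\<in>pairs. 1 / nsq (d z s) * (d z s a * d z s b))" if "a < p" "b < p" for a b
    by (rule sum.reindex_bij_witness[symmetric, of _ "\<lambda>(i, j). (i - 1, j - 1)" "\<lambda>(i, j). (Suc i, Suc j)"])
      (use that in \<open>auto simp: pairs_def sm\<close>)
  hence "(1 / 2 * mat_trace Sig) \<cdot>\<^sub>m kendall_tau p N obs = KM z"
    unfolding kendall_tau_def KM_def gram_def mat_trace_square[OF RR]
    by (intro eq_matI) (auto simp: NN_def sum_distrib_left divide_simps intro!: sum.cong)
  thus ?thesis by (simp add: obs_def z_def)
qed

end

section \<open>The limiting spectral distribution\<close>

theorem theorem2p2:
  fixes M :: "'a measure"
    and Z :: "nat \<Rightarrow> nat \<Rightarrow> 'a \<Rightarrow> real"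
    and p :: "nat \<Rightarrow> nat"
    and y :: real
    and mu :: "nat \<Rightarrow> real vec"
    and Sig :: "nat \<Rightarrow> real mat"
    and H :: "real measure"
  assumes "prob_space M"
    and Z_indep: "prob_space.indep_vars M (\<lambda>_. borel) (\<lambda>(i, k). Z i k) ({1..} \<times> {1..})"
    and Z_ident: "\<And>i k. 1 \<le> i \<Longrightarrow> 1 \<le> k \<Longrightarrow> distr M borel (Z i k) = distr M borel (Z 1 1)"
    and Z_mean: "\<And>i k. 1 \<le> i \<Longrightarrow> 1 \<le> k \<Longrightarrow> prob_space.expectation M (Z i k) = 0"
    and Z_variance: "\<And>i k. 1 \<le> i \<Longrightarrow> 1 \<le> k \<Longrightarrow> prob_space.variance M (Z i k) = 1 / 2"
    and Z_fourth: "\<And>i k. 1 \<le> i \<Longrightarrow> 1 \<le> k \<Longrightarrow> integrable M (\<lambda>\<omega>. Z i k \<omega> ^ 4)"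
    and p_pos: "\<And>n. n \<ge> 2 \<Longrightarrow> p n > 0"
    and p_ratio: "(\<lambda>n. real (p n) / real n) \<longlonglongrightarrow> y"
    and y: "0 < y" "y < 1"
    and mu: "\<And>q. q \<ge> 1 \<Longrightarrow> mu q \<in> carrier_vec q"
    and Sig_dim: "\<And>q. q \<ge> 1 \<Longrightarrow> Sig q \<in> carrier_mat q q"
    and Sig_pos_def: "\<And>q. q \<ge> 1 \<Longrightarrow> pos_def_mat (Sig q)"
    and Sig_bounded: "bdd_above ((\<lambda>q. spectral_norm (Sig q)) ` {1..})"
    and H: "real_distribution H"
    and H_limit: "weak_conv (\<lambda>q. esd ((1 / 2) \<cdot>\<^sub>m Sig q)) (cdf H)"
  shows "\<exists>F. real_distribution F \<and>
    (AE \<omega> in M. weak_conv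
       (\<lambda>n. esd ((1 / 2 * mat_trace (Sig (p n))) \<cdot>\<^sub>m
          kendall_tau (p n) n (observation (p n) (mu (p n)) (Sig (p n)) Z \<omega>)))
       (cdf F)) \<and>
    (\<forall>z. Im z > 0 \<longrightarrow>
       stieltjes F z =
         (LINT t|H. 1 / (complex_of_real t *
            (1 - complex_of_real y - complex_of_real y * z * stieltjes F z) - z)))"
proof -
  interpret prob_space M by fact
  define \<nu> where "\<nu> = distr M borel (Z 1 1)"
  have Z1[measurable]: "Z 1 1 \<in> borel_measurable M"
    using Z_indep by (auto simp: indep_vars_def)
  have prob_nu: "prob_space \<nu>" unfolding \<nu>_def by (rule prob_space_distr) measurable
  have nu1: "(\<integral>x. x \<partial>\<nu>) = 0" unfolding \<nu>_def by (subst integral_distr[OF Z1]) (use Z_mean[of 1 1] in auto)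
  have nu2: "(\<integral>x. x\<^sup>2 \<partial>\<nu>) = 1 / 2" unfolding \<nu>_def by (subst integral_distr[OF Z1]) (use Z_mean[of 1 1] Z_variance[of 1 1] in auto)
  have nu4: "integrable \<nu> (\<lambda>x. x ^ 4)" unfolding \<nu>_def by (subst integrable_distr_eq[OF Z1]) (use Z_fourth[of 1 1] in auto)
  obtain C0 where C0: "\<And>q. q \<ge> 1 \<Longrightarrow> spectral_norm (Sig q) \<le> C0" using Sig_bounded by (auto simp: bdd_above_def)
  define C where "C = max 1 C0"
  have C: "C > 0" "\<And>q. q \<ge> 1 \<Longrightarrow> spectral_norm (Sig q) \<le> C" using C0 by (auto simp: C_def le_max_iff_disj)
  define P where "P n = p (n + 2)" for n
  have P: "P n \<ge> 1" for n using p_pos[of "n + 2"] by (simp add: P_def)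
  define R where "R n = mat_sqrt (Sig (P n))" for n
  note Rp = mat_sqrt_pos_def[OF Sig_dim[OF P] Sig_pos_def[OF P], folded R_def]
  have setting: "sample_setting \<nu> (P n) (n + 2) (R n) C" for n
  proof (rule sample_setting.intro)
    show "prob_space \<nu>" by (rule prob_nu)
    show "(\<Sum>k<P n. (\<Sum>l<P n. R n $$ (k, l) * u l)\<^sup>2) \<le> C * (\<Sum>l<P n. (u l)\<^sup>2)" for u
      by (rule square_root_bound[OF Rp(1,2)]) (simp add: Rp(3) C(2)[OF P])
  qed (use P[of n] Rp[of n] nu1 nu2 nu4 C(1) in \<open>auto simp: \<nu>_def\<close>)
  define W where "W n \<omega> = (\<lambda>i\<in>{..<n + 2}. \<lambda>k\<in>{..<P n}. Z (Suc i) (Suc k) \<omega>)" for n \<omega>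
  have ident: "distr M borel (Z i k) = \<nu>" if "1 \<le> i" "1 \<le> k" for i k unfolding \<nu>_def by (rule Z_ident[OF that])
  have Om: "sample_setting.Om \<nu> (P n) (n + 2) = PiM {..<n + 2} (\<lambda>_. PiM {..<P n} (\<lambda>_. \<nu>))" for n
    unfolding sample_setting.Om_def[OF setting] sample_setting.Pr_def[OF setting] ..
  have ratio: "(\<lambda>n. real (P n) / real (n + 2)) \<longlonglongrightarrow> y"
    unfolding P_def by (rule LIMSEQ_ignore_initial_segment[OF p_ratio])
  have "filterlim (\<lambda>n. real (n + 2)) at_top sequentially"
    by (intro filterlim_compose[OF filterlim_real_sequentially] filterlim_add_const_nat_at_top)
  from filterlim_tendsto_pos_mult_at_top[OF ratio y(1) this]
  have P_top: "filterlim P at_top sequentially" by (simp add: filterlim_sequentially_iff_filterlim_real)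
  have H_lim: "weak_conv (\<lambda>n. esd (sample_setting.T (P n) (R n))) (cdf H)"
    unfolding sample_setting.T_eq_half_square[OF setting Rp(3)] weak_conv_def
    using H_limit filterlim_compose[OF _ P_top] by (auto simp: weak_conv_def)
  interpret mp_model M \<nu> P R C y W H
  proof (intro mp_model.intro mp_model_axioms.intro)
    show "prob_space M" by unfold_locales
    show "W n \<in> measurable M (sample_setting.Om \<nu> (P n) (n + 2))"
      and "distr M (sample_setting.Om \<nu> (P n) (n + 2)) (W n) = sample_setting.Om \<nu> (P n) (n + 2)" for n
      unfolding Om W_def[abs_def] by (rule distr_iid_array[OF Z_indep ident]; use P[of n] in simp)+
  qed (fact setting ratio y(1) H H_lim)+
  have KM: "KM n (W n \<omega>) = (1 / 2 * mat_trace (Sig (P n))) \<cdot>\<^sub>m kendall_tau (P n) (n + 2) (observation (P n) (mu (P n)) (Sig (P n)) Z \<omega>)" for n \<omega>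
    unfolding KM_def W_def
    by (rule sample_resolvent.kendall_tau_KM[OF resolvent_setting[of \<i>] mu[OF P] R_def Rp(3), symmetric]) simp
  have shift: "weak_conv f G" if "weak_conv (\<lambda>n. f (n + 2)) G" for f and G :: "real \<Rightarrow> real"
    using that unfolding weak_conv_def by (auto intro: LIMSEQ_offset[of _ 2])
  obtain F where F: "real_distribution F" "AE \<omega> in M. weak_conv (\<lambda>n. esd (KM n (W n \<omega>))) (cdf F)"
    "\<forall>z. Im z > 0 \<longrightarrow> stieltjes F z = (\<integral>t. 1 / (complex_of_real t * (1 - of_real y - of_real y * z * stieltjes F z) - z) \<partial>H)"
    using kendall_limit by blast
  have "AE \<omega> in M. weak_conv (\<lambda>n. esd ((1 / 2 * mat_trace (Sig (p n))) \<cdot>\<^sub>m kendall_tau (p n) n (observation (p n) (mu (p n)) (Sig (p n)) Z \<omega>))) (cdf F)"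
    using F(2) by eventually_elim (rule shift, simp only: KM P_def)
  thus ?thesis using F(1,3) by blast
qed

end
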